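(* Let $G$ be a finite group. If $(K,\overline{\sigma})\models G\text{-TCF}$, then the field of constants $K^G=\{a\in K:\sigma_k(a)=a\text{ for all }k\}$ is a bounded $K$-strongly PAC field.
   Context: $G=\{g_1,\dots,g_e\}$ is a finite group of order $e$ with neutral element $g_1=1$. $\mathcal{L}_G$ is the language of rings with $e$ additional unary function symbols $\sigma_1,\dots,\sigma_e$; write $\sigma_{g_k}=\sigma_k$ and $\overline{\sigma}=(\sigma_1,\dots,\sigma_e)$. A $G$-transformal ring (resp. field) is an $\mathcal{L}_G$-structure $(R,\overline{\sigma})$ such that $R$ is a commutative ring (resp. a field) and $g_k\mapsto\sigma_k$ is a group homomorphism $G\to\mathrm{Aut}(R)$. For a tuple $a$, $\sigma_k(a)$ is taken coordinatewise and $\overline{\sigma}(a)=(\sigma_1(a),\dots,\sigma_e(a))$. Let $G$ act on $\{1,\dots,e\}$ by $g_k\ast l=j$ iff $g_kg_l=g_j$. For $n\geq 1$ let $\mathbf{X}_i=(X_{i,1},\dots,X_{i,n})$, $i\leq e$, be $n$-tuples of variables. For a $G$-transformal field $(K,\overline{\sigma})$, the ring $K[\mathbf{X}_1,\dots,\mathbf{X}_e]$ is a $G$-transformal ring via $\sigma_{g_k}(f(\mathbf{X}_1,\dots,\mathbf{X}_e))=f^{\sigma_{g_k}}(\mathbf{X}_{g_k\ast 1},\dots,\mathbf{X}_{g_k\ast e})$, where $f^{\sigma}$ is obtained by applying $\sigma$ to the coefficients. An ideal $I$ is $G$-invariant if $\sigma_k(I)\subseteq I$ for all $k\leq e$. Put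 $V_K(I)=\{r\in K^{ne}: f(r)=0\text{ for all }f\in I\}$. A $G$-transformal field $(K,\overline{\sigma})$ is a model of $G$-TCF if for every $n\geq 1$ and all ideals $I,J$ of $K[\mathbf{X}_1,\dots,\mathbf{X}_e]$ such that $I\subsetneq J$ and $I$ is a $G$-invariant prime ideal, there is $a\in K^n$ with $\overline{\sigma}(a)\in V_K(I)\setminus V_K(J)$. A field $F$ is $K$-strongly PAC if $F\subseteq K$ and every $K$-irreducible $F$-variety (i.e. every $F$-variety $V$ such that $V\times_{\mathrm{Spec}(F)}\mathrm{Spec}(K)$ is irreducible) has an $F$-rational point. A field $F$ is bounded if for every $n>0$ there are only finitely many extensions of $F$ of degree $n$ inside a fixed algebraic closure $F^{\mathrm{alg}}$. *)

theory Defs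
  imports
    "HOL-Library.Poly_Mapping"
    "HOL-Analysis.Function_Topology"
    "HOL-Algebra.Algebra"
    "HOL-Algebra.Algebraic_Closure_Type"
begin

section \<open>G-transformal fields and the theory G-TCF\<close>

text \<open>
  A field is given as a type of class \<^class>\<open>field\<close>; \<^const>\<open>ring_of_type_algebra\<close> turns it into
  a ring record. The operators \<open>\<sigma>\<close> and the blocks of variables are indexed by the
  elements of \<open>G\<close> instead of by an enumeration of them.
\<close>

definition transformal_field :: "('g, 'm) monoid_scheme \<Rightarrow> ('g \<Rightarrow> 'k::field \<Rightarrow> 'k) \<Rightarrow> bool" where
  "transformal_field G \<sigma> \<longleftrightarrow>
     (\<forall>g\<in>carrier G. \<sigma> g \<in> ring_iso ring_of_type_algebra ring_of_type_algebra) \<and>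
     (\<forall>g\<in>carrier G. \<forall>h\<in>carrier G. \<sigma> (g \<otimes>\<^bsub>G\<^esub> h) = \<sigma> g \<circ> \<sigma> h)"

definition constants :: "('g, 'm) monoid_scheme \<Rightarrow> ('g \<Rightarrow> 'k::field \<Rightarrow> 'k) \<Rightarrow> 'k set" where
  "constants G \<sigma> = {a. \<forall>g\<in>carrier G. \<sigma> g a = a}"

type_synonym ('x, 'k) mpoly = "('x \<Rightarrow>\<^sub>0 nat) \<Rightarrow>\<^sub>0 'k"

text \<open>The polynomial ring over \<open>'k\<close> in the variables from \<open>S\<close>.\<close>

definition mpoly_ring :: "'x set \<Rightarrow> ('x, 'k::field) mpoly ring" where
  "mpoly_ring S = ring_of_type_algebra
     \<lparr>carrier := {f. \<forall>m\<in>Poly_Mapping.keys f. Poly_Mapping.keys m \<subseteq> S}\<rparr>"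

text \<open>Apply \<open>\<phi>\<close> to the coefficients and substitute \<open>\<rho> v\<close> for each variable \<open>v\<close>.\<close>

definition mpoly_subst ::
  "('k::field \<Rightarrow> 'r::comm_ring_1) \<Rightarrow> ('x \<Rightarrow> 'r) \<Rightarrow> ('x, 'k) mpoly \<Rightarrow> 'r" where
  "mpoly_subst \<phi> \<rho> f =
     (\<Sum>m\<in>Poly_Mapping.keys f. \<phi> (Poly_Mapping.lookup f m) *
        (\<Prod>v\<in>Poly_Mapping.keys m. \<rho> v ^ Poly_Mapping.lookup m v))"

definition mpoly_const :: "'k::field \<Rightarrow> ('x, 'k) mpoly" where
  "mpoly_const c = Poly_Mapping.single 0 c"

definition mpoly_var :: "'x \<Rightarrow> ('x, 'k::field) mpoly" where
  "mpoly_var v = Poly_Mapping.single (Poly_Mapping.single v 1) 1"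

text \<open>The pair \<open>(g, i)\<close> is the \<open>i\<close>-th variable (counted from 0) of the block attached to \<open>g\<close>.\<close>

definition block_vars :: "('g, 'm) monoid_scheme \<Rightarrow> nat \<Rightarrow> ('g \<times> nat) set" where
  "block_vars G n = carrier G \<times> {..<n}"

definition mpoly_act :: "('g, 'm) monoid_scheme \<Rightarrow> ('g \<Rightarrow> 'k::field \<Rightarrow> 'k) \<Rightarrow>
    'g \<Rightarrow> ('g \<times> nat, 'k) mpoly \<Rightarrow> ('g \<times> nat, 'k) mpoly" where
  "mpoly_act G \<sigma> g =
     mpoly_subst (\<lambda>c. mpoly_const (\<sigma> g c)) (\<lambda>(h, i). mpoly_var (g \<otimes>\<^bsub>G\<^esub> h, i))"

definition invariant_ideal :: "('g, 'm) monoid_scheme \<Rightarrow> ('g \<Rightarrow> 'k::field \<Rightarrow> 'k) \<Rightarrow>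
    ('g \<times> nat, 'k) mpoly set \<Rightarrow> bool" where
  "invariant_ideal G \<sigma> I \<longleftrightarrow> (\<forall>g\<in>carrier G. mpoly_act G \<sigma> g ` I \<subseteq> I)"

text \<open>
  Points are total functions on the variable names; for \<open>I\<close> in \<^term>\<open>mpoly_ring S\<close>
  only the coordinates in \<open>S\<close> matter.
\<close>

definition zero_locus :: "('x, 'k::field) mpoly set \<Rightarrow> ('x \<Rightarrow> 'k) set" where
  "zero_locus I = {r. \<forall>f\<in>I. mpoly_subst (\<lambda>c. c) r f = 0}"

definition sigma_tuple :: "('g \<Rightarrow> 'k \<Rightarrow> 'k) \<Rightarrow> (nat \<Rightarrow> 'k) \<Rightarrow> 'g \<times> nat \<Rightarrow> 'k" where
  "sigma_tuple \<sigma> a = (\<lambda>(g, i). \<sigma> g (a i))"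

definition models_G_TCF :: "('g, 'm) monoid_scheme \<Rightarrow> ('g \<Rightarrow> 'k::field \<Rightarrow> 'k) \<Rightarrow> bool" where
  "models_G_TCF G \<sigma> \<longleftrightarrow> transformal_field G \<sigma> \<and>
     (\<forall>n\<ge>1. \<forall>I J. ideal I (mpoly_ring (block_vars G n)) \<and> ideal J (mpoly_ring (block_vars G n)) \<and>
        I \<subset> J \<and> invariant_ideal G \<sigma> I \<and> primeideal I (mpoly_ring (block_vars G n)) \<longrightarrow>
        (\<exists>a. sigma_tuple \<sigma> a \<in> zero_locus I - zero_locus J))"


section \<open>Schemes\<close>

text \<open>
  A space \<open>topo\<close> with a presheaf of rings \<open>sect\<close>, restriction maps \<open>rstr U V\<close> from \<open>U\<close> to \<open>V\<close>,
  and a map \<open>cst\<close> from the base field to the global sections. Morphisms to the spectrum of a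
  field \<open>F\<close> are the same as ring homomorphisms from \<open>F\<close> to the global sections. Only the
  values of \<open>sect\<close> and \<open>rstr\<close> on open sets, and of \<open>cst\<close> on the base field, are relevant.
\<close>

record ('v, 'b, 'k) ringed_space =
  topo :: "'v topology"
  sect :: "'v set \<Rightarrow> 'b ring"
  rstr :: "'v set \<Rightarrow> 'v set \<Rightarrow> 'b \<Rightarrow> 'b"
  cst  :: "'k \<Rightarrow> 'b"

definition presheaf :: "('v, 'b, 'k) ringed_space \<Rightarrow> bool" where
  "presheaf Z \<longleftrightarrow>
     (\<forall>U. openin (topo Z) U \<longrightarrow> cring (sect Z U) \<and> (\<forall>s\<in>carrier (sect Z U). rstr Z U U s = s)) \<and>
     (\<forall>U V. openin (topo Z) U \<and> openin (topo Z) V \<and> V \<subseteq> U \<longrightarrow>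
        rstr Z U V \<in> ring_hom (sect Z U) (sect Z V)) \<and>
     (\<forall>U V W. openin (topo Z) U \<and> openin (topo Z) V \<and> openin (topo Z) W \<and> W \<subseteq> V \<and> V \<subseteq> U \<longrightarrow>
        (\<forall>s\<in>carrier (sect Z U). rstr Z V W (rstr Z U V s) = rstr Z U W s))"

definition sheaf :: "('v, 'b, 'k) ringed_space \<Rightarrow> bool" where
  "sheaf Z \<longleftrightarrow> presheaf Z \<and>
     (\<forall>\<C>. (\<forall>U\<in>\<C>. openin (topo Z) U) \<longrightarrow>
        (\<forall>s\<in>carrier (sect Z (\<Union>\<C>)). \<forall>t\<in>carrier (sect Z (\<Union>\<C>)).
           (\<forall>U\<in>\<C>. rstr Z (\<Union>\<C>) U s = rstr Z (\<Union>\<C>) U t) \<longrightarrow> s = t) \<and>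
        (\<forall>f. (\<forall>U\<in>\<C>. f U \<in> carrier (sect Z U)) \<and>
             (\<forall>U\<in>\<C>. \<forall>V\<in>\<C>. rstr Z U (U \<inter> V) (f U) = rstr Z V (U \<inter> V) (f V)) \<longrightarrow>
             (\<exists>s\<in>carrier (sect Z (\<Union>\<C>)). \<forall>U\<in>\<C>. rstr Z (\<Union>\<C>) U s = f U)))"

text \<open>The germ of \<open>s\<close> at \<open>x\<close> is a unit of the stalk iff \<open>s\<close> is a unit on a neighbourhood of \<open>x\<close>.\<close>

definition unit_germ :: "('v, 'b, 'k) ringed_space \<Rightarrow> 'v set \<Rightarrow> 'b \<Rightarrow> 'v \<Rightarrow> bool" where
  "unit_germ Z U s x \<longleftrightarrow>
     (\<exists>W. openin (topo Z) W \<and> x \<in> W \<and> W \<subseteq> U \<and> rstr Z U W s \<in> Units (sect Z W))"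

text \<open>A commutative ring is local iff 0 is not a unit and one of \<open>s\<close>, \<open>t\<close> is a unit whenever
  \<open>s + t\<close> is.\<close>

definition locally_ringed :: "('v, 'b, 'k) ringed_space \<Rightarrow> bool" where
  "locally_ringed Z \<longleftrightarrow> sheaf Z \<and>
     (\<forall>U x. openin (topo Z) U \<and> x \<in> U \<longrightarrow>
        \<not> unit_germ Z U \<zero>\<^bsub>sect Z U\<^esub> x \<and>
        (\<forall>s\<in>carrier (sect Z U). \<forall>t\<in>carrier (sect Z U).
           unit_germ Z U (s \<oplus>\<^bsub>sect Z U\<^esub> t) x \<longrightarrow> unit_germ Z U s x \<or> unit_germ Z U t x))"

definition zariski :: "('b, 'm) ring_scheme \<Rightarrow> 'b set topology" where
  "zariski A = topology_generated_by {{P. primeideal P A \<and> f \<notin> P} | f. f \<in> carrier A}"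

text \<open>
  The open subspace \<open>U\<close> is an affine scheme iff the canonical morphism from \<open>U\<close> to the spectrum
  of \<open>A = sect Z U\<close> is an isomorphism. On points this morphism sends \<open>x\<close> to the sections
  vanishing at \<open>x\<close>. On sheaves it suffices to test the basic open sets \<open>D\<close> of points where a given
  \<open>f\<close> does not vanish, and there the condition is that restriction from \<open>U\<close> to \<open>D\<close> is the
  localization of \<open>A\<close> at the powers of \<open>f\<close>.
\<close>

definition affine_open :: "('v, 'b, 'k) ringed_space \<Rightarrow> 'v set \<Rightarrow> bool" where
  "affine_open Z U \<longleftrightarrow> openin (topo Z) U \<and>
     (let A = sect Z U in
       homeomorphic_map (subtopology (topo Z) U) (zariski A)
         (\<lambda>x. {s \<in> carrier A. \<not> unit_germ Z U s x}) \<and>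
       (\<forall>f\<in>carrier A. let D = {x \<in> U. unit_germ Z U f x}; B = sect Z D in
          rstr Z U D f \<in> Units B \<and>
          (\<forall>t\<in>carrier B. \<exists>a\<in>carrier A. \<exists>n::nat.
             t \<otimes>\<^bsub>B\<^esub> rstr Z U D f [^]\<^bsub>B\<^esub> n = rstr Z U D a) \<and>
          (\<forall>a\<in>carrier A. rstr Z U D a = \<zero>\<^bsub>B\<^esub> \<longrightarrow>
             (\<exists>n::nat. f [^]\<^bsub>A\<^esub> n \<otimes>\<^bsub>A\<^esub> a = \<zero>\<^bsub>A\<^esub>))))"

definition scheme :: "('v, 'b, 'k) ringed_space \<Rightarrow> bool" where
  "scheme Z \<longleftrightarrow> locally_ringed Z \<and> (\<forall>x\<in>topspace (topo Z). \<exists>U. affine_open Z U \<and> x \<in> U)"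

text \<open>Meaningful when \<open>F\<close> is a subfield of the type.\<close>

abbreviation field_on :: "'k::field set \<Rightarrow> 'k ring" where
  "field_on F \<equiv> ring_of_type_algebra \<lparr>carrier := F\<rparr>"

definition scheme_over :: "'k::field set \<Rightarrow> ('v, 'b, 'k) ringed_space \<Rightarrow> bool" where
  "scheme_over F Z \<longleftrightarrow> scheme Z \<and> cst Z \<in> ring_hom (field_on F) (sect Z (topspace (topo Z)))"

definition cst_on :: "('v, 'b, 'k) ringed_space \<Rightarrow> 'v set \<Rightarrow> 'k \<Rightarrow> 'b" where
  "cst_on Z U c = rstr Z (topspace (topo Z)) U (cst Z c)"

text \<open>
  A variety over \<open>F\<close> is a scheme of finite type over \<open>F\<close>. Neither reducedness nor separatedness
  nor irreducibility is required.
\<close>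

definition variety_over :: "'k::field set \<Rightarrow> ('v, 'b, 'k) ringed_space \<Rightarrow> bool" where
  "variety_over F Z \<longleftrightarrow> scheme_over F Z \<and>
     (\<exists>\<C>. finite \<C> \<and> \<Union>\<C> = topspace (topo Z) \<and>
        (\<forall>U\<in>\<C>. affine_open Z U \<and>
           (\<exists>S. finite S \<and> S \<subseteq> carrier (sect Z U) \<and>
              generate_ring (sect Z U) (cst_on Z U ` F \<union> S) = carrier (sect Z U))))"

text \<open>A point \<open>x\<close> is \<open>F\<close>-rational iff the map from \<open>F\<close> to the residue field at \<open>x\<close> is onto.\<close>

definition rational_point :: "'k::field set \<Rightarrow> ('v, 'b, 'k) ringed_space \<Rightarrow> 'v \<Rightarrow> bool" where
  "rational_point F Z x \<longleftrightarrow> x \<in> topspace (topo Z) \<and>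
     (\<forall>U. openin (topo Z) U \<and> x \<in> U \<longrightarrow>
        (\<forall>s\<in>carrier (sect Z U). \<exists>c\<in>F. \<not> unit_germ Z U (s \<ominus>\<^bsub>sect Z U\<^esub> cst_on Z U c) x))"


section \<open>Base change\<close>

text \<open>A morphism over \<open>F\<close> of locally ringed spaces, with map \<open>p\<close> on points and comorphism \<open>q\<close>.\<close>

definition morphism_over :: "'k::field set \<Rightarrow> ('w, 'c, 'k) ringed_space \<Rightarrow>
    ('v, 'b, 'k) ringed_space \<Rightarrow> ('w \<Rightarrow> 'v) \<Rightarrow> ('v set \<Rightarrow> 'b \<Rightarrow> 'c) \<Rightarrow> bool" where
  "morphism_over F Y Z p q \<longleftrightarrow>
     continuous_map (topo Y) (topo Z) p \<and>
     (let pre = (\<lambda>U. {y \<in> topspace (topo Y). p y \<in> U}) in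
       (\<forall>U. openin (topo Z) U \<longrightarrow> q U \<in> ring_hom (sect Z U) (sect Y (pre U))) \<and>
       (\<forall>U V. openin (topo Z) U \<and> openin (topo Z) V \<and> V \<subseteq> U \<longrightarrow>
          (\<forall>s\<in>carrier (sect Z U). rstr Y (pre U) (pre V) (q U s) = q V (rstr Z U V s))) \<and>
       (\<forall>U. openin (topo Z) U \<longrightarrow> (\<forall>s\<in>carrier (sect Z U). \<forall>y\<in>pre U.
          unit_germ Y (pre U) (q U s) y \<longrightarrow> unit_germ Z U s (p y))) \<and>
       (\<forall>c\<in>F. q (topspace (topo Z)) (cst Z c) = cst Y c))"

definition lin_indep_over :: "'k::field set \<Rightarrow> 'k set \<Rightarrow> bool" where
  "lin_indep_over F B \<longleftrightarrow>
     (\<forall>c. (\<forall>k\<in>B. c k \<in> F) \<and> (\<Sum>k\<in>B. c k * k) = 0 \<longrightarrow> (\<forall>k\<in>B. c k = 0))"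

text \<open>
  For an \<open>F\<close>-algebra \<open>A\<close> and ring homomorphisms \<open>\<alpha>\<close> from \<open>A\<close> and \<open>\<beta>\<close> from \<open>'k\<close> to \<open>T\<close> that agree
  on \<open>F\<close>: the induced map from the tensor product of \<open>A\<close> and \<open>'k\<close> over \<open>F\<close> to \<open>T\<close> is surjective
  (first condition) and injective (second condition; every element of the tensor product is a
  sum of pure tensors \<open>a k \<otimes> k\<close> with \<open>k\<close> running through a finite \<open>F\<close>-independent set, and it
  is zero iff all \<open>a k\<close> are).
\<close>

definition is_tensor_with_field :: "'k::field set \<Rightarrow> 'b ring \<Rightarrow> 'c ring \<Rightarrow>
    ('b \<Rightarrow> 'c) \<Rightarrow> ('k \<Rightarrow> 'c) \<Rightarrow> bool" where
  "is_tensor_with_field F A T \<alpha> \<beta> \<longleftrightarrow>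
     (\<forall>t\<in>carrier T. \<exists>B a. finite B \<and> a \<in> B \<rightarrow> carrier A \<and>
        t = (\<Oplus>\<^bsub>T\<^esub>k\<in>B. \<alpha> (a k) \<otimes>\<^bsub>T\<^esub> \<beta> k)) \<and>
     (\<forall>B a. finite B \<and> lin_indep_over F B \<and> a \<in> B \<rightarrow> carrier A \<and>
        (\<Oplus>\<^bsub>T\<^esub>k\<in>B. \<alpha> (a k) \<otimes>\<^bsub>T\<^esub> \<beta> k) = \<zero>\<^bsub>T\<^esub> \<longrightarrow>
        (\<forall>k\<in>B. a k = \<zero>\<^bsub>A\<^esub>))"

text \<open>
  \<open>W\<close>, with projection \<open>(p, q)\<close>, is the fibre product of \<open>Z\<close> with the spectrum of \<open>'k\<close> over the
  spectrum of \<open>F\<close>: over each affine open \<open>U\<close> of \<open>Z\<close>, it is the spectrum of the tensor product of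
  \<open>sect Z U\<close> with \<open>'k\<close> over \<open>F\<close>.
\<close>

definition is_base_change :: "'k::field set \<Rightarrow> ('v, 'b, 'k) ringed_space \<Rightarrow>
    ('w, 'c, 'k) ringed_space \<Rightarrow> ('w \<Rightarrow> 'v) \<Rightarrow> ('v set \<Rightarrow> 'b \<Rightarrow> 'c) \<Rightarrow> bool" where
  "is_base_change F Z W p q \<longleftrightarrow>
     scheme_over UNIV W \<and> morphism_over F W Z p q \<and>
     (\<forall>U. affine_open Z U \<longrightarrow>
        (let U' = {w \<in> topspace (topo W). p w \<in> U} in
          affine_open W U' \<and>
          is_tensor_with_field F (sect Z U) (sect W U') (q U) (cst_on W U')))"

definition irreducible_space :: "'w topology \<Rightarrow> bool" where
  "irreducible_space T \<longleftrightarrow> topspace T \<noteq> {} \<and>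
     (\<forall>A B. closedin T A \<and> closedin T B \<and> A \<union> B = topspace T \<longrightarrow>
        A = topspace T \<or> B = topspace T)"

text \<open>
  The type arguments are the types of the points and of the sections of the base change, which
  is unique up to isomorphism.
\<close>

definition irreducible_over_field :: "'w itself \<Rightarrow> 'c itself \<Rightarrow> 'k::field set \<Rightarrow>
    ('v, 'b, 'k) ringed_space \<Rightarrow> bool" where
  "irreducible_over_field (_ :: 'w itself) (_ :: 'c itself) F Z \<longleftrightarrow>
     (\<exists>(W :: ('w, 'c, 'k) ringed_space) p q. is_base_change F Z W p q \<and> irreducible_space (topo W))"


section \<open>Strongly PAC fields and bounded fields\<close>

text \<open>
  The subfield \<open>F\<close> of \<open>K = 'k\<close> is \<open>K\<close>-strongly PAC. The type arguments are those of the points and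
  sections of the varieties and of their base changes; a statement polymorphic in them covers
  all varieties.
\<close>

definition strongly_PAC :: "'v itself \<Rightarrow> 'b itself \<Rightarrow> 'w itself \<Rightarrow> 'c itself \<Rightarrow>
    'k::field set \<Rightarrow> bool" where
  "strongly_PAC (_ :: 'v itself) (_ :: 'b itself) (_ :: 'w itself) (_ :: 'c itself) F \<longleftrightarrow>
     subfield F (ring_of_type_algebra :: 'k ring) \<and>
     (\<forall>Z :: ('v, 'b, 'k) ringed_space.
        variety_over F Z \<and> irreducible_over_field TYPE('w) TYPE('c) F Z \<longrightarrow>
        (\<exists>x. rational_point F Z x))"

text \<open>
  The elements of the algebraic closure of \<open>'k\<close> that are algebraic over the subfield \<open>F\<close> form an
  algebraic closure of \<open>F\<close>.
\<close>

definition alg_closure_of :: "'k::field set \<Rightarrow> 'k alg_closure set" where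
  "alg_closure_of F = {x. ring.algebraic ring_of_type_algebra (to_ac ` F) x}"

definition bounded_field :: "'k::field set \<Rightarrow> bool" where
  "bounded_field F \<longleftrightarrow> subfield F (ring_of_type_algebra :: 'k ring) \<and>
     (\<forall>n>0. finite {L. subfield L (ring_of_type_algebra :: 'k alg_closure ring) \<and>
        to_ac ` F \<subseteq> L \<and> L \<subseteq> alg_closure_of F \<and>
        ring.dimension ring_of_type_algebra n (to_ac ` F) L})"

end

theory Submission imports Defs
begin

text \<open>
  Let \<open>F\<close> be the field of constants and \<open>\<Omega>\<close> the algebraic closure of \<open>K\<close>. Points are produced by
  applying the axioms of G-TCF to the ideal of all polynomials in the variables \<open>(g, i)\<close> that
  vanish (or become nilpotent) when \<open>(g, i)\<close> is replaced by an element \<open>s i\<close> not depending on \<open>g\<close>.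
  Its zeros \<open>\<sigma>(a)\<close> satisfy \<open>\<sigma> g (a i) = a i\<close>, so \<open>a\<close> consists of constants.

  Boundedness: extend each \<open>\<sigma> g\<close> to an endomorphism \<open>\<tau> g\<close> of \<open>\<Omega>\<close>. If \<open>x\<close> is fixed by all \<open>\<tau> g\<close>, the
  choice \<open>s i = x\<close> gives a root in \<open>F\<close> of the minimal polynomial of \<open>x\<close> over \<open>K\<close>, whence \<open>x\<close> lies in
  \<open>F\<close>. So \<open>F\<close> is the fixed field of the finitely many \<open>\<tau> g\<close>. By the independence of characters and
  Artin's theorem, an extension \<open>L\<close> of degree \<open>n\<close> is determined by the action of the \<open>\<tau> g\<close> on the at
  most \<open>n\<close> embeddings of \<open>L\<close> that they generate, and there are finitely many such actions.

  Rational points: if \<open>A\<close> is the coordinate ring of an affine chart with generators \<open>s i\<close> and its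
  tensor product \<open>T\<close> with \<open>K\<close> has prime nilradical, the polynomials that become nilpotent in \<open>T\<close>
  form an invariant prime ideal. The constants \<open>a i\<close> obtained from it define a homomorphism of
  \<open>F\<close>-algebras from \<open>A\<close> to \<open>F\<close>.
\<close>

section \<open>Rings of types\<close>

lemma type_ring_simps [simp]:
  "carrier (ring_of_type_algebra :: 'a::comm_ring_1 ring) = UNIV"
  "monoid.mult (ring_of_type_algebra :: 'a::comm_ring_1 ring) = (*)"
  "monoid.one (ring_of_type_algebra :: 'a::comm_ring_1 ring) = 1"
  "ring.zero (ring_of_type_algebra :: 'a::comm_ring_1 ring) = 0"
  "ring.add (ring_of_type_algebra :: 'a::comm_ring_1 ring) = (+)"
  by (auto simp: ring_of_type_algebra_def fun_eq_iff)

lemma type_ring_cring: "cring (ring_of_type_algebra :: 'a::comm_ring_1 ring)"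
  by (rule cring_from_type_algebra)

lemma type_ring_field: "field (ring_of_type_algebra :: 'a::field ring)"
  by (rule field_from_type_algebra)

lemma type_ring_pow [simp]:
  "x [^]\<^bsub>(ring_of_type_algebra :: 'a::comm_ring_1 ring)\<^esub> (n::nat) = x ^ n"
proof -
  interpret cring "ring_of_type_algebra :: 'a ring" by (rule type_ring_cring)
  show ?thesis by (induction n) (auto simp: mult.commute)
qed

lemma type_ring_finsum [simp]:
  "finsum (ring_of_type_algebra :: 'a::comm_ring_1 ring) f A = sum f A"
proof -
  interpret cring "ring_of_type_algebra :: 'a ring" by (rule type_ring_cring)
  show ?thesis by (induction A rule: infinite_finite_induct) auto
qed

lemma type_ring_finprod [simp]:
  "finprod (ring_of_type_algebra :: 'a::comm_ring_1 ring) f A = prod f A"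
proof -
  interpret cring "ring_of_type_algebra :: 'a ring" by (rule type_ring_cring)
  show ?thesis by (induction A rule: infinite_finite_induct) auto
qed

lemma type_ring_a_inv [simp]:
  "a_inv (ring_of_type_algebra :: 'a::comm_ring_1 ring) x = - x"
proof -
  interpret cring "ring_of_type_algebra :: 'a ring" by (rule type_ring_cring)
  show ?thesis by (rule minus_equality) auto
qed

lemma type_ring_minus [simp]:
  "a_minus (ring_of_type_algebra :: 'a::comm_ring_1 ring) x y = x - y"
  by (simp add: a_minus_def)

lemma type_ring_m_inv:
  "x \<noteq> 0 \<Longrightarrow> m_inv (ring_of_type_algebra :: 'a::field ring) x = inverse x"
proof -
  interpret field "ring_of_type_algebra :: 'a ring" by (rule type_ring_field)
  show "x \<noteq> 0 \<Longrightarrow> inv\<^bsub>ring_of_type_algebra\<^esub> x = inverse x"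
    by (rule comm_inv_char) auto
qed

lemma type_ring_carrier_update [simp]:
  "ring_of_type_algebra \<lparr>carrier := UNIV\<rparr> = (ring_of_type_algebra :: 'a::comm_ring_1 ring)"
  by (simp add: ring_of_type_algebra_def)

section \<open>Evaluation of polynomials\<close>

definition monom_eval :: "('r, 'm) ring_scheme \<Rightarrow> ('x \<Rightarrow> 'r) \<Rightarrow> ('x \<Rightarrow>\<^sub>0 nat) \<Rightarrow> 'r" where
  "monom_eval R \<rho> m = (\<Otimes>\<^bsub>R\<^esub>v\<in>Poly_Mapping.keys m. \<rho> v [^]\<^bsub>R\<^esub> Poly_Mapping.lookup m v)"

text \<open>The target is an arbitrary ring record, so the same evaluation serves for rings of
  sections, which are not given by a type. For rings of types it is \<open>mpoly_subst\<close>, by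
  \<open>mpoly_subst_eq_poly_eval\<close>.\<close>

definition poly_eval ::
  "('r, 'm) ring_scheme \<Rightarrow> ('k::zero \<Rightarrow> 'r) \<Rightarrow> ('x \<Rightarrow> 'r) \<Rightarrow> (('x \<Rightarrow>\<^sub>0 nat) \<Rightarrow>\<^sub>0 'k) \<Rightarrow> 'r" where
  "poly_eval R \<phi> \<rho> f =
     (\<Oplus>\<^bsub>R\<^esub>m\<in>Poly_Mapping.keys f. \<phi> (Poly_Mapping.lookup f m) \<otimes>\<^bsub>R\<^esub> monom_eval R \<rho> m)"

text \<open>This serves on two levels: polynomials as sums of terms, and exponents as sums of powers
  of one variable. In the step \<open>m\<close> may already be a key of \<open>f\<close>, which is
  harmless for the additive properties proved this way.\<close>

lemma poly_mapping_add_single_induct [case_names zero add]: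
  fixes f :: "'a \<Rightarrow>\<^sub>0 'b::monoid_add"
  assumes "P 0" and "\<And>f m c. P f \<Longrightarrow> P (Poly_Mapping.single m c + f)"
  shows "P f"
proof (induction f rule: update_induct)
  case const
  then show ?case by (rule assms(1))
next
  case (update f a b)
  have "Poly_Mapping.update a b f = Poly_Mapping.single a b + f"
    using update(1)
    by (intro poly_mapping_eqI) (auto simp: lookup_update lookup_add lookup_single when_def in_keys_iff)
  with update(3) assms(2) show ?case by simp
qed

context cring
begin

lemma monom_eval_closed [simp]:
  assumes "\<And>v. \<rho> v \<in> carrier R"
  shows "monom_eval R \<rho> m \<in> carrier R"
  unfolding monom_eval_def using assms by (auto intro!: finprod_closed)

text \<open>Variables outside the support have exponent 0 and contribute a factor 1. This puts
  monomials with different supports over one index set.\<close>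

lemma monom_eval_superset:
  assumes "\<And>v. \<rho> v \<in> carrier R" "finite V" "Poly_Mapping.keys m \<subseteq> V"
  shows "monom_eval R \<rho> m = (\<Otimes>v\<in>V. \<rho> v [^] Poly_Mapping.lookup m v)"
  unfolding monom_eval_def using assms
  by (intro finprod_mono_neutral_cong_left) (auto simp: in_keys_iff)

lemma monom_eval_add:
  assumes "\<And>v. \<rho> v \<in> carrier R"
  shows "monom_eval R \<rho> (m + m') = monom_eval R \<rho> m \<otimes> monom_eval R \<rho> m'"
proof -
  let ?V = "Poly_Mapping.keys m \<union> Poly_Mapping.keys m'"
  have "monom_eval R \<rho> (m + m') = (\<Otimes>v\<in>?V. \<rho> v [^] Poly_Mapping.lookup (m + m') v)"
    by (rule monom_eval_superset) (use assms keys_add[of m m'] in auto)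
  also have "\<dots> = (\<Otimes>v\<in>?V. \<rho> v [^] Poly_Mapping.lookup m v \<otimes> \<rho> v [^] Poly_Mapping.lookup m' v)"
    by (rule finprod_cong') (use assms in \<open>auto simp: lookup_add nat_pow_mult\<close>)
  also have "\<dots> = (\<Otimes>v\<in>?V. \<rho> v [^] Poly_Mapping.lookup m v) \<otimes> (\<Otimes>v\<in>?V. \<rho> v [^] Poly_Mapping.lookup m' v)"
    by (rule finprod_multf) (use assms in auto)
  also have "\<dots> = monom_eval R \<rho> m \<otimes> monom_eval R \<rho> m'"
    using assms by (simp add: monom_eval_superset[of \<rho> ?V])
  finally show ?thesis .
qed

lemma monom_eval_0 [simp]: "monom_eval R \<rho> 0 = \<one>"
  by (simp add: monom_eval_def)

lemma monom_eval_single: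
  assumes "\<And>v. \<rho> v \<in> carrier R"
  shows "monom_eval R \<rho> (Poly_Mapping.single v k) = \<rho> v [^] k"
  using monom_eval_superset[of \<rho> "{v}" "Poly_Mapping.single v k"] assms by simp

end

locale poly_evaluation = cring R for R (structure) +
  fixes \<phi> :: "'k::comm_ring_1 \<Rightarrow> 'a" and \<rho> :: "'x \<Rightarrow> 'a"
  assumes coeff_hom: "\<phi> \<in> ring_hom ring_of_type_algebra R"
    and point_closed [simp]: "\<rho> v \<in> carrier R"
begin

sublocale \<phi>: ring_hom_cring ring_of_type_algebra R \<phi>
  by (intro ring_hom_cringI ring_hom_cring.intro type_ring_cring cring_axioms ring_hom_cring_axioms.intro coeff_hom)

lemma coeff_map [simp]:
  "\<phi> c \<in> carrier R" "\<phi> 0 = \<zero>" "\<phi> 1 = \<one>" "\<phi> (c + d) = \<phi> c \<oplus> \<phi> d" "\<phi> (c * d) = \<phi> c \<otimes> \<phi> d"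
  using \<phi>.hom_closed[of c] \<phi>.hom_zero \<phi>.hom_one \<phi>.hom_add[of c d] \<phi>.hom_mult[of c d] by auto

abbreviation "pe \<equiv> poly_eval R \<phi> \<rho>"
abbreviation "me \<equiv> monom_eval R \<rho>"

lemma eval_closed [simp]: "pe f \<in> carrier R"
  unfolding poly_eval_def by (auto intro!: finsum_closed)

lemma eval_superset:
  assumes "finite V" "Poly_Mapping.keys f \<subseteq> V"
  shows "pe f = (\<Oplus>m\<in>V. \<phi> (Poly_Mapping.lookup f m) \<otimes> me m)"
  unfolding poly_eval_def using assms
  by (intro add.finprod_mono_neutral_cong_left) (auto simp: in_keys_iff)

lemma eval_0 [simp]: "pe 0 = \<zero>"
  by (simp add: poly_eval_def)

lemma eval_add [simp]: "pe (f + g) = pe f \<oplus> pe g"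
proof -
  let ?V = "Poly_Mapping.keys f \<union> Poly_Mapping.keys g"
  have "pe (f + g) = (\<Oplus>m\<in>?V. \<phi> (Poly_Mapping.lookup (f + g) m) \<otimes> me m)"
    by (rule eval_superset) (use keys_add[of f g] in auto)
  also have "\<dots> = (\<Oplus>m\<in>?V. \<phi> (Poly_Mapping.lookup f m) \<otimes> me m \<oplus> \<phi> (Poly_Mapping.lookup g m) \<otimes> me m)"
    by (rule finsum_cong') (auto simp: lookup_add l_distr)
  also have "\<dots> = (\<Oplus>m\<in>?V. \<phi> (Poly_Mapping.lookup f m) \<otimes> me m) \<oplus>
      (\<Oplus>m\<in>?V. \<phi> (Poly_Mapping.lookup g m) \<otimes> me m)"
    by (rule finsum_addf) auto
  also have "\<dots> = pe f \<oplus> pe g"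
    by (simp add: eval_superset[of ?V])
  finally show ?thesis .
qed

lemma eval_single: "pe (Poly_Mapping.single m c) = \<phi> c \<otimes> me m"
  using eval_superset[of "{m}" "Poly_Mapping.single m c"] by simp

lemma eval_mult [simp]: "pe (f * g) = pe f \<otimes> pe g"
proof -
  \<comment> \<open>A single term as left factor comes first; general products then follow by
    distributivity.\<close>
  have *: "pe (Poly_Mapping.single m c * g) = pe (Poly_Mapping.single m c) \<otimes> pe g" for m c g
  proof (induction g rule: poly_mapping_add_single_induct)
    case (add g m' c')
    then show ?case
      by (simp add: distrib_left mult_single eval_single monom_eval_add r_distr m_ac)
  qed auto
  show ?thesis
    by (induction f rule: poly_mapping_add_single_induct) (auto simp: distrib_right * l_distr)
qed

lemma eval_1 [simp]: "pe 1 = \<one>"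
  using eval_single[of 0 1] by simp

lemma eval_power [simp]: "pe (f ^ n) = pe f [^] n"
  by (induction n) (auto simp: m_comm)

lemma eval_uminus [simp]: "pe (- f) = \<ominus> pe f"
  using eval_add[of f "-f"] by (simp add: minus_equality eval_superset del: eval_add) (metis add.inv_equality add.m_comm eval_closed)

lemma eval_diff [simp]: "pe (f - g) = pe f \<ominus> pe g"
  using eval_add[of f "-g"] by (simp add: minus_eq)

end

lemma mpoly_subst_eq_poly_eval: "mpoly_subst \<phi> \<rho> = poly_eval ring_of_type_algebra \<phi> \<rho>"
  by (simp add: fun_eq_iff mpoly_subst_def poly_eval_def monom_eval_def)

locale field_poly_evaluation = poly_evaluation R \<phi> \<rho>
  for R (structure) and \<phi> :: "'k::field \<Rightarrow> 'a" and \<rho> :: "'x \<Rightarrow> 'a"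
begin

lemma eval_const [simp]: "pe (mpoly_const c) = \<phi> c"
  by (simp add: mpoly_const_def eval_single)

lemma eval_var [simp]: "pe (mpoly_var v) = \<rho> v"
  by (simp add: mpoly_var_def eval_single monom_eval_single)

end

lemma mpoly_const_hom:
  assumes "\<phi> \<in> ring_hom ring_of_type_algebra ring_of_type_algebra"
  shows "(\<lambda>c. mpoly_const (\<phi> c)) \<in> ring_hom ring_of_type_algebra ring_of_type_algebra"
  using assms by (auto simp: ring_hom_def mpoly_const_def single_add mult_single)

text \<open>Acting first and evaluating afterwards amounts to acting on the coefficients alone, because
  the point takes the same value on the \<open>i\<close>-th variables of all blocks.\<close>

lemma poly_eval_act:
  fixes R (structure) and G (structure) and g :: 'g and f :: "('g \<times> nat, 'k::field) mpoly"
  assumes "cring R" and \<phi>: "\<phi> \<in> ring_hom (ring_of_type_algebra :: 'k::field ring) R"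
    and \<sigma>: "\<sigma> g \<in> ring_hom ring_of_type_algebra (ring_of_type_algebra :: 'k ring)"
    and s: "\<And>i. s i \<in> carrier R"
  shows "poly_eval R \<phi> (\<lambda>(h, i). s i) (mpoly_act G \<sigma> g f) = poly_eval R (\<lambda>c. \<phi> (\<sigma> g c)) (\<lambda>(h, i). s i) f"
proof -
  interpret cring R by fact
  interpret E: field_poly_evaluation R \<phi> "\<lambda>(h, i). s i"
    by unfold_locales (use \<phi> s in auto)
  interpret E': field_poly_evaluation R "\<lambda>c. \<phi> (\<sigma> g c)" "\<lambda>(h, i). s i"
    by unfold_locales (use \<phi> \<sigma> s in \<open>auto simp: ring_hom_def\<close>)
  interpret A: field_poly_evaluation "ring_of_type_algebra :: ('g \<times> nat, 'k) mpoly ring"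
    "\<lambda>c. mpoly_const (\<sigma> g c)" "\<lambda>(h, i). mpoly_var (g \<otimes>\<^bsub>G\<^esub> h, i)"
    by (intro field_poly_evaluation.intro poly_evaluation.intro type_ring_cring
        poly_evaluation_axioms.intro mpoly_const_hom \<sigma>) auto
  have act: "mpoly_act G \<sigma> g = A.pe"
    by (simp add: mpoly_act_def mpoly_subst_eq_poly_eval)
  \<comment> \<open>Translating the block index of a variable does not change its value
    \<open>s i\<close>, so a monomial keeps its value.\<close>
  have me: "E.pe (A.me m) = E.me m" for m
  proof (induction m rule: poly_mapping_add_single_induct)
    case (add m v n)
    have "E.pe (mpoly_var v ^ n) = E.me (Poly_Mapping.single v n)" for v
      by (simp add: monom_eval_single s split: prod.splits)
    with add show ?case
      by (cases v) (simp add: A.monom_eval_add A.monom_eval_single monom_eval_add monom_eval_single s)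
  qed (simp add: A.monom_eval_0)
  have "E.pe (A.pe f) = E'.pe f"
  proof (induction f rule: poly_mapping_add_single_induct)
    case (add f m c)
    have "E.pe (A.pe (Poly_Mapping.single m c)) = E'.pe (Poly_Mapping.single m c)"
      using A.eval_single[of m c] by (simp add: E'.eval_single me)
    with add show ?case using A.eval_add[of "Poly_Mapping.single m c" f] by simp
  qed (use A.eval_0 in simp)
  then show ?thesis by (simp add: act)
qed

section \<open>Polynomial rings in given variables\<close>

lemma mpoly_ring_simps [simp]:
  "monoid.mult (mpoly_ring S :: ('x, 'k::field) mpoly ring) = (*)"
  "monoid.one (mpoly_ring S :: ('x, 'k::field) mpoly ring) = 1"
  "ring.zero (mpoly_ring S :: ('x, 'k::field) mpoly ring) = 0"
  "ring.add (mpoly_ring S :: ('x, 'k::field) mpoly ring) = (+)"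
  by (simp_all add: mpoly_ring_def)

lemma mpoly_ring_carrier:
  "f \<in> carrier (mpoly_ring S) \<longleftrightarrow> (\<forall>m\<in>Poly_Mapping.keys f. Poly_Mapping.keys m \<subseteq> S)"
  by (simp add: mpoly_ring_def)

text \<open>The polynomials in the variables from \<open>S\<close> form a subring of those in all
  variables: the monomials of a product are sums of monomials of the factors.\<close>

lemma mpoly_ring_cring: "cring (mpoly_ring S :: ('x, 'k::field) mpoly ring)"
proof -
  interpret cring "ring_of_type_algebra :: ('x, 'k) mpoly ring" by (rule type_ring_cring)
  have add: "f + g \<in> carrier (mpoly_ring S)"
    if "f \<in> carrier (mpoly_ring S)" "g \<in> carrier (mpoly_ring S)" for f g :: "('x, 'k) mpoly"
    using that keys_add[of f g] unfolding mpoly_ring_carrier by blast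
  have mult: "f * g \<in> carrier (mpoly_ring S)"
    if fg: "f \<in> carrier (mpoly_ring S)" "g \<in> carrier (mpoly_ring S)" for f g :: "('x, 'k) mpoly"
    unfolding mpoly_ring_carrier
  proof
    fix m assume "m \<in> Poly_Mapping.keys (f * g)"
    then obtain a b where "a \<in> Poly_Mapping.keys f" "b \<in> Poly_Mapping.keys g" and m: "m = a + b"
      using keys_mult[of f g] by blast
    then have "Poly_Mapping.keys a \<subseteq> S" "Poly_Mapping.keys b \<subseteq> S"
      using fg by (auto simp: mpoly_ring_carrier)
    then show "Poly_Mapping.keys m \<subseteq> S" using keys_add[of a b] m by blast
  qed
  have uminus: "- f \<in> carrier (mpoly_ring S)" if "f \<in> carrier (mpoly_ring S)" for f :: "('x, 'k) mpoly"
    using that by (auto simp: mpoly_ring_carrier in_keys_iff)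
  have one: "1 \<in> carrier (mpoly_ring S :: ('x, 'k) mpoly ring)"
    by (simp add: mpoly_ring_carrier)
  have "subcring (carrier (mpoly_ring S)) (ring_of_type_algebra :: ('x, 'k) mpoly ring)"
    by (intro subcringI' subringI) (simp_all add: add mult uminus one)
  then show ?thesis
    unfolding mpoly_ring_def using subcring_iff by auto
qed

lemma mpoly_const_in_ring [simp]: "mpoly_const c \<in> carrier (mpoly_ring S)"
  by (simp add: mpoly_ring_carrier mpoly_const_def)

lemma mpoly_var_in_ring [simp]: "v \<in> S \<Longrightarrow> mpoly_var v \<in> carrier (mpoly_ring S)"
  by (simp add: mpoly_ring_carrier mpoly_var_def)

lemma mpoly_ring_closed:
  assumes "f \<in> carrier (mpoly_ring S)" "g \<in> carrier (mpoly_ring S)"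
  shows "f + g \<in> carrier (mpoly_ring S)" "f * g \<in> carrier (mpoly_ring S)"
    "f - g \<in> carrier (mpoly_ring S)"
proof -
  interpret cring "mpoly_ring S :: ('a, 'b) mpoly ring" by (rule mpoly_ring_cring)
  show "f + g \<in> carrier (mpoly_ring S)" using a_closed[of f g] assms by simp
  have *: "f * g \<in> carrier (mpoly_ring S)"
    if "f \<in> carrier (mpoly_ring S)" "g \<in> carrier (mpoly_ring S)" for f g :: "('a, 'b) mpoly"
    using m_closed[of f g] that by simp
  then show "f * g \<in> carrier (mpoly_ring S)" using assms by simp
  have "Poly_Mapping.keys (f - g) \<subseteq> Poly_Mapping.keys f \<union> Poly_Mapping.keys g"
    by (auto simp: in_keys_iff lookup_minus)
  with assms show "f - g \<in> carrier (mpoly_ring S)"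
    unfolding mpoly_ring_carrier by blast
qed

lemma mpoly_ring_power:
  assumes "f \<in> carrier (mpoly_ring S)"
  shows "f ^ n \<in> carrier (mpoly_ring S)"
  by (induction n) (use assms in \<open>auto intro: mpoly_ring_closed simp: mpoly_ring_carrier[of 1]\<close>)

lemma mpoly_ring_sum: "(\<And>i. i \<in> I \<Longrightarrow> f i \<in> carrier (mpoly_ring S)) \<Longrightarrow> sum f I \<in> carrier (mpoly_ring S)"
  by (induction I rule: infinite_finite_induct)
    (auto intro!: mpoly_ring_closed simp: mpoly_ring_carrier[of 0])

lemma mpoly_ring_prod: "(\<And>i. i \<in> I \<Longrightarrow> f i \<in> carrier (mpoly_ring S)) \<Longrightarrow> prod f I \<in> carrier (mpoly_ring S)"
  by (induction I rule: infinite_finite_induct)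
    (auto intro!: mpoly_ring_closed simp: mpoly_ring_carrier[of 1])

lemma mpoly_act_closed:
  fixes G (structure)
  assumes "group G" "g \<in> carrier G" "f \<in> carrier (mpoly_ring (block_vars G n))"
  shows "mpoly_act G \<sigma> g f \<in> carrier (mpoly_ring (block_vars G n))"
proof -
  interpret group G by fact
  show ?thesis
    unfolding mpoly_act_def mpoly_subst_def using assms(2,3)
    by (auto simp: mpoly_ring_carrier[of f] block_vars_def
        intro!: mpoly_ring_sum mpoly_ring_prod mpoly_ring_closed(2) mpoly_ring_power mpoly_const_in_ring mpoly_var_in_ring)
qed

section \<open>Linear equations, characters and fixed fields\<close>

text \<open>Gaussian elimination by induction on the equations: an equation that is not identically
  zero is solved for one unknown, which removes one equation and one unknown and so keeps the strict
  inequality.\<close>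

lemma homogeneous_system_nontrivial_solution:
  fixes A :: "'i \<Rightarrow> 'j \<Rightarrow> 'a::field"
  assumes "finite I" "finite J" "card I < card J"
  shows "\<exists>c. (\<exists>j\<in>J. c j \<noteq> 0) \<and> (\<forall>i\<in>I. (\<Sum>j\<in>J. A i j * c j) = 0)"
  using assms
proof (induction I arbitrary: J A rule: finite_induct)
  case empty
  then have "J \<noteq> {}" by auto
  then show ?case by (intro exI[of _ "\<lambda>_. 1"]) auto
next
  case (insert i I)
  show ?case
  proof (cases "\<forall>j\<in>J. A i j = 0")
    case True
    have "card I < card J" using insert by simp
    from insert.IH[OF insert.prems(1) this, of A] True show ?thesis by auto
  next
    case False
    then obtain k where k: "k \<in> J" "A i k \<noteq> 0" by blast
    \<comment> \<open>Row \<open>i\<close> is subtracted from the other rows so that column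
      \<open>k\<close> becomes zero.\<close>
    define B where "B i' j = A i' j - A i' k * A i j / A i k" for i' j
    have "card I < card (J - {k})" using insert k by simp
    then obtain c where c: "\<exists>j\<in>J - {k}. c j \<noteq> 0" "\<forall>i'\<in>I. (\<Sum>j\<in>J - {k}. B i' j * c j) = 0"
      using insert.IH[of "J - {k}" B] insert.prems by auto
    \<comment> \<open>The value at \<open>k\<close> is forced by equation \<open>i\<close>.\<close>
    define d where "d j = (if j = k then - (\<Sum>j\<in>J - {k}. A i j * c j) / A i k else c j)" for j
    have split: "(\<Sum>j\<in>J. A i' j * d j) = (\<Sum>j\<in>J - {k}. A i' j * c j) + A i' k * d k" for i'
    proof -
      have "(\<Sum>j\<in>J. A i' j * d j) = A i' k * d k + (\<Sum>j\<in>J - {k}. A i' j * d j)"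
        using insert.prems(1) k(1) by (rule sum.remove)
      also have "(\<Sum>j\<in>J - {k}. A i' j * d j) = (\<Sum>j\<in>J - {k}. A i' j * c j)"
        by (rule sum.cong) (auto simp: d_def)
      finally show ?thesis by simp
    qed
    have "(\<Sum>j\<in>J. A i' j * d j) = 0" if "i' \<in> I" for i'
    proof -
      have "0 = (\<Sum>j\<in>J - {k}. A i' j * c j - A i' k / A i k * (A i j * c j))"
        using c(2) that by (simp add: B_def algebra_simps)
      also have "\<dots> = (\<Sum>j\<in>J - {k}. A i' j * c j) + A i' k * d k"
        by (simp add: sum_subtractf sum_distrib_left[symmetric] sum_divide_distrib[symmetric] d_def)
      finally show ?thesis by (simp add: split)
    qed
    moreover have "(\<Sum>j\<in>J. A i j * d j) = 0"
      unfolding split using k(2) by (simp add: d_def)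
    moreover have "\<exists>j\<in>J. d j \<noteq> 0" using c(1) by (auto simp: d_def)
    ultimately show ?thesis by blast
  qed
qed

text \<open>Dedekind's argument, by induction on the number of characters. Evaluating a relation at
  \<open>y * x\<close> and subtracting \<open>h v y\<close> times the relation at \<open>x\<close>
  cancels the term of \<open>v\<close>; choosing \<open>y\<close> to separate \<open>w\<close> from
  \<open>v\<close> then forces \<open>c w = 0\<close>.\<close>

lemma characters_linearly_independent:
  fixes h :: "'w \<Rightarrow> 'a::comm_ring_1 \<Rightarrow> 'b::field"
  assumes "finite W"
    and mult_closed: "\<And>x y. x \<in> L \<Longrightarrow> y \<in> L \<Longrightarrow> x * y \<in> L"
    and mult: "\<And>w x y. w \<in> W \<Longrightarrow> x \<in> L \<Longrightarrow> y \<in> L \<Longrightarrow> h w (x * y) = h w x * h w y"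
    and nonzero: "\<And>w. w \<in> W \<Longrightarrow> \<exists>x\<in>L. h w x \<noteq> 0"
    and distinct: "\<And>v w. v \<in> W \<Longrightarrow> w \<in> W \<Longrightarrow> v \<noteq> w \<Longrightarrow> \<exists>x\<in>L. h v x \<noteq> h w x"
    and "\<And>x. x \<in> L \<Longrightarrow> (\<Sum>w\<in>W. c w * h w x) = 0"
  shows "\<forall>w\<in>W. c w = 0"
  using assms(1,3-)
proof (induction W arbitrary: c rule: finite_induct)
  case (insert v W)
  have "c w = 0" if w: "w \<in> W" for w
  proof -
    from insert.prems(3)[of w v] w insert.hyps obtain y where y: "y \<in> L" "h w y \<noteq> h v y" by auto
    have "(\<Sum>u\<in>W. c u * (h u y - h v y) * h u x) = 0" if x: "x \<in> L" for x
    proof -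
      have "(\<Sum>u\<in>insert v W. c u * h u (y * x)) = 0"
        using mult_closed x y(1) by (intro insert.prems(4))
      moreover have "(\<Sum>u\<in>insert v W. c u * h u (y * x)) = (\<Sum>u\<in>insert v W. c u * h u y * h u x)"
        by (rule sum.cong) (use insert.prems(1) x y(1) in \<open>auto simp: mult.assoc\<close>)
      moreover have "(\<Sum>u\<in>insert v W. c u * h v y * h u x) = h v y * (\<Sum>u\<in>insert v W. c u * h u x)"
        by (simp add: sum_distrib_left algebra_simps)
      moreover have "(\<Sum>u\<in>insert v W. c u * h u x) = 0"
        using x by (rule insert.prems(4))
      ultimately have "(\<Sum>u\<in>insert v W. c u * h u y * h u x) - (\<Sum>u\<in>insert v W. c u * h v y * h u x) = 0"
        by simp
      then have "(\<Sum>u\<in>insert v W. c u * (h u y - h v y) * h u x) = 0"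
        by (simp add: sum_subtractf[symmetric] algebra_simps del: sum.insert)
      then show ?thesis using insert.hyps by simp
    qed
    with insert.IH[of "\<lambda>u. c u * (h u y - h v y)"] insert.prems(1-3) have
      "\<forall>u\<in>W. c u * (h u y - h v y) = 0" by auto
    with w y show ?thesis by auto
  qed
  moreover have "c v = 0"
  proof -
    obtain x where x: "x \<in> L" "h v x \<noteq> 0" using insert.prems(2)[of v] by auto
    have "c v * h v x + (\<Sum>u\<in>W. c u * h u x) = 0"
      using insert.prems(4)[OF x(1)] insert.hyps by simp
    with calculation have "c v * h v x = 0" by simp
    with x show ?thesis by simp
  qed
  ultimately show ?case by blast
qed simp

section \<open>Endomorphisms of fields and Artin's theorem\<close>

text \<open>Surjectivity is left out on purpose: the lifts to the algebraic closure are constructed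
  only as endomorphisms, and injectivity is automatic over a field.\<close>

definition endo :: "('a::comm_ring_1 \<Rightarrow> 'a) \<Rightarrow> bool" where
  "endo h \<longleftrightarrow> h 1 = 1 \<and> (\<forall>x y. h (x + y) = h x + h y) \<and> (\<forall>x y. h (x * y) = h x * h y)"

lemma endoD:
  assumes "endo h"
  shows "h 1 = 1" "h (x + y) = h x + h y" "h (x * y) = h x * h y" "h 0 = 0" "h (- x) = - h x"
    "h (x - y) = h x - h y"
proof -
  show "h 1 = 1" and add: "h (x + y) = h x + h y" and "h (x * y) = h x * h y" for x y
    using assms by (auto simp: endo_def)
  show 0: "h 0 = 0" using add[of 0 0] by simp
  show uminus: "h (- x) = - h x" for x using add[of x "-x"] 0 by (simp add: eq_neg_iff_add_eq_0 add.commute)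
  show "h (x - y) = h x - h y" using add[of x "-y"] uminus by simp
qed

lemma endo_sum: "endo h \<Longrightarrow> h (sum f A) = (\<Sum>x\<in>A. h (f x))"
  by (induction A rule: infinite_finite_induct) (auto simp: endoD)

lemma endo_power: "endo h \<Longrightarrow> h (x ^ n) = h x ^ n"
  by (induction n) (auto simp: endoD)

lemma endo_prod: "endo h \<Longrightarrow> h (prod f A) = (\<Prod>x\<in>A. h (f x))"
  by (induction A rule: infinite_finite_induct) (auto simp: endoD)

lemma endo_eq_0_iff:
  fixes h :: "'a::field \<Rightarrow> 'a"
  assumes "endo h"
  shows "h x = 0 \<longleftrightarrow> x = 0"
proof
  assume "h x = 0"
  show "x = 0"
  proof (rule ccontr)
    assume "x \<noteq> 0"
    then have "h x * h (inverse x) = 1" using assms by (simp flip: endoD(3) add: endoD)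
    with \<open>h x = 0\<close> show False by simp
  qed
qed (simp add: assms endoD)

lemma endo_inj:
  fixes h :: "'a::field \<Rightarrow> 'a"
  assumes "endo h"
  shows "inj h"
  using endo_eq_0_iff[OF assms] endoD(6)[OF assms] by (metis injI eq_iff_diff_eq_0)

text \<open>This is Artin's theorem on the degree over a fixed field, for a monoid \<open>H\<close> of endomorphisms
  of which only the finitely many tuples of images of the \<open>x j\<close> are considered.\<close>

lemma artin_dependence:
  fixes x :: "'j \<Rightarrow> 'a::field"
  assumes H: "\<And>h. h \<in> H \<Longrightarrow> endo h" "id \<in> H" "\<And>h h'. h \<in> H \<Longrightarrow> h' \<in> H \<Longrightarrow> h \<circ> h' \<in> H"
    and J: "finite J"
    and S: "finite ((\<lambda>h. restrict (h \<circ> x) J) ` H)" "card ((\<lambda>h. restrict (h \<circ> x) J) ` H) < card J"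
  shows "\<exists>c. (\<exists>j\<in>J. c j \<noteq> 0) \<and> (\<forall>j\<in>J. \<forall>h\<in>H. h (c j) = c j) \<and> (\<Sum>j\<in>J. c j * x j) = 0"
proof -
  define S where "S = (\<lambda>h. restrict (h \<circ> x) J) ` H"
  \<comment> \<open>A solution is orthogonal to all tuples of images at once. One of minimal support
    will be shown to have fixed coordinates after scaling.\<close>
  define sol where "sol c \<longleftrightarrow> (\<forall>s\<in>S. (\<Sum>j\<in>J. s j * c j) = 0)" for c
  define supp where "supp c = {j \<in> J. c j \<noteq> 0}" for c :: "'j \<Rightarrow> 'a"
  have fin: "finite (supp c)" for c using J by (auto simp: supp_def)
  have "\<exists>c. sol c \<and> supp c \<noteq> {}"
    using homogeneous_system_nontrivial_solution[OF S(1) J S(2), of "\<lambda>s j. s j"]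
    by (auto simp: sol_def S_def supp_def)
  then obtain c where c: "sol c" "supp c \<noteq> {}"
    and min: "\<And>d. sol d \<Longrightarrow> supp d \<noteq> {} \<Longrightarrow> card (supp c) \<le> card (supp d)"
    using ex_has_least_nat[of "\<lambda>c. sol c \<and> supp c \<noteq> {}" _ "\<lambda>c. card (supp c)"] by blast
  then obtain k where k: "k \<in> J" "c k \<noteq> 0" by (auto simp: supp_def)
  \<comment> \<open>With coordinate \<open>k\<close> scaled to 1, \<open>h\<close> fixes that
    coordinate, so the difference of \<open>h \<circ> d\<close> and \<open>d\<close> has strictly
    smaller support than \<open>d\<close>.\<close>
  define d where "d j = c j / c k" for j
  have d: "sol d" "d k = 1" "supp d = supp c"
    using c(1) k by (auto simp: sol_def d_def supp_def sum_divide_distrib[symmetric])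
  have fixed: "h (d j) = d j" if h: "h \<in> H" and j: "j \<in> J" for h j
  proof -
    \<comment> \<open>Composition with \<open>h\<close> is an injection of the finite set
      \<open>S\<close> into itself. Its surjectivity is what matters: every \<open>s\<close> in
      \<open>S\<close> has the form \<open>h \<circ> t\<close> on \<open>J\<close>, so applying
      \<open>h\<close> to the equation of \<open>t\<close> gives the equation of \<open>s\<close>
      for \<open>h \<circ> d\<close>.\<close>
    have "bij_betw (\<lambda>s. restrict (h \<circ> s) J) S S"
    proof -
      have sub: "(\<lambda>s. restrict (h \<circ> s) J) ` S \<subseteq> S"
      proof (clarsimp simp: S_def)
        fix h' assume "h' \<in> H"
        have "restrict (h \<circ> restrict (h' \<circ> x) J) J = restrict ((h \<circ> h') \<circ> x) J"
          by (auto simp: restrict_def)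
        with H(3)[OF h \<open>h' \<in> H\<close>]
        show "restrict (h \<circ> restrict (h' \<circ> x) J) J \<in> (\<lambda>h. restrict (h \<circ> x) J) ` H" by auto
      qed
      have inj: "inj_on (\<lambda>s. restrict (h \<circ> s) J) S"
      proof (rule inj_onI)
        fix s t assume st: "s \<in> S" "t \<in> S" and eq: "restrict (h \<circ> s) J = restrict (h \<circ> t) J"
        show "s = t"
        proof
          fix i
          show "s i = t i"
          proof (cases "i \<in> J")
            case True
            with eq have "h (s i) = h (t i)" by (auto simp: restrict_def fun_eq_iff split: if_splits)
            then show ?thesis using endo_inj[OF H(1)[OF h]] by (simp add: inj_eq)
          next
            case False
            with st show ?thesis by (auto simp: S_def)
          qed
        qed
      qed
      from endo_inj_surj[OF _ sub inj] inj S(1) show ?thesis by (auto simp: bij_betw_def S_def)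
    qed
    then have surj: "(\<lambda>s. restrict (h \<circ> s) J) ` S = S" by (simp add: bij_betw_def)
    define e where "e j = h (d j) - d j" for j
    have "sol e"
      unfolding sol_def
    proof
      fix s assume "s \<in> S"
      with surj obtain t where t: "t \<in> S" "s = restrict (h \<circ> t) J" by blast
      have "(\<Sum>j\<in>J. s j * h (d j)) = h (\<Sum>j\<in>J. t j * d j)"
        using t(2) by (simp add: endo_sum[OF H(1)[OF h]] endoD[OF H(1)[OF h]])
      also have "\<dots> = 0" using d(1) t(1) endoD(4)[OF H(1)[OF h]] by (simp add: sol_def)
      finally show "(\<Sum>j\<in>J. s j * e j) = 0"
        using d(1) \<open>s \<in> S\<close> by (simp add: e_def sol_def right_diff_distrib sum_subtractf)
    qed
    have "supp e \<subset> supp d"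
    proof
      show "supp e \<subseteq> supp d" using endoD(4)[OF H(1)[OF h]] by (auto simp: supp_def e_def)
      have "k \<in> supp d" "k \<notin> supp e"
        using k(1) d(2) endoD(1)[OF H(1)[OF h]] by (auto simp: supp_def e_def)
      then show "supp e \<noteq> supp d" by blast
    qed
    with fin have "card (supp e) < card (supp c)" using d(3) by (metis psubset_card_mono)
    with min[OF \<open>sol e\<close>] have "supp e = {}" by auto
    with j show ?thesis by (auto simp: supp_def e_def)
  qed
  \<comment> \<open>The identity of \<open>H\<close> contributes the equation of the tuple
    \<open>x\<close> itself, which is the desired dependence.\<close>
  have "restrict x J \<in> S" using H(2) unfolding S_def by (metis id_comp imageI)
  then have "(\<Sum>j\<in>J. restrict x J j * d j) = 0" using d(1) unfolding sol_def by blast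
  then have "(\<Sum>j\<in>J. d j * x j) = 0" by (simp add: mult.commute)
  with fixed d(2) k(1) show ?thesis by (intro exI[of _ d] conjI bexI[of _ k]) auto
qed

section \<open>Extending endomorphisms to the algebraic closure\<close>

text \<open>A homomorphism from a subfield containing the base field is represented by its graph, a
  single-valued subring of the product ring. Closure under inverses is automatic, because
  inverses of algebraic elements are polynomial expressions.\<close>

definition partial_endo :: "('k::field \<Rightarrow> 'k) \<Rightarrow> ('k alg_closure \<times> 'k alg_closure) set \<Rightarrow> bool" where
  "partial_endo \<sigma> A \<longleftrightarrow>
     (\<forall>c. (to_ac c, to_ac (\<sigma> c)) \<in> A) \<and>
     (\<forall>x y x' y'. (x, y) \<in> A \<longrightarrow> (x', y') \<in> A \<longrightarrow> (x + x', y + y') \<in> A \<and> (x * x', y * y') \<in> A) \<and>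
     (\<forall>y. (0, y) \<in> A \<longrightarrow> y = 0)"

text \<open>Write an annihilating polynomial as a constant term plus \<open>x\<close> times a
  shorter polynomial. A nonzero constant term lets the inverse be read off; a zero one allows
  division by \<open>x\<close> and induction.\<close>

lemma inverse_algebraic:
  fixes x :: "'k::field alg_closure"
  assumes "x \<noteq> 0"
  shows "\<exists>q. inverse x = poly (map_poly to_ac q) x"
proof -
  obtain p :: "'k poly" where p: "p \<noteq> 0" "poly (map_poly to_ac p) x = 0"
    by (rule alg_closure_algebraic)
  from p show ?thesis
  proof (induction p)
    case (pCons c p)
    have eq: "to_ac c + x * poly (map_poly to_ac p) x = 0"
      using pCons.prems by (simp add: map_poly_pCons)
    show ?case
    proof (cases "c = 0")
      case True
      with eq assms pCons show ?thesis by auto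
    next
      case False
      have "inverse x = - to_ac (inverse c) * poly (map_poly to_ac p) x"
        using eq False assms by (simp add: field_simps eq_neg_iff_add_eq_0)
      also have "\<dots> = poly (map_poly to_ac (smult (- inverse c) p)) x"
        by (simp add: map_poly_smult del: smult_minus_left)
      finally show ?thesis by blast
    qed
  qed simp
qed

context
  fixes \<sigma> :: "'k::field \<Rightarrow> 'k"
  assumes \<sigma>: "endo \<sigma>"
begin

lemma partial_endo_add: "partial_endo \<sigma> A \<Longrightarrow> (x, y) \<in> A \<Longrightarrow> (x', y') \<in> A \<Longrightarrow> (x + x', y + y') \<in> A"
  and partial_endo_mult: "partial_endo \<sigma> A \<Longrightarrow> (x, y) \<in> A \<Longrightarrow> (x', y') \<in> A \<Longrightarrow> (x * x', y * y') \<in> A"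
  and partial_endo_zero: "partial_endo \<sigma> A \<Longrightarrow> (0, y) \<in> A \<Longrightarrow> y = 0"
  and partial_endo_base: "partial_endo \<sigma> A \<Longrightarrow> (to_ac c, to_ac (\<sigma> c)) \<in> A"
  unfolding partial_endo_def by blast+

lemma partial_endo_01: "partial_endo \<sigma> A \<Longrightarrow> (0, 0) \<in> A" "partial_endo \<sigma> A \<Longrightarrow> (1, 1) \<in> A"
  using partial_endo_base[of A 0] partial_endo_base[of A 1] endoD[OF \<sigma>] by auto

lemma partial_endo_uminus: "partial_endo \<sigma> A \<Longrightarrow> (x, y) \<in> A \<Longrightarrow> (- x, - y) \<in> A"
  using partial_endo_mult[of A "-1" "-1" x y] partial_endo_base[of A "-1"] endoD[OF \<sigma>] by simp

lemma partial_endo_diff: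
  "partial_endo \<sigma> A \<Longrightarrow> (x, y) \<in> A \<Longrightarrow> (x', y') \<in> A \<Longrightarrow> (x - x', y - y') \<in> A"
  using partial_endo_add[of A x y "-x'" "-y'"] partial_endo_uminus[of A x' y'] by simp

lemma partial_endo_functional:
  assumes "partial_endo \<sigma> A" "(x, y) \<in> A" "(x, y') \<in> A"
  shows "y = y'"
  using partial_endo_zero[OF assms(1)] partial_endo_diff[OF assms] by force

lemma partial_endo_sum:
  "partial_endo \<sigma> A \<Longrightarrow> (\<And>i. i \<in> I \<Longrightarrow> (f i, g i) \<in> A) \<Longrightarrow> (sum f I, sum g I) \<in> A"
  by (induction I rule: infinite_finite_induct) (auto simp: partial_endo_01 partial_endo_add)

lemma partial_endo_poly:
  assumes A: "partial_endo \<sigma> A" and x: "(x, y) \<in> A" and fg: "\<And>n. (coeff f n, coeff g n) \<in> A"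
  shows "(poly f x, poly g y) \<in> A"
  using fg
proof (induction f arbitrary: g)
  case 0
  have "coeff g n = 0" for n using 0[of n] partial_endo_zero[OF A] by simp
  then have "g = 0" by (simp add: poly_eq_iff)
  then show ?case using partial_endo_01[OF A] by simp
next
  case (pCons a f)
  obtain b g' where g: "g = pCons b g'" by (cases g)
  have "(a, b) \<in> A" using pCons.prems[of 0] g by simp
  moreover have "(coeff f n, coeff g' n) \<in> A" for n using pCons.prems[of "Suc n"] g by simp
  then have "(poly f x, poly g' y) \<in> A" by (rule pCons.IH)
  ultimately show ?case using g by (simp add: partial_endo_add partial_endo_mult A x)
qed

text \<open>As the inverse of \<open>x\<close> is a polynomial in \<open>x\<close> over the base
  field, the conjugate polynomial in \<open>y\<close> gives it a partner \<open>z\<close>. Comparing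
  \<open>(1, y * z)\<close> with \<open>(1, 1)\<close> identifies \<open>z\<close> with the inverse
  of \<open>y\<close>.\<close>

lemma partial_endo_inverse:
  assumes A: "partial_endo \<sigma> A" and "(x, y) \<in> A" "x \<noteq> 0"
  shows "(inverse x, inverse y) \<in> A" "y \<noteq> 0"
proof -
  obtain q where q: "inverse x = poly (map_poly to_ac q) x" using inverse_algebraic[OF assms(3)] by blast
  define z where "z = poly (map_poly to_ac (map_poly \<sigma> q)) y"
  have z: "(inverse x, z) \<in> A"
    unfolding q z_def using assms(2) endoD[OF \<sigma>]
    by (intro partial_endo_poly A) (simp_all add: coeff_map_poly partial_endo_base A)
  have "(1, y * z) \<in> A" using partial_endo_mult[OF A assms(2) z] assms(3) by simp
  then have yz: "y * z = 1" using partial_endo_functional[OF A] partial_endo_01[OF A] by blast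
  then show "y \<noteq> 0" by auto
  with yz have "z = inverse y" by (simp add: field_simps)
  with z show "(inverse x, inverse y) \<in> A" by simp
qed

text \<open>This is the extension to a simple algebraic extension. \<open>Q\<close> relates a
  polynomial over the domain to its conjugate; \<open>m\<close> has minimal degree among those
  vanishing at \<open>x\<close>, and \<open>x\<close> is sent to a root \<open>y\<close> of its
  conjugate \<open>m'\<close>. The new graph consists of the values of conjugate pairs at
  \<open>x\<close> and \<open>y\<close>.\<close>

lemma partial_endo_ext:
  assumes A: "partial_endo \<sigma> A"
  shows "\<exists>y B. partial_endo \<sigma> B \<and> A \<subseteq> B \<and> (x, y) \<in> B"
proof -
  define Q where "Q = {(f, g). \<forall>n. (coeff f n, coeff g n) \<in> A}"
  have Q0: "g = 0" if "(0, g) \<in> Q" for g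
    using that partial_endo_zero[OF A] by (auto simp: Q_def poly_eq_iff)
  have Q_add: "(f + f', g + g') \<in> Q" and Q_diff: "(f - f', g - g') \<in> Q"
    and Q_mult: "(f * f', g * g') \<in> Q" if "(f, g) \<in> Q" "(f', g') \<in> Q" for f g f' g'
    using that
    by (auto simp: Q_def coeff_mult A intro!: partial_endo_add partial_endo_diff partial_endo_sum partial_endo_mult)
  have Q_monom: "(monom a n, monom b n) \<in> Q" if "(a, b) \<in> A" for a b n
    using that partial_endo_01[OF A] by (auto simp: Q_def)
  \<comment> \<open>Zero coefficients correspond to zero coefficients, so conjugation preserves
    degrees. In particular \<open>m'\<close> is not constant and has a root.\<close>
  have Q_degree: "degree f = degree g" if fg: "(f, g) \<in> Q" for f g
  proof -
    have "coeff f n = 0 \<longleftrightarrow> coeff g n = 0" for n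
      using partial_endo_inverse(2)[OF A, of "coeff f n" "coeff g n"] partial_endo_zero[OF A, of "coeff g n"] fg
      by (auto simp: Q_def) metis
    then show ?thesis by (simp add: degree_def)
  qed
  obtain p :: "'k poly" where p: "p \<noteq> 0" "poly (map_poly to_ac p) x = 0"
    by (rule alg_closure_algebraic)
  have "(map_poly to_ac p, map_poly to_ac (map_poly \<sigma> p)) \<in> Q"
    using endoD[OF \<sigma>] by (simp add: Q_def coeff_map_poly partial_endo_base A)
  moreover have "map_poly to_ac p \<noteq> 0" using p by (simp add: map_poly_eq_0_iff)
  ultimately have "\<exists>mm. mm \<in> Q \<and> fst mm \<noteq> 0 \<and> poly (fst mm) x = 0"
    using p by (intro exI[of _ "(map_poly to_ac p, map_poly to_ac (map_poly \<sigma> p))"]) simp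
  from ex_has_least_nat[of "\<lambda>mm. mm \<in> Q \<and> fst mm \<noteq> 0 \<and> poly (fst mm) x = 0" _ "\<lambda>mm. degree (fst mm)"] this
  obtain mm where "mm \<in> Q \<and> fst mm \<noteq> 0 \<and> poly (fst mm) x = 0"
    and min0: "\<And>m'. m' \<in> Q \<and> fst m' \<noteq> 0 \<and> poly (fst m') x = 0 \<Longrightarrow> degree (fst mm) \<le> degree (fst m')"
    by blast
  then obtain m m' where m: "(m, m') \<in> Q" "m \<noteq> 0" "poly m x = 0" and mm: "mm = (m, m')"
    by (cases mm) auto
  have min: "degree m \<le> degree f" if "(f, g) \<in> Q" "f \<noteq> 0" "poly f x = 0" for f g
    using min0[of "(f, g)"] that mm by simp
  have "degree m > 0"
    using m(2,3) by (intro Nat.gr0I) (auto elim!: degree_eq_zeroE)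
  then have "degree m' > 0" using Q_degree[OF m(1)] by simp
  then obtain y where y: "poly m' y = 0"
    using alg_closed_imp_poly_has_root[of m'] by auto
  have lc: "(inverse (Polynomial.lead_coeff m), inverse (Polynomial.lead_coeff m')) \<in> A"
  proof (rule partial_endo_inverse(1)[OF A])
    show "(Polynomial.lead_coeff m, Polynomial.lead_coeff m') \<in> A"
      using m(1) Q_degree[OF m(1)] by (simp add: Q_def)
  qed (use m(2) in simp)
  \<comment> \<open>This makes the new graph single-valued. It is division by \<open>m\<close>,
    carried out on both sides in parallel and one leading term at a time; minimality of
    \<open>m\<close> excludes a nonzero remainder.\<close>
  have key: "poly g y = 0" if "(f, g) \<in> Q" "poly f x = 0" for f g
    using that
  proof (induction "degree f" arbitrary: f g rule: less_induct)
    case less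
    show ?case
    proof (cases "f = 0")
      case True
      with Q0[of g] less.prems(1) have "g = 0" by blast
      then show ?thesis by simp
    next
      case False
      define k where "k = degree f - degree m"
      define a where "a = monom (Polynomial.lead_coeff f * inverse (Polynomial.lead_coeff m)) k"
      \<comment> \<open>The coefficient of \<open>g\<close> at \<open>degree f\<close> is the
        partner in \<open>A\<close> of the leading coefficient of \<open>f\<close>, so
        \<open>b\<close> is the conjugate of \<open>a\<close>.\<close>
      define b where "b = monom (coeff g (degree f) * inverse (Polynomial.lead_coeff m')) k"
      have le: "degree m \<le> degree f" using min less.prems False by blast
      have ab: "(a, b) \<in> Q"
        unfolding a_def b_def using less.prems lc
        by (intro Q_monom partial_endo_mult A) (auto simp: Q_def)
      have Q': "(f - a * m, g - b * m') \<in> Q" by (intro Q_diff Q_mult ab less.prems m)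
      have x0: "poly (f - a * m) x = 0" using less.prems m by simp
      have a0: "a \<noteq> 0" using False m(2) by (simp add: a_def)
      have deg_a: "degree a = k"
        unfolding a_def using False m(2) by (intro degree_monom_eq) simp
      then have deg_am: "degree (a * m) = degree f"
        using a0 m(2) le by (simp add: degree_mult_eq k_def)
      have "poly (g - b * m') y = 0"
      proof (cases "f - a * m = 0")
        case True
        with Q0[of "g - b * m'"] Q' have "g - b * m' = 0" by metis
        then show ?thesis by simp
      next
        case nz: False
        have "Polynomial.lead_coeff a = Polynomial.lead_coeff f * inverse (Polynomial.lead_coeff m)"
          unfolding deg_a by (simp add: a_def)
        then have "Polynomial.lead_coeff (a * m) = Polynomial.lead_coeff f"
          using m(2) by (simp add: lead_coeff_mult)
        then have "coeff (f - a * m) (degree f) = 0" using deg_am by simp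
        moreover have "degree (f - a * m) \<le> degree f" by (rule degree_diff_le) (simp_all add: deg_am)
        ultimately have "degree (f - a * m) < degree f"
          using nz eq_zero_or_degree_less by blast
        with less.hyps Q' x0 show ?thesis by blast
      qed
      then show ?thesis using y by simp
    qed
  qed
  define B where "B = {(poly f x, poly g y) | f g. (f, g) \<in> Q}"
  have "(u, v) \<in> B" if "(u, v) \<in> A" for u v
    unfolding B_def using Q_monom[OF that, of 0] by (force simp: monom_0)
  then have AB: "A \<subseteq> B" by auto
  have B_ring: "(u + u', v + v') \<in> B \<and> (u * u', v * v') \<in> B" if "(u, v) \<in> B" "(u', v') \<in> B" for u v u' v'
  proof -
    from that obtain f g f' g' where "(f, g) \<in> Q" "(f', g') \<in> Q"
      "u = poly f x" "v = poly g y" "u' = poly f' x" "v' = poly g' y"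
      by (auto simp: B_def)
    with Q_add[of f g f' g'] Q_mult[of f g f' g'] show ?thesis
      unfolding B_def by (metis (mono_tags, lifting) mem_Collect_eq poly_add poly_mult)
  qed
  have "(to_ac c, to_ac (\<sigma> c)) \<in> B" for c
    using AB partial_endo_base[OF A] by blast
  moreover have "v = 0" if "(0, v) \<in> B" for v
    using that key unfolding B_def by force
  ultimately have "partial_endo \<sigma> B"
    unfolding partial_endo_def using B_ring by blast
  moreover have "(x, y) \<in> B"
    unfolding B_def using Q_monom[OF partial_endo_01(2)[OF A], of 1] by (force simp: poly_monom)
  ultimately show ?thesis using AB by blast
qed

text \<open>Each closure condition involves at most two pairs, and these lie in a common member of
  the chain.\<close>

lemma partial_endo_Union:
  assumes C: "C \<noteq> {}" "subset.chain {A. partial_endo \<sigma> A} C"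
  shows "partial_endo \<sigma> (\<Union>C)"
proof -
  have pe: "partial_endo \<sigma> A" if "A \<in> C" for A using C(2) that by (auto simp: subset.chain_def)
  have two: "\<exists>A\<in>C. p \<in> A \<and> q \<in> A" if "p \<in> \<Union>C" "q \<in> \<Union>C" for p q
    using that C(2) unfolding subset.chain_def by blast
  show ?thesis
    unfolding partial_endo_def
  proof (intro conjI allI impI)
    fix c show "(to_ac c, to_ac (\<sigma> c)) \<in> \<Union>C" using C(1) pe partial_endo_base by blast
  next
    fix x y x' y' assume "(x, y) \<in> \<Union>C" "(x', y') \<in> \<Union>C"
    then obtain A where "A \<in> C" "(x, y) \<in> A" "(x', y') \<in> A" using two by blast
    with pe show "(x + x', y + y') \<in> \<Union>C" "(x * x', y * y') \<in> \<Union>C"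
      using partial_endo_add partial_endo_mult by blast+
  next
    fix y assume "(0, y) \<in> \<Union>C"
    then show "y = 0" using pe partial_endo_zero by blast
  qed
qed

text \<open>Zorn's lemma gives a maximal partial endomorphism; by \<open>partial_endo_ext\<close>
  its domain is everything.\<close>

theorem endo_extends_to_alg_closure:
  "\<exists>\<tau> :: 'k alg_closure \<Rightarrow> 'k alg_closure. endo \<tau> \<and> (\<forall>c. \<tau> (to_ac c) = to_ac (\<sigma> c))"
proof -
  let ?\<A> = "{A. partial_endo \<sigma> A}"
  have "partial_endo \<sigma> (range (\<lambda>c. (to_ac c, to_ac (\<sigma> c))))"
    unfolding partial_endo_def
  proof (intro conjI allI impI)
    fix x y x' y' assume "(x, y) \<in> range (\<lambda>c. (to_ac c, to_ac (\<sigma> c)))"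
      "(x', y') \<in> range (\<lambda>c. (to_ac c, to_ac (\<sigma> c)))"
    then obtain c d where cd: "x = to_ac c" "y = to_ac (\<sigma> c)" "x' = to_ac d" "y' = to_ac (\<sigma> d)" by auto
    show "(x + x', y + y') \<in> range (\<lambda>c. (to_ac c, to_ac (\<sigma> c)))"
      by (rule range_eqI[of _ _ "c + d"]) (simp add: cd endoD[OF \<sigma>])
    show "(x * x', y * y') \<in> range (\<lambda>c. (to_ac c, to_ac (\<sigma> c)))"
      by (rule range_eqI[of _ _ "c * d"]) (simp add: cd endoD[OF \<sigma>])
  qed (auto simp: endoD[OF \<sigma>])
  then have "?\<A> \<noteq> {}" by blast
  then obtain A where A: "partial_endo \<sigma> A" and max: "\<And>B. partial_endo \<sigma> B \<Longrightarrow> A \<subseteq> B \<Longrightarrow> B = A"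
    using subset_Zorn_nonempty[of ?\<A>] partial_endo_Union by (metis mem_Collect_eq)
  have "\<exists>y. (x, y) \<in> A" for x
    using partial_endo_ext[OF A, of x] max by blast
  then obtain \<tau> where \<tau>: "\<And>x. (x, \<tau> x) \<in> A" by metis
  have eq: "\<tau> x = y" if "(x, y) \<in> A" for x y
    using partial_endo_functional[OF A \<tau> that] .
  have "endo \<tau>"
    unfolding endo_def using \<tau> by (auto intro!: eq partial_endo_01 partial_endo_add partial_endo_mult A)
  moreover have "\<tau> (to_ac c) = to_ac (\<sigma> c)" for c
    by (intro eq partial_endo_base A)
  ultimately show ?thesis by blast
qed

end

section \<open>Constants of models of G-TCF\<close>

lemma endo_iff_ring_hom: "endo h \<longleftrightarrow> h \<in> ring_hom ring_of_type_algebra ring_of_type_algebra"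
  by (auto simp: endo_def ring_hom_def)

lemma transformal_field_endo:
  "transformal_field G \<sigma> \<Longrightarrow> g \<in> carrier G \<Longrightarrow> endo (\<sigma> g)"
  by (auto simp: transformal_field_def endo_iff_ring_hom ring_iso_def)

text \<open>Only multiplicativity in \<open>g\<close> is part of the definition. The operator of the
  neutral element is therefore idempotent, and being injective it is the identity.\<close>

lemma transformal_field_one:
  assumes "group G" "transformal_field G \<sigma>"
  shows "\<sigma> \<one>\<^bsub>G\<^esub> x = x"
proof -
  interpret group G by fact
  have "\<sigma> (\<one>\<^bsub>G\<^esub> \<otimes>\<^bsub>G\<^esub> \<one>\<^bsub>G\<^esub>) = \<sigma> \<one>\<^bsub>G\<^esub> \<circ> \<sigma> \<one>\<^bsub>G\<^esub>"
    using assms(2) unfolding transformal_field_def by blast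
  then have "\<sigma> \<one>\<^bsub>G\<^esub> (\<sigma> \<one>\<^bsub>G\<^esub> x) = \<sigma> \<one>\<^bsub>G\<^esub> x" by (simp add: fun_eq_iff)
  then show ?thesis
    using endo_inj[OF transformal_field_endo[OF assms(2) one_closed]] by (simp add: inj_eq)
qed

lemma constants_closed:
  fixes \<sigma> :: "'g \<Rightarrow> 'k::field \<Rightarrow> 'k"
  assumes "transformal_field G \<sigma>"
  shows "0 \<in> constants G \<sigma>" "1 \<in> constants G \<sigma>"
    "a \<in> constants G \<sigma> \<Longrightarrow> b \<in> constants G \<sigma> \<Longrightarrow> a + b \<in> constants G \<sigma>"
    "a \<in> constants G \<sigma> \<Longrightarrow> b \<in> constants G \<sigma> \<Longrightarrow> a * b \<in> constants G \<sigma>"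
    "a \<in> constants G \<sigma> \<Longrightarrow> - a \<in> constants G \<sigma>"
    "a \<in> constants G \<sigma> \<Longrightarrow> inverse a \<in> constants G \<sigma>"
    "a \<in> constants G \<sigma> \<Longrightarrow> a ^ n \<in> constants G \<sigma>"
proof -
  note e = transformal_field_endo[OF assms]
  show "0 \<in> constants G \<sigma>" "1 \<in> constants G \<sigma>"
    "a \<in> constants G \<sigma> \<Longrightarrow> b \<in> constants G \<sigma> \<Longrightarrow> a + b \<in> constants G \<sigma>"
    "a \<in> constants G \<sigma> \<Longrightarrow> b \<in> constants G \<sigma> \<Longrightarrow> a * b \<in> constants G \<sigma>"
    "a \<in> constants G \<sigma> \<Longrightarrow> - a \<in> constants G \<sigma>"
    by (auto simp: constants_def endoD e)
  show "a ^ n \<in> constants G \<sigma>" if "a \<in> constants G \<sigma>"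
    using that by (induction n) (auto simp: constants_def endoD e)
  show "inverse a \<in> constants G \<sigma>" if a: "a \<in> constants G \<sigma>"
  proof (cases "a = 0")
    case False
    have "\<sigma> g (inverse a) = inverse a" if "g \<in> carrier G" for g
    proof -
      have "a * \<sigma> g (inverse a) = 1"
        using a that False endoD(3)[OF e[OF that], of a "inverse a"] endoD(1)[OF e[OF that]]
        by (simp add: constants_def)
      then show ?thesis using False by (simp add: field_simps)
    qed
    then show ?thesis by (simp add: constants_def)
  qed (use a in simp)
qed

lemma constants_subfield:
  fixes \<sigma> :: "'g \<Rightarrow> 'k::field \<Rightarrow> 'k"
  assumes "transformal_field G \<sigma>"
  shows "subfield (constants G \<sigma>) ring_of_type_algebra"
proof -
  interpret field "ring_of_type_algebra :: 'k ring" by (rule type_ring_field)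
  show ?thesis
    by (intro subfieldI' subringI) (auto simp: constants_closed[OF assms] type_ring_m_inv)
qed

text \<open>An invariant prime ideal of points whose blocks of coordinates coincide has a zero in
  constants: its zero of the form \<open>\<sigma>(a)\<close> also kills the differences of corresponding variables of
  distinct blocks.\<close>

lemma G_TCF_constant_point:
  fixes G :: "('g, 'm) monoid_scheme" and \<sigma> :: "'g \<Rightarrow> 'k::field \<Rightarrow> 'k" and R :: "('r, 'q) ring_scheme"
  assumes G: "group G" and TCF: "models_G_TCF G \<sigma>" and n: "n \<ge> 1"
    and R: "cring R" and \<phi>: "\<phi> \<in> ring_hom (ring_of_type_algebra :: 'k ring) R"
    and s: "\<And>i. s i \<in> carrier R" and P: "primeideal P R"
    and inv: "\<And>g f. g \<in> carrier G \<Longrightarrow> poly_eval R \<phi> (\<lambda>(h :: 'g, i). s i) f \<in> P \<Longrightarrow>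
      poly_eval R (\<lambda>c. \<phi> (\<sigma> g c)) (\<lambda>(h, i). s i) f \<in> P"
  shows "\<exists>a. (\<forall>i<n. a i \<in> constants G \<sigma>) \<and>
    (\<forall>f\<in>carrier (mpoly_ring (block_vars G n)). poly_eval R \<phi> (\<lambda>(h, i). s i) f \<in> P \<longrightarrow>
      mpoly_subst (\<lambda>c. c) (sigma_tuple \<sigma> a) f = 0)"
proof -
  interpret G: group G by fact
  interpret R: cring R by fact
  interpret E: field_poly_evaluation R \<phi> "\<lambda>(h :: 'g, i). s i"
    by unfold_locales (use \<phi> s in auto)
  interpret M: cring "mpoly_ring (block_vars G n) :: ('g \<times> nat, 'k) mpoly ring"
    by (rule mpoly_ring_cring)
  interpret P: primeideal P R by fact
  have tf: "transformal_field G \<sigma>" using TCF by (simp add: models_G_TCF_def)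
  note \<sigma>_endo = transformal_field_endo[OF tf]
  define M where "M = carrier (mpoly_ring (block_vars G n) :: ('g \<times> nat, 'k) mpoly ring)"
  \<comment> \<open>\<open>I\<close> is the preimage of \<open>P\<close> under evaluation at the
    point all of whose blocks equal \<open>s\<close>.\<close>
  define I where "I = {f \<in> M. E.pe f \<in> P}"
  have hom: "E.pe \<in> ring_hom (mpoly_ring (block_vars G n)) R"
    by (intro ring_hom_memI) auto
  interpret H: ring_hom_ring "mpoly_ring (block_vars G n)" R E.pe
    by (intro ring_hom_ringI2 M.ring_axioms R.ring_axioms hom)
  have prime: "primeideal I (mpoly_ring (block_vars G n))"
    unfolding I_def M_def by (rule H.primeideal_vimage) (use P M.cring_axioms in auto)
  then interpret I: primeideal I "mpoly_ring (block_vars G n)" .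
  have "mpoly_act G \<sigma> g f \<in> I" if g: "g \<in> carrier G" and f: "f \<in> I" for g f
  proof -
    have "E.pe (mpoly_act G \<sigma> g f) = poly_eval R (\<lambda>c. \<phi> (\<sigma> g c)) (\<lambda>(h, i). s i) f"
      using R \<phi> \<sigma>_endo[OF g] s by (intro poly_eval_act) (auto simp: endo_iff_ring_hom)
    moreover have "f \<in> M" and fP: "E.pe f \<in> P" using f unfolding I_def by blast+
    from fP have "poly_eval R (\<lambda>c. \<phi> (\<sigma> g c)) (\<lambda>(h, i). s i) f \<in> P"
      by (rule inv[OF g])
    ultimately have "E.pe (mpoly_act G \<sigma> g f) \<in> P" by (rule ssubst)
    moreover have "mpoly_act G \<sigma> g f \<in> M"
      using mpoly_act_closed[OF G g] \<open>f \<in> M\<close> unfolding M_def by blast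
    ultimately show ?thesis unfolding I_def by blast
  qed
  then have invI: "invariant_ideal G \<sigma> I" unfolding invariant_ideal_def by blast
  have "I \<subset> M" using I.I_notcarr unfolding M_def I_def by blast
  \<comment> \<open>The larger ideal is taken to be the unit ideal, so the axiom is used to provide
    a zero of \<open>I\<close>.\<close>
  moreover have "ideal M (mpoly_ring (block_vars G n))" unfolding M_def by (rule M.oneideal)
  ultimately have IM: "ideal I (mpoly_ring (block_vars G n)) \<and> ideal M (mpoly_ring (block_vars G n)) \<and>
      I \<subset> M \<and> invariant_ideal G \<sigma> I \<and> primeideal I (mpoly_ring (block_vars G n))"
    using I.ideal_axioms invI prime by blast
  from TCF have "\<And>n I J. n \<ge> 1 \<Longrightarrow> ideal I (mpoly_ring (block_vars G n)) \<and> ideal J (mpoly_ring (block_vars G n)) \<and>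
        I \<subset> J \<and> invariant_ideal G \<sigma> I \<and> primeideal I (mpoly_ring (block_vars G n)) \<Longrightarrow>
        \<exists>a. sigma_tuple \<sigma> a \<in> zero_locus I - zero_locus J"
    unfolding models_G_TCF_def by blast
  from this[OF n IM] obtain a where a: "sigma_tuple \<sigma> a \<in> zero_locus I" by blast
  have const: "a i \<in> constants G \<sigma>" if i: "i < n" for i
    unfolding constants_def
  proof (intro CollectI ballI)
    fix g assume g: "g \<in> carrier G"
    interpret Z: field_poly_evaluation "ring_of_type_algebra :: 'k ring" "\<lambda>c. c" "sigma_tuple \<sigma> a"
      by (intro field_poly_evaluation.intro poly_evaluation.intro type_ring_cring
          poly_evaluation_axioms.intro) (auto simp: ring_hom_def)
    \<comment> \<open>Both variables are evaluated to \<open>s i\<close>, so their difference lies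
      in \<open>I\<close>; at the zero \<open>sigma_tuple \<sigma> a\<close> it becomes
      \<open>\<sigma> g (a i) - a i\<close>.\<close>
    let ?f = "mpoly_var (g, i) - mpoly_var (\<one>\<^bsub>G\<^esub>, i) :: ('g \<times> nat, 'k) mpoly"
    have "?f \<in> M" unfolding M_def using g i by (intro mpoly_ring_closed mpoly_var_in_ring) (auto simp: block_vars_def)
    moreover have "E.pe ?f \<in> P" using s by (simp add: R.minus_eq R.r_neg)
    ultimately have "Z.pe ?f = 0"
      using a unfolding I_def zero_locus_def mpoly_subst_eq_poly_eval by blast
    moreover have "Z.pe ?f = \<sigma> g (a i) - \<sigma> \<one>\<^bsub>G\<^esub> (a i)"
      unfolding Z.eval_diff Z.eval_var type_ring_minus by (simp add: sigma_tuple_def)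
    ultimately show "\<sigma> g (a i) = a i"
      unfolding transformal_field_one[OF G tf] by (simp only: right_minus_eq)
  qed
  moreover have "mpoly_subst (\<lambda>c. c) (sigma_tuple \<sigma> a) f = 0"
    if "f \<in> carrier (mpoly_ring (block_vars G n))" "E.pe f \<in> P" for f
    using a that unfolding I_def zero_locus_def M_def by blast
  ultimately show ?thesis by blast
qed

section \<open>Boundedness\<close>

lemma endo_poly_eval:
  "endo \<tau> \<Longrightarrow> \<tau> (poly_eval ring_of_type_algebra \<phi> \<rho> f) =
    poly_eval ring_of_type_algebra (\<lambda>c. \<tau> (\<phi> c)) (\<lambda>v. \<tau> (\<rho> v)) f"
  by (simp add: poly_eval_def monom_eval_def endo_sum endo_prod endo_power endoD)

lemma map_poly_to_ac_mult: "map_poly to_ac (p * q) = map_poly to_ac p * map_poly to_ac q"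
  by (rule poly_eqI) (simp add: coeff_map_poly coeff_mult to_ac_sum)

text \<open>The minimal polynomial of \<open>x\<close> belongs to the ideal of the point all of whose coordinates
  are \<open>x\<close>, so it has a root in the constants.\<close>

lemma fixed_by_lifts_imp_constant:
  fixes G :: "('g, 'm) monoid_scheme" and \<sigma> :: "'g \<Rightarrow> 'k::field \<Rightarrow> 'k"
  assumes G: "group G" and TCF: "models_G_TCF G \<sigma>"
    and \<tau>: "\<And>g. g \<in> carrier G \<Longrightarrow> endo (\<tau> g)" "\<And>g c. g \<in> carrier G \<Longrightarrow> \<tau> g (to_ac c) = to_ac (\<sigma> g c)"
    and x: "\<And>g. g \<in> carrier G \<Longrightarrow> \<tau> g x = x"
  shows "x \<in> to_ac ` constants G \<sigma>"
proof -
  let ?\<Omega> = "ring_of_type_algebra :: 'k alg_closure ring"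
  interpret G: group G by fact
  interpret \<Omega>: field ?\<Omega> by (rule type_ring_field)
  have tf: "transformal_field G \<sigma>" using TCF by (simp add: models_G_TCF_def)
  have hom: "to_ac \<in> ring_hom (ring_of_type_algebra :: 'k ring) ?\<Omega>"
    by (auto simp: ring_hom_def)
  have inv: "poly_eval ?\<Omega> (\<lambda>c. to_ac (\<sigma> g c)) (\<lambda>(h :: 'g, i :: nat). x) f \<in> {\<zero>\<^bsub>?\<Omega>\<^esub>}"
    if g: "g \<in> carrier G" and f: "poly_eval ?\<Omega> to_ac (\<lambda>(h :: 'g, i :: nat). x) f \<in> {\<zero>\<^bsub>?\<Omega>\<^esub>}" for g f
  proof -
    \<comment> \<open>Since \<open>\<tau> g\<close> fixes \<open>x\<close> and extends
      \<open>\<sigma> g\<close>, the evaluation with conjugated coefficients is the image under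
      \<open>\<tau> g\<close> of the original value.\<close>
    have "(\<lambda>v. \<tau> g ((\<lambda>(h :: 'g, i :: nat). x) v)) = (\<lambda>(h, i). x)" using x[OF g] by auto
    then have "poly_eval ?\<Omega> (\<lambda>c. to_ac (\<sigma> g c)) (\<lambda>(h, i). x) f =
        \<tau> g (poly_eval ?\<Omega> to_ac (\<lambda>(h, i). x) f)"
      unfolding endo_poly_eval[OF \<tau>(1)[OF g]] \<tau>(2)[OF g] by simp
    moreover have "\<tau> g 0 = 0" using endoD(4)[OF \<tau>(1)[OF g]] .
    ultimately show ?thesis using f by simp
  qed
  have "\<exists>a. (\<forall>i<1. a i \<in> constants G \<sigma>) \<and>
    (\<forall>f\<in>carrier (mpoly_ring (block_vars G 1)). poly_eval ?\<Omega> to_ac (\<lambda>(h, i). x) f \<in> {\<zero>\<^bsub>?\<Omega>\<^esub>} \<longrightarrow>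
      mpoly_subst (\<lambda>c. c) (sigma_tuple \<sigma> a) f = 0)"
    by (rule G_TCF_constant_point[OF G TCF _ type_ring_cring hom _ \<Omega>.zeroprimeideal inv]) auto
  then obtain a where a: "a 0 \<in> constants G \<sigma>"
    and vanish: "\<And>f. f \<in> carrier (mpoly_ring (block_vars G 1)) \<Longrightarrow>
      poly_eval ?\<Omega> to_ac (\<lambda>(h, i). x) f = 0 \<Longrightarrow> mpoly_subst (\<lambda>c. c) (sigma_tuple \<sigma> a) f = 0"
    by auto
  obtain p0 :: "'k poly" where "p0 \<noteq> 0" "poly (map_poly to_ac p0) x = 0"
    by (rule alg_closure_algebraic)
  then obtain p :: "'k poly" where p: "p \<noteq> 0" "poly (map_poly to_ac p) x = 0"
    and min: "\<And>q :: 'k poly. q \<noteq> 0 \<Longrightarrow> poly (map_poly to_ac q) x = 0 \<Longrightarrow> degree p \<le> degree q"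
    using ex_has_least_nat[of "\<lambda>q. q \<noteq> 0 \<and> poly (map_poly to_ac q) x = 0" p0 degree] by blast
  \<comment> \<open>The minimal polynomial of \<open>x\<close>, written in the single variable of
    the block of the neutral element.\<close>
  define f :: "('g \<times> nat, 'k) mpoly"
    where "f = (\<Sum>i\<le>degree p. mpoly_const (coeff p i) * mpoly_var (\<one>\<^bsub>G\<^esub>, 0) ^ i)"
  have fM: "f \<in> carrier (mpoly_ring (block_vars G 1))"
    unfolding f_def
    by (intro mpoly_ring_sum mpoly_ring_closed(2) mpoly_ring_power mpoly_const_in_ring mpoly_var_in_ring) (simp add: block_vars_def)
  have eval_f: "poly_eval ring_of_type_algebra \<phi> \<rho> f = (\<Sum>i\<le>degree p. \<phi> (coeff p i) * \<rho> (\<one>\<^bsub>G\<^esub>, 0) ^ i)"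
    if "\<phi> \<in> ring_hom ring_of_type_algebra ring_of_type_algebra"
    for \<phi> :: "'k \<Rightarrow> 'r::field" and \<rho>
  proof -
    interpret E: field_poly_evaluation "ring_of_type_algebra :: 'r ring" \<phi> \<rho>
      by (intro field_poly_evaluation.intro poly_evaluation.intro type_ring_cring
          poly_evaluation_axioms.intro that) auto
    have sum: "E.pe (sum h I) = (\<Sum>i\<in>I. E.pe (h i))" for h :: "nat \<Rightarrow> ('g \<times> nat, 'k) mpoly" and I
      by (induction I rule: infinite_finite_induct) (simp_all add: E.eval_0 E.eval_add)
    show ?thesis
      unfolding f_def sum E.eval_mult E.eval_power E.eval_const E.eval_var by simp
  qed
  have "degree (map_poly to_ac p) = degree p" by (rule degree_map_poly) simp
  then have "poly_eval ?\<Omega> to_ac (\<lambda>(h, i). x) f = 0"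
    using p(2) unfolding eval_f[OF hom] by (simp add: poly_altdef coeff_map_poly)
  from vanish[OF fM this] have "poly p (a 0) = 0"
    using eval_f[of "\<lambda>c. c" "sigma_tuple \<sigma> a"] transformal_field_one[OF G tf]
    by (simp add: mpoly_subst_eq_poly_eval sigma_tuple_def poly_altdef ring_hom_def)
  \<comment> \<open>The constant \<open>a 0\<close> is a root of \<open>p\<close> in the base field.
    By minimality the cofactor \<open>q\<close> does not vanish at \<open>x\<close>, so
    \<open>x\<close> is the root of the linear factor.\<close>
  then obtain q where q: "p = [:- a 0, 1:] * q" by (auto simp: poly_eq_0_iff_dvd)
  with p have "q \<noteq> 0" by auto
  then have "degree p = Suc (degree q)" unfolding q by (subst degree_mult_eq) auto
  with min[OF \<open>q \<noteq> 0\<close>] have "poly (map_poly to_ac q) x \<noteq> 0" by auto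
  moreover have "(x - to_ac (a 0)) * poly (map_poly to_ac q) x = 0"
    using p(2) unfolding q map_poly_to_ac_mult by (simp add: map_poly_pCons) blast
  ultimately have "x = to_ac (a 0)" by simp
  with a show ?thesis by blast
qed

section \<open>Words in the lifted endomorphisms and their action on finite extensions\<close>

text \<open>The lifts are chosen separately for each generator and need not multiply as in the
  group. The monoid that they generate is therefore described by words.\<close>

definition word :: "('g \<Rightarrow> 'a \<Rightarrow> 'a) \<Rightarrow> 'g list \<Rightarrow> 'a \<Rightarrow> 'a" where
  "word \<tau> w = foldr (\<lambda>g h. \<tau> g \<circ> h) w id"

lemma word_simps [simp]:
  "word \<tau> [] = id" "word \<tau> (g # w) = \<tau> g \<circ> word \<tau> w"
  by (simp_all add: word_def)

lemma word_append: "word \<tau> (v @ w) = word \<tau> v \<circ> word \<tau> w"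
  by (induction v) (auto simp: comp_assoc)

lemma endo_word: "(\<And>g. g \<in> A \<Longrightarrow> endo (\<tau> g)) \<Longrightarrow> w \<in> lists A \<Longrightarrow> endo (word \<tau> w)"
  by (induction w) (auto simp: endo_def)

lemma word_fixed: "(\<And>g. g \<in> A \<Longrightarrow> \<tau> g x = x) \<Longrightarrow> w \<in> lists A \<Longrightarrow> word \<tau> w x = x"
  by (induction w) auto

text \<open>This turns bases given as lists into indexed families, the form in which the linear
  algebra is done.\<close>

lemma dimension_basis:
  fixes F :: "'a::field set"
  assumes F: "subfield F ring_of_type_algebra" and "ring.dimension ring_of_type_algebra n F L"
  shows "\<exists>x. (\<forall>c. (\<forall>j<n. c j \<in> F) \<and> (\<Sum>j<n. c j * x j) = 0 \<longrightarrow> (\<forall>j<n. c j = 0)) \<and>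
    L = {\<Sum>j<n. c j * x j | c. \<forall>j<n. c j \<in> F}"
proof -
  interpret field "ring_of_type_algebra :: 'a ring" by (rule type_ring_field)
  obtain Us where Us: "set Us \<subseteq> carrier ring_of_type_algebra" "independent F Us" "length Us = n" "Span F Us = L"
    using exists_base[OF F assms(2)] by blast
  have combine: "combine Ks Us = (\<Sum>j<length Us. Ks ! j * Us ! j)" if "length Ks = length Us" for Ks Us
    using that by (induction Ks Us rule: list_induct2) (simp_all add: sum.lessThan_Suc_shift del: sum.lessThan_Suc)
  have "\<forall>j<n. c j = 0" if c: "\<forall>j<n. c j \<in> F" "(\<Sum>j<n. c j * Us ! j) = 0" for c
  proof -
    have "combine (map c [0..<n]) Us = \<zero>\<^bsub>ring_of_type_algebra\<^esub>"
      using c(2) Us(3) by (simp add: combine)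
    moreover have "set (map c [0..<n]) \<subseteq> F" using c(1) by auto
    ultimately have "set (take (length Us) (map c [0..<n])) \<subseteq> {0}"
      using independent_imp_trivial_combine[OF F Us(2)] by simp
    then have "c j \<in> {0}" if "j < n" for j using Us(3) that by (auto simp: subset_iff)
    then show ?thesis by blast
  qed
  moreover have "L = {\<Sum>j<n. c j * Us ! j | c. \<forall>j<n. c j \<in> F}"
  proof (intro equalityI subsetI)
    fix y assume "y \<in> L"
    then obtain Ks where Ks: "y = combine Ks Us" "length Ks = length Us" "set Ks \<subseteq> F"
      using Span_eq_combine_set_length_version[OF F Us(1)] Us(4) by blast
    then have "y = (\<Sum>j<n. Ks ! j * Us ! j)" "\<forall>j<n. Ks ! j \<in> F" using combine Us(3) by auto
    then show "y \<in> {\<Sum>j<n. c j * Us ! j | c. \<forall>j<n. c j \<in> F}" by (intro CollectI exI[of _ "\<lambda>j. Ks ! j"]) simp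
  next
    fix y assume "y \<in> {\<Sum>j<n. c j * Us ! j | c. \<forall>j<n. c j \<in> F}"
    then obtain c where c: "y = (\<Sum>j<n. c j * Us ! j)" "\<forall>j<n. c j \<in> F" by blast
    then have "y = combine (map c [0..<n]) Us" using Us(3) by (simp add: combine)
    moreover have "length (map c [0..<n]) = length Us" "set (map c [0..<n]) \<subseteq> F" using c(2) Us(3) by auto
    ultimately show "y \<in> L"
      using Span_eq_combine_set_length_version[OF F Us(1)] Us(4) by blast
  qed
  ultimately show ?thesis by (intro exI[of _ "\<lambda>j. Us ! j"]) blast
qed

text \<open>The counterpart of \<open>word\<close> on finitely many labels. The map
  \<open>\<pi>\<close> is uncurried so that all candidates form one finite function space.\<close>

definition perm_word :: "('g \<times> nat \<Rightarrow> nat) \<Rightarrow> 'g list \<Rightarrow> nat \<Rightarrow> nat" where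
  "perm_word \<pi> w i = foldr (\<lambda>g i. \<pi> (g, i)) w i"

lemma perm_word_simps [simp]:
  "perm_word \<pi> [] i = i" "perm_word \<pi> (g # w) i = \<pi> (g, perm_word \<pi> w i)"
  by (simp_all add: perm_word_def)

text \<open>An extension of degree \<open>n\<close> has at most \<open>n\<close> restrictions of words in the generators. They are
  permuted by the generators, and this permutation representation determines the extension.\<close>

lemma extension_determined_by_permutations:
  fixes \<tau> :: "'g \<Rightarrow> 'a::field \<Rightarrow> 'a"
  assumes \<tau>: "\<And>g. g \<in> A \<Longrightarrow> endo (\<tau> g)"
    and F: "F = {x. \<forall>g\<in>A. \<tau> g x = x}" "subfield F ring_of_type_algebra"
    and L: "subfield L ring_of_type_algebra" "ring.dimension ring_of_type_algebra n F L"
  shows "\<exists>k<n. \<exists>\<pi>\<in>A \<times> {..<n} \<rightarrow>\<^sub>E {..<n}.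
    L = {y. \<forall>v\<in>lists A. \<forall>w\<in>lists A. perm_word \<pi> v k = perm_word \<pi> w k \<longrightarrow> word \<tau> v y = word \<tau> w y}"
proof -
  obtain x where indep: "\<And>c. (\<forall>j<n. c j \<in> F) \<and> (\<Sum>j<n. c j * x j) = 0 \<Longrightarrow> (\<forall>j<n. c j = 0)"
    and span: "L = {\<Sum>j<n. c j * x j | c. \<forall>j<n. c j \<in> F}"
    using dimension_basis[OF F(2) L(2)] by blast
  define H where "H = word \<tau> ` lists A"
  have H: "endo h" if "h \<in> H" for h
    using that \<tau> endo_word unfolding H_def by blast
  have H_id: "id \<in> H" unfolding H_def by (rule image_eqI[of _ _ "[]"]) auto
  have H_comp: "h \<circ> h' \<in> H" if "h \<in> H" "h' \<in> H" for h h'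
  proof -
    from that obtain v w where "v \<in> lists A" "w \<in> lists A" "h = word \<tau> v" "h' = word \<tau> w"
      by (auto simp: H_def)
    then show ?thesis unfolding H_def by (intro image_eqI[of _ _ "v @ w"]) (auto simp: word_append)
  qed
  have H_fixed: "h c = c" if "h \<in> H" "c \<in> F" for h c
  proof -
    from that obtain w where w: "w \<in> lists A" "h = word \<tau> w" by (auto simp: H_def)
    show ?thesis unfolding w(2) by (rule word_fixed[OF _ w(1)]) (use that F(1) in auto)
  qed
  have H_gen: "\<tau> g \<in> H" if "g \<in> A" for g
    unfolding H_def by (rule image_eqI[of _ _ "[g]"]) (use that in auto)
  \<comment> \<open>The values on the basis \<open>x\<close> record the restriction of
    \<open>h\<close> to \<open>L\<close>, because \<open>h\<close> fixes the coefficients.\<close>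
  define T where "T h = restrict (h \<circ> x) {..<n}" for h :: "'a \<Rightarrow> 'a"
  have T_L: "h y = h' y" if "h \<in> H" "h' \<in> H" "T h = T h'" and yL: "y \<in> L" for h h' y
  proof -
    obtain c where c: "y = (\<Sum>j<n. c j * x j)" "\<forall>j<n. c j \<in> F" using yL span by auto
    have "h (x j) = h' (x j)" if "j < n" for j
      using fun_cong[OF \<open>T h = T h'\<close>, of j] that by (simp add: T_def)
    then show ?thesis
      unfolding c(1) using c(2) that(1,2)
      by (simp add: endo_sum H endoD(3) H_fixed)
  qed
  have xL: "x j \<in> L" if "j < n" for j
  proof -
    have "0 \<in> F" "1 \<in> F"
      using subringE(2,3)[OF subfieldE(1)[OF F(2)]] by simp_all
    moreover have "x j = (\<Sum>i<n. (if i = j then 1 else 0) * x i)"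
      using that by (simp add: if_distrib[of "\<lambda>t. t * _"] cong: if_cong)
    ultimately show ?thesis unfolding span by (intro CollectI exI[of _ "\<lambda>i. if i = j then 1 else 0"]) auto
  qed
  \<comment> \<open>More than \<open>n\<close> tuples of length \<open>n\<close> are linearly
    dependent. Such a dependence extends from the basis to all of \<open>L\<close>, against the
    independence of the distinct characters \<open>h s\<close> on \<open>L\<close>.\<close>
  have card_bound: "card W \<le> n" if W: "W \<subseteq> T ` H" "finite W" for W
  proof (rule ccontr)
    assume "\<not> card W \<le> n"
    then obtain c where c: "\<exists>s\<in>W. c s \<noteq> 0" "\<forall>j<n. (\<Sum>s\<in>W. s j * c s) = 0"
      using homogeneous_system_nontrivial_solution[of "{..<n}" W "\<lambda>j s. s j"] W(2) by auto
    define h where "h = inv_into H T"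
    have h: "h s \<in> H" "T (h s) = s" if "s \<in> W" for s
      using subsetD[OF W(1) that] inv_into_into[of s T H] f_inv_into_f[of s T H] by (simp_all add: h_def)
    have "\<forall>s\<in>W. c s = 0"
    proof (rule characters_linearly_independent[where L = L and h = h])
      show "finite W" by fact
      show "y * z \<in> L" if "y \<in> L" "z \<in> L" for y z
        using that subringE(6)[OF subfieldE(1)[OF L(1)]] by simp
      show "h s (y * z) = h s y * h s z" if "s \<in> W" for s y z
        using endoD(3)[OF H[OF h(1)[OF that]]] .
      show "\<exists>y\<in>L. h s y \<noteq> 0" if "s \<in> W" for s
        using endoD(1)[OF H[OF h(1)[OF that]]] subringE(3)[OF subfieldE(1)[OF L(1)]]
        by (intro bexI[of _ 1]) simp_all
      show "\<exists>y\<in>L. h s y \<noteq> h t y" if st: "s \<in> W" "t \<in> W" "s \<noteq> t" for s t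
      proof -
        have "\<exists>j<n. s j \<noteq> t j"
        proof (rule ccontr)
          assume "\<not> ?thesis"
          then have "restrict s {..<n} = restrict t {..<n}" by (auto simp: restrict_def)
          moreover have "restrict r {..<n} = r" if "r \<in> W" for r
            using W(1) that by (auto simp: T_def)
          ultimately show False using st by metis
        qed
        then obtain j where j: "j < n" "s j \<noteq> t j" by blast
        have "h r (x j) = r j" if "r \<in> W" for r
          using fun_cong[OF h(2)[OF that], of j] j(1) by (simp add: T_def)
        with j st xL show ?thesis by metis
      qed
      show "(\<Sum>s\<in>W. c s * h s y) = 0" if y: "y \<in> L" for y
      proof -
        obtain d where d: "y = (\<Sum>j<n. d j * x j)" "\<forall>j<n. d j \<in> F" using y span by auto
        have "h s y = (\<Sum>j<n. d j * s j)" if "s \<in> W" for s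
        proof -
          have "h s (x j) = s j" if "j < n" for j
            using fun_cong[OF h(2)[OF \<open>s \<in> W\<close>], of j] that by (simp add: T_def)
          then show ?thesis
            unfolding d(1) using d(2) by (simp add: endo_sum endoD(3) H_fixed H h(1) that)
        qed
        then have "(\<Sum>s\<in>W. c s * h s y) = (\<Sum>s\<in>W. \<Sum>j<n. d j * (s j * c s))"
          by (intro sum.cong) (auto simp: sum_distrib_left mult_ac)
        also have "\<dots> = (\<Sum>j<n. d j * (\<Sum>s\<in>W. s j * c s))"
          by (subst sum.swap) (simp add: sum_distrib_left)
        also have "\<dots> = 0" using c(2) by simp
        finally show ?thesis .
      qed
    qed
    with c(1) show False by blast
  qed
  have finS: "finite (T ` H)"
  proof (rule ccontr)
    assume "infinite (T ` H)"
    then obtain W where "W \<subseteq> T ` H" "finite W" "card W = Suc n"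
      using infinite_arbitrarily_large by blast
    with card_bound[of W] show False by simp
  qed
  have cardS: "card (T ` H) \<le> n" by (rule card_bound[OF subset_refl finS])
  \<comment> \<open>\<open>b\<close> labels the at most \<open>n\<close> restrictions by numbers
    below \<open>n\<close>.\<close>
  obtain b where b: "b ` (T ` H) \<subseteq> {..<n}" "inj_on b (T ` H)"
    using card_le_inj[OF finS finite_lessThan[of n]] cardS by auto
  define k where "k = b (T id)"
  define \<pi> where "\<pi> = restrict (\<lambda>(g, i). if i \<in> b ` T ` H
    then b (restrict (\<tau> g \<circ> inv_into (T ` H) b i) {..<n}) else i) (A \<times> {..<n})"
  have T_comp: "restrict (h \<circ> T h') {..<n} = T (h \<circ> h')" for h h'
    by (auto simp: T_def restrict_def)
  have \<pi>_T: "\<pi> (g, b (T h)) = b (T (\<tau> g \<circ> h))" if "g \<in> A" "h \<in> H" for g h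
  proof -
    have "b (T h) < n" using b(1) that by blast
    then show ?thesis using that b(2) by (simp add: \<pi>_def inv_into_f_f T_comp)
  qed
  have perm: "perm_word \<pi> w k = b (T (word \<tau> w))" if "w \<in> lists A" for w
    using that
  proof (induction w)
    case (Cons g w)
    then have "word \<tau> w \<in> H" by (auto simp: H_def)
    with Cons \<pi>_T show ?case by (simp add: comp_def)
  qed (simp add: k_def id_def)
  have "k < n" using b(1) H_id by (auto simp: k_def)
  moreover have "\<pi> \<in> A \<times> {..<n} \<rightarrow>\<^sub>E {..<n}"
  proof (rule PiE_I)
    fix gi assume "gi \<in> A \<times> {..<n}"
    then obtain g i where gi: "gi = (g, i)" "g \<in> A" "i < n" by auto
    show "\<pi> gi \<in> {..<n}"
    proof (cases "i \<in> b ` T ` H")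
      case True
      then obtain h where h: "h \<in> H" "i = b (T h)" by blast
      then have "\<tau> g \<circ> h \<in> H" using H_comp H_gen gi(2) by blast
      then show ?thesis using b(1) \<pi>_T[OF gi(2) h(1)] h gi by auto
    qed (use gi in \<open>simp add: \<pi>_def\<close>)
  qed (simp add: \<pi>_def)
  moreover have "L = {y. \<forall>v\<in>lists A. \<forall>w\<in>lists A. perm_word \<pi> v k = perm_word \<pi> w k \<longrightarrow> word \<tau> v y = word \<tau> w y}"
    (is "L = ?R")
  proof
    show "L \<subseteq> ?R"
    proof (intro subsetI CollectI ballI impI)
      fix y v w assume y: "y \<in> L" and vw: "v \<in> lists A" "w \<in> lists A" "perm_word \<pi> v k = perm_word \<pi> w k"
      have vwH: "word \<tau> v \<in> H" "word \<tau> w \<in> H" using vw by (auto simp: H_def)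
      have "T (word \<tau> v) = T (word \<tau> w)"
        using vw perm b(2) vwH by (auto simp: inj_on_def)
      with vwH y show "word \<tau> v y = word \<tau> w y" by (intro T_L)
    qed
    \<comment> \<open>Adjoining \<open>y\<close> to the basis creates no new image tuples, since the
      image of \<open>y\<close> is determined by the restriction to \<open>L\<close>. So
      \<open>n + 1\<close> elements have at most \<open>n\<close> image tuples, and Artin's theorem
      gives a dependence over \<open>F\<close>.\<close>
    show "?R \<subseteq> L"
    proof (rule subsetI, rule ccontr)
      fix y assume y: "y \<in> ?R" and "y \<notin> L"
      have det: "h y = h' y" if hh: "h \<in> H" "h' \<in> H" "T h = T h'" for h h'
      proof -
        obtain v w where vw: "v \<in> lists A" "w \<in> lists A" "h = word \<tau> v" "h' = word \<tau> w"
          using hh(1,2) by (auto simp: H_def)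
        have "perm_word \<pi> v k = perm_word \<pi> w k"
          using perm[OF vw(1)] perm[OF vw(2)] hh(3) vw(3,4) by simp
        with y vw(1,2) have "word \<tau> v y = word \<tau> w y" by blast
        with vw(3,4) show ?thesis by simp
      qed
      \<comment> \<open>Index \<open>n\<close> holds the additional element
        \<open>y\<close>.\<close>
      define x' where "x' j = (if j = n then y else x j)" for j
      define T' where "T' h = restrict (h \<circ> x') {..n}" for h :: "'a \<Rightarrow> 'a"
      have T'_T: "T' h = T' h'" if "h \<in> H" "h' \<in> H" "T h = T h'" for h h'
      proof
        fix j
        show "T' h j = T' h' j"
          using fun_cong[OF that(3), of j] det[OF that]
          by (auto simp: T'_def T_def x'_def)
      qed
      have sub: "T' ` H \<subseteq> (\<lambda>s. T' (inv_into H T s)) ` T ` H"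
      proof
        fix t assume "t \<in> T' ` H"
        then obtain h where h: "h \<in> H" "t = T' h" by blast
        have "T' (inv_into H T (T h)) = t"
          unfolding h(2) using h(1) inv_into_into[of "T h" T H] f_inv_into_f[of "T h" T H]
          by (intro T'_T) simp_all
        with h(1) show "t \<in> (\<lambda>s. T' (inv_into H T s)) ` T ` H" by blast
      qed
      have fin': "finite (T' ` H)" using finite_subset[OF sub] finS by simp
      have "card (T' ` H) \<le> card ((\<lambda>s. T' (inv_into H T s)) ` T ` H)"
        using sub finS by (intro card_mono) auto
      also have "\<dots> \<le> n" using card_image_le[OF finS] cardS by (rule le_trans)
      finally have card': "card (T' ` H) < card {..n}" by simp
      have "\<exists>c. (\<exists>j\<in>{..n}. c j \<noteq> 0) \<and> (\<forall>j\<in>{..n}. \<forall>h\<in>H. h (c j) = c j) \<and> (\<Sum>j\<in>{..n}. c j * x' j) = 0"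
        by (rule artin_dependence[OF H H_id H_comp]) (use fin' card' in \<open>auto simp: T'_def\<close>)
      then obtain c where c: "\<exists>j\<le>n. c j \<noteq> 0" "\<forall>j\<le>n. \<forall>h\<in>H. h (c j) = c j" "(\<Sum>j\<le>n. c j * x' j) = 0"
        by auto
      have cF: "c j \<in> F" if "j \<le> n" for j
        using c(2) H_gen that unfolding F(1) by blast
      have sum: "(\<Sum>j<n. c j * x j) + c n * y = 0"
      proof -
        have "(\<Sum>j<n. c j * x' j) = (\<Sum>j<n. c j * x j)"
          by (rule sum.cong) (auto simp: x'_def)
        then show ?thesis using c(3) by (simp add: lessThan_Suc_atMost[symmetric] x'_def)
      qed
      show False
      \<comment> \<open>If \<open>y\<close> does not occur, the relation contradicts the
        independence of the basis; otherwise it can be solved for \<open>y\<close>.\<close>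
      proof (cases "c n = 0")
        case True
        have "(\<forall>j<n. c j \<in> F) \<and> (\<Sum>j<n. c j * x j) = 0"
          using cF sum unfolding True by (auto simp: less_imp_le)
        then have zero: "\<forall>j<n. c j = 0" by (rule indep)
        obtain i where "i \<le> n" "c i \<noteq> 0" using c(1) by blast
        with zero True show False by (cases "i = n") auto
      next
        case False
        have "y = (\<Sum>j<n. (- c j / c n) * x j)"
        proof -
          have "c n * y = - (\<Sum>j<n. c j * x j)" using sum by (simp add: eq_neg_iff_add_eq_0 add.commute)
          then have "y = - (\<Sum>j<n. c j * x j) / c n" using False by (simp add: field_simps)
          then show ?thesis by (simp add: sum_divide_distrib sum_negf)
        qed
        moreover have "- c j / c n \<in> F" if "j < n" for j
        proof -
          have "\<tau> g (- c j / c n) = - c j / c n" if g: "g \<in> A" for g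
          proof -
            have "\<tau> g (c j) = c j" "\<tau> g (c n) = c n"
              using cF[of j] cF[of n] g \<open>j < n\<close> unfolding F(1) by auto
            moreover have "\<tau> g (- c j / c n) * \<tau> g (c n) = - \<tau> g (c j)"
              using False by (simp flip: endoD(3,5)[OF \<tau>[OF g]])
            ultimately show ?thesis using False by (simp add: field_simps)
          qed
          then show ?thesis unfolding F(1) by blast
        qed
        ultimately have "y \<in> L"
          unfolding span by (intro CollectI exI[of _ "\<lambda>j. - c j / c n"]) auto
        with \<open>y \<notin> L\<close> show False ..
      qed
    qed
  qed
  ultimately show ?thesis by blast
qed

text \<open>By \<open>extension_determined_by_permutations\<close> the field is recovered from a
  pair of a label and a map on labels, and only finitely many such pairs exist.\<close>

theorem finite_extensions_of_fixed_field:
  fixes \<tau> :: "'g \<Rightarrow> 'a::field \<Rightarrow> 'a"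
  assumes "finite A" and \<tau>: "\<And>g. g \<in> A \<Longrightarrow> endo (\<tau> g)"
    and F: "F = {x. \<forall>g\<in>A. \<tau> g x = x}" "subfield F ring_of_type_algebra"
  shows "finite {L. subfield L ring_of_type_algebra \<and> ring.dimension ring_of_type_algebra n F L}"
proof (rule finite_subset)
  let ?R = "\<lambda>(k, \<pi>). {y. \<forall>v\<in>lists A. \<forall>w\<in>lists A. perm_word \<pi> v k = perm_word \<pi> w k \<longrightarrow> word \<tau> v y = word \<tau> w y}"
  show "{L. subfield L ring_of_type_algebra \<and> ring.dimension ring_of_type_algebra n F L} \<subseteq>
      ?R ` ({..<n} \<times> (A \<times> {..<n} \<rightarrow>\<^sub>E {..<n}))"
    using extension_determined_by_permutations[OF \<tau> F] by fastforce
  show "finite (?R ` ({..<n} \<times> (A \<times> {..<n} \<rightarrow>\<^sub>E {..<n})))"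
    using assms(1) by (intro finite_imageI finite_cartesian_product finite_PiE) auto
qed

theorem G_TCF_constants_bounded:
  fixes G :: "('g, 'm) monoid_scheme" and \<sigma> :: "'g \<Rightarrow> 'k::field \<Rightarrow> 'k"
  assumes G: "group G" and fin: "finite (carrier G)" and TCF: "models_G_TCF G \<sigma>"
  shows "bounded_field (constants G \<sigma>)"
proof -
  have tf: "transformal_field G \<sigma>" using TCF by (simp add: models_G_TCF_def)
  have "\<exists>t :: 'k alg_closure \<Rightarrow> 'k alg_closure. endo t \<and> (\<forall>c. t (to_ac c) = to_ac (\<sigma> g c))"
    if "g \<in> carrier G" for g
    by (rule endo_extends_to_alg_closure[OF transformal_field_endo[OF tf that]])
  then obtain \<tau> :: "'g \<Rightarrow> 'k alg_closure \<Rightarrow> 'k alg_closure" where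
    \<tau>: "\<And>g. g \<in> carrier G \<Longrightarrow> endo (\<tau> g)" "\<And>g c. g \<in> carrier G \<Longrightarrow> \<tau> g (to_ac c) = to_ac (\<sigma> g c)"
    by metis
  let ?F = "to_ac ` constants G \<sigma>"
  \<comment> \<open>The base field embedded in its algebraic closure has the constants as exact
    fixed field of the lifts, so the count for fixed fields applies.\<close>
  have F: "?F = {x. \<forall>g\<in>carrier G. \<tau> g x = x}"
  proof
    show "{x. \<forall>g\<in>carrier G. \<tau> g x = x} \<subseteq> ?F"
      using fixed_by_lifts_imp_constant[OF G TCF \<tau>] by blast
  qed (auto simp: \<tau>(2) constants_def)
  interpret hom: ring_hom_ring "ring_of_type_algebra :: 'k ring" "ring_of_type_algebra :: 'k alg_closure ring" to_ac
    by (intro ring_hom_ringI2 cring.axioms(1) type_ring_cring) (auto simp: ring_hom_def)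
  have sf: "subfield ?F ring_of_type_algebra"
    by (rule hom.img_is_subfield(2)[OF constants_subfield[OF tf]]) auto
  have "finite {L. subfield L (ring_of_type_algebra :: 'k alg_closure ring) \<and>
      to_ac ` constants G \<sigma> \<subseteq> L \<and> L \<subseteq> alg_closure_of (constants G \<sigma>) \<and>
      ring.dimension ring_of_type_algebra n ?F L}" for n
    by (rule finite_subset[OF _ finite_extensions_of_fixed_field[OF fin \<tau>(1) F sf, where n = n]]) blast+
  with constants_subfield[OF tf] show ?thesis
    unfolding bounded_field_def by blast
qed

section \<open>Locally ringed spaces\<close>

lemma ring_hom_Units:
  assumes "h \<in> ring_hom R S" "u \<in> Units R"
  shows "h u \<in> Units S"
proof -
  obtain v where v: "u \<in> carrier R" "v \<in> carrier R" "v \<otimes>\<^bsub>R\<^esub> u = \<one>\<^bsub>R\<^esub>" "u \<otimes>\<^bsub>R\<^esub> v = \<one>\<^bsub>R\<^esub>"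
    using assms(2) by (auto simp: Units_def)
  have "h v \<otimes>\<^bsub>S\<^esub> h u = \<one>\<^bsub>S\<^esub>" "h u \<otimes>\<^bsub>S\<^esub> h v = \<one>\<^bsub>S\<^esub>"
    using ring_hom_mult[OF assms(1)] ring_hom_one[OF assms(1)] v by metis+
  moreover have "h u \<in> carrier S" "h v \<in> carrier S" using v ring_hom_closed[OF assms(1)] by blast+
  ultimately show ?thesis unfolding Units_def by blast
qed

locale locally_ringed_space =
  fixes Z :: "('v, 'b, 'k) ringed_space"
  assumes locally_ringed: "locally_ringed Z"
begin

lemma presheaf: "presheaf Z"
  using locally_ringed by (simp add: locally_ringed_def sheaf_def)

lemma sect_cring: "openin (topo Z) U \<Longrightarrow> cring (sect Z U)"
  using presheaf by (simp add: presheaf_def)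

lemma rstr_hom:
  "openin (topo Z) U \<Longrightarrow> openin (topo Z) V \<Longrightarrow> V \<subseteq> U \<Longrightarrow> rstr Z U V \<in> ring_hom (sect Z U) (sect Z V)"
  using presheaf unfolding presheaf_def by blast

lemma rstr_rstr:
  "openin (topo Z) U \<Longrightarrow> openin (topo Z) V \<Longrightarrow> openin (topo Z) W \<Longrightarrow> W \<subseteq> V \<Longrightarrow> V \<subseteq> U \<Longrightarrow>
    s \<in> carrier (sect Z U) \<Longrightarrow> rstr Z V W (rstr Z U V s) = rstr Z U W s"
  using presheaf unfolding presheaf_def by blast

lemma rstr_closed:
  "openin (topo Z) U \<Longrightarrow> openin (topo Z) V \<Longrightarrow> V \<subseteq> U \<Longrightarrow> s \<in> carrier (sect Z U) \<Longrightarrow>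
    rstr Z U V s \<in> carrier (sect Z V)"
  by (rule ring_hom_closed[OF rstr_hom])

lemma unit_germ_zero:
  "openin (topo Z) U \<Longrightarrow> x \<in> U \<Longrightarrow> \<not> unit_germ Z U \<zero>\<^bsub>sect Z U\<^esub> x"
  using locally_ringed unfolding locally_ringed_def by blast

lemma unit_germ_add:
  "openin (topo Z) U \<Longrightarrow> x \<in> U \<Longrightarrow> s \<in> carrier (sect Z U) \<Longrightarrow> t \<in> carrier (sect Z U) \<Longrightarrow>
    unit_germ Z U (s \<oplus>\<^bsub>sect Z U\<^esub> t) x \<Longrightarrow> unit_germ Z U s x \<or> unit_germ Z U t x"
  using locally_ringed unfolding locally_ringed_def by blast

lemma unit_germ_one:
  assumes "openin (topo Z) U" "x \<in> U"
  shows "unit_germ Z U \<one>\<^bsub>sect Z U\<^esub> x"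
proof -
  interpret cring "sect Z U" by (rule sect_cring[OF assms(1)])
  have "rstr Z U U \<one>\<^bsub>sect Z U\<^esub> = \<one>\<^bsub>sect Z U\<^esub>"
    using ring_hom_one[OF rstr_hom] assms(1) by blast
  then show ?thesis unfolding unit_germ_def using assms by (intro exI[of _ U]) simp
qed

lemma unit_germ_shrink:
  assumes U: "openin (topo Z) U" "s \<in> carrier (sect Z U)" and s: "unit_germ Z U s x"
    and V: "openin (topo Z) V" "x \<in> V"
  shows "\<exists>W. openin (topo Z) W \<and> x \<in> W \<and> W \<subseteq> U \<and> W \<subseteq> V \<and> rstr Z U W s \<in> Units (sect Z W)"
proof -
  obtain W where W: "openin (topo Z) W" "x \<in> W" "W \<subseteq> U" "rstr Z U W s \<in> Units (sect Z W)"
    using s by (auto simp: unit_germ_def)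
  have WV: "openin (topo Z) (W \<inter> V)" using W V by blast
  have "rstr Z W (W \<inter> V) (rstr Z U W s) \<in> Units (sect Z (W \<inter> V))"
    by (rule ring_hom_Units[OF rstr_hom[OF W(1) WV] W(4)]) blast
  also have "rstr Z W (W \<inter> V) (rstr Z U W s) = rstr Z U (W \<inter> V) s"
    by (rule rstr_rstr) (use U W WV in auto)
  finally show ?thesis using W V WV by (intro exI[of _ "W \<inter> V"]) auto
qed

lemma unit_germ_restrict:
  assumes U: "openin (topo Z) U" "s \<in> carrier (sect Z U)" and V: "openin (topo Z) V" "V \<subseteq> U" "x \<in> V"
  shows "unit_germ Z V (rstr Z U V s) x \<longleftrightarrow> unit_germ Z U s x"
proof
  assume "unit_germ Z V (rstr Z U V s) x"
  then obtain W where W: "openin (topo Z) W" "x \<in> W" "W \<subseteq> V" "rstr Z V W (rstr Z U V s) \<in> Units (sect Z W)"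
    by (auto simp: unit_germ_def)
  moreover have "rstr Z V W (rstr Z U V s) = rstr Z U W s"
    by (rule rstr_rstr) (use U V W in auto)
  ultimately show "unit_germ Z U s x" unfolding unit_germ_def using V by auto
next
  assume "unit_germ Z U s x"
  from unit_germ_shrink[OF U this V(1,3)] obtain W where
    W: "openin (topo Z) W" "x \<in> W" "W \<subseteq> V" "rstr Z U W s \<in> Units (sect Z W)" by blast
  moreover have "rstr Z V W (rstr Z U V s) = rstr Z U W s"
    by (rule rstr_rstr) (use U V W in auto)
  ultimately show "unit_germ Z V (rstr Z U V s) x" unfolding unit_germ_def by auto
qed

text \<open>A factor of a unit is a unit; conversely, the neighbourhoods on which the two factors
  are units are intersected.\<close>

lemma unit_germ_mult:
  assumes U: "openin (topo Z) U" and s: "s \<in> carrier (sect Z U)" and t: "t \<in> carrier (sect Z U)"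
  shows "unit_germ Z U (s \<otimes>\<^bsub>sect Z U\<^esub> t) x \<longleftrightarrow> unit_germ Z U s x \<and> unit_germ Z U t x"
proof -
  have mult: "rstr Z U W (s \<otimes>\<^bsub>sect Z U\<^esub> t) = rstr Z U W s \<otimes>\<^bsub>sect Z W\<^esub> rstr Z U W t"
    if "openin (topo Z) W" "W \<subseteq> U" for W
    by (rule ring_hom_mult[OF rstr_hom[OF U that] s t])
  show ?thesis
  proof
    assume "unit_germ Z U (s \<otimes>\<^bsub>sect Z U\<^esub> t) x"
    then obtain W where W: "openin (topo Z) W" "x \<in> W" "W \<subseteq> U"
      and u: "rstr Z U W s \<otimes>\<^bsub>sect Z W\<^esub> rstr Z U W t \<in> Units (sect Z W)"
      unfolding unit_germ_def using mult by metis
    interpret W: cring "sect Z W" by (rule sect_cring[OF W(1)])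
    have c: "rstr Z U W s \<in> carrier (sect Z W)" "rstr Z U W t \<in> carrier (sect Z W)"
      using rstr_closed[OF U W(1,3)] s t by blast+
    have "rstr Z U W s \<in> Units (sect Z W)" "rstr Z U W t \<in> Units (sect Z W)"
      using W.unit_factor[OF u c] W.unit_factor[of "rstr Z U W t" "rstr Z U W s"] u c W.m_comm by auto
    with W show "unit_germ Z U s x \<and> unit_germ Z U t x" by (auto simp: unit_germ_def)
  next
    assume st: "unit_germ Z U s x \<and> unit_germ Z U t x"
    then obtain V where V: "openin (topo Z) V" "x \<in> V" "V \<subseteq> U" "rstr Z U V s \<in> Units (sect Z V)"
      by (auto simp: unit_germ_def)
    from unit_germ_shrink[OF U t _ V(1,2)] st obtain W where
      W: "openin (topo Z) W" "x \<in> W" "W \<subseteq> U" "W \<subseteq> V" "rstr Z U W t \<in> Units (sect Z W)" by blast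
    interpret W: cring "sect Z W" by (rule sect_cring[OF W(1)])
    have "rstr Z V W (rstr Z U V s) \<in> Units (sect Z W)"
      by (rule ring_hom_Units[OF rstr_hom[OF V(1) W(1,4)] V(4)])
    then have "rstr Z U W s \<in> Units (sect Z W)"
      by (simp add: rstr_rstr[OF U V(1) W(1,4) V(3) s])
    then have "rstr Z U W (s \<otimes>\<^bsub>sect Z U\<^esub> t) \<in> Units (sect Z W)"
      unfolding mult[OF W(1,3)] using W(5) by blast
    with W show "unit_germ Z U (s \<otimes>\<^bsub>sect Z U\<^esub> t) x" by (auto simp: unit_germ_def)
  qed
qed

lemma unit_germ_power:
  assumes "openin (topo Z) U" "s \<in> carrier (sect Z U)" "unit_germ Z U s x" "x \<in> U"
  shows "unit_germ Z U (s [^]\<^bsub>sect Z U\<^esub> (n::nat)) x"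
proof -
  interpret cring "sect Z U" by (rule sect_cring[OF assms(1)])
  show ?thesis
    by (induction n) (use assms in \<open>auto simp: unit_germ_one unit_germ_mult\<close>)
qed

lemma unit_germ_open:
  assumes "openin (topo Z) U"
  shows "openin (topo Z) {x \<in> U. unit_germ Z U s x}"
proof (subst openin_subopen, intro ballI)
  fix x assume "x \<in> {x \<in> U. unit_germ Z U s x}"
  then obtain W where "openin (topo Z) W" "x \<in> W" "W \<subseteq> U" "rstr Z U W s \<in> Units (sect Z W)"
    by (auto simp: unit_germ_def)
  then show "\<exists>T. openin (topo Z) T \<and> x \<in> T \<and> T \<subseteq> {x \<in> U. unit_germ Z U s x}"
    by (intro exI[of _ W]) (auto simp: unit_germ_def)
qed

lemma affine_localization:
  fixes U :: "'v set" and f :: 'b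
  defines "D \<equiv> {x \<in> U. unit_germ Z U f x}"
  assumes "affine_open Z U" "f \<in> carrier (sect Z U)"
  shows "rstr Z U D f \<in> Units (sect Z D)"
    "t \<in> carrier (sect Z D) \<Longrightarrow> \<exists>a\<in>carrier (sect Z U). \<exists>n::nat.
      t \<otimes>\<^bsub>sect Z D\<^esub> rstr Z U D f [^]\<^bsub>sect Z D\<^esub> n = rstr Z U D a"
    "a \<in> carrier (sect Z U) \<Longrightarrow> rstr Z U D a = \<zero>\<^bsub>sect Z D\<^esub> \<Longrightarrow>
      \<exists>n::nat. f [^]\<^bsub>sect Z U\<^esub> n \<otimes>\<^bsub>sect Z U\<^esub> a = \<zero>\<^bsub>sect Z U\<^esub>"
proof -
  note loc = assms(2)[unfolded affine_open_def Let_def, THEN conjunct2, THEN conjunct2, THEN bspec,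
    OF assms(3), folded D_def]
  show "rstr Z U D f \<in> Units (sect Z D)" using loc by (rule conjunct1)
  show "\<exists>a\<in>carrier (sect Z U). \<exists>n::nat. t \<otimes>\<^bsub>sect Z D\<^esub> rstr Z U D f [^]\<^bsub>sect Z D\<^esub> n = rstr Z U D a"
    if "t \<in> carrier (sect Z D)"
    using loc[THEN conjunct2, THEN conjunct1, THEN bspec, OF that] .
  show "\<exists>n::nat. f [^]\<^bsub>sect Z U\<^esub> n \<otimes>\<^bsub>sect Z U\<^esub> a = \<zero>\<^bsub>sect Z U\<^esub>"
    if "a \<in> carrier (sect Z U)" "rstr Z U D a = \<zero>\<^bsub>sect Z D\<^esub>"
    using loc[THEN conjunct2, THEN conjunct2, THEN bspec, OF that(1), THEN mp, OF that(2)] .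
qed

text \<open>The sections that are zero in every residue field. On an affine open they are nilpotent,
  on a nonempty open of an irreducible space they form a prime ideal; together these facts provide a
  prime nilradical.\<close>

definition vanishing :: "'v set \<Rightarrow> 'b set" where
  "vanishing U = {s \<in> carrier (sect Z U). \<forall>x\<in>U. \<not> unit_germ Z U s x}"

text \<open>The locus where \<open>s\<close> is a unit is empty, and the sheaf axiom for the empty
  cover makes its ring of sections trivial. Hence 1 restricts to 0 there, and the localization
  clause of \<open>affine_open\<close> gives a power of \<open>s\<close> that annihilates 1.\<close>

lemma vanishing_imp_nilpotent:
  assumes "affine_open Z U" "s \<in> vanishing U"
  shows "\<exists>n::nat. s [^]\<^bsub>sect Z U\<^esub> n = \<zero>\<^bsub>sect Z U\<^esub>"
proof -
  have U: "openin (topo Z) U" using assms(1) by (simp add: affine_open_def)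
  interpret U: cring "sect Z U" by (rule sect_cring[OF U])
  have s: "s \<in> carrier (sect Z U)" and D: "{x \<in> U. unit_germ Z U s x} = {}"
    using assms(2) by (auto simp: vanishing_def)
  have empty: "openin (topo Z) {}" by simp
  interpret E: cring "sect Z {}" by (rule sect_cring[OF empty])
  have "rstr Z U {} \<one>\<^bsub>sect Z U\<^esub> \<in> carrier (sect Z (\<Union>{}))"
    using rstr_closed[OF U empty] by auto
  moreover have "\<zero>\<^bsub>sect Z {}\<^esub> \<in> carrier (sect Z (\<Union>{}))" by simp
  moreover have "\<forall>s\<in>carrier (sect Z (\<Union>{})). \<forall>t\<in>carrier (sect Z (\<Union>{})). s = t"
    using locally_ringed unfolding locally_ringed_def sheaf_def by blast
  ultimately have "rstr Z U {} \<one>\<^bsub>sect Z U\<^esub> = \<zero>\<^bsub>sect Z {}\<^esub>" by blast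
  then have "\<exists>n::nat. s [^]\<^bsub>sect Z U\<^esub> n \<otimes>\<^bsub>sect Z U\<^esub> \<one>\<^bsub>sect Z U\<^esub> = \<zero>\<^bsub>sect Z U\<^esub>"
    using affine_localization(3)[OF assms(1) s, of "\<one>\<^bsub>sect Z U\<^esub>"] unfolding D by simp
  with s show ?thesis by simp
qed

text \<open>If \<open>a\<close> times \<open>b\<close> vanishes, the loci where \<open>a\<close> and
  \<open>b\<close> are units are disjoint, so their closed complements cover the space. By
  irreducibility one of the two loci is empty.\<close>

lemma vanishing_prime:
  assumes irr: "irreducible_space (topo Z)" and U: "openin (topo Z) U" "U \<noteq> {}"
  shows "primeideal (vanishing U) (sect Z U)"
proof -
  interpret cring "sect Z U" by (rule sect_cring[OF U(1)])
  show ?thesis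
  proof (rule primeidealI)
    show "ideal (vanishing U) (sect Z U)"
    proof (rule idealI)
      show "ring (sect Z U)" by (rule ring_axioms)
      show "subgroup (vanishing U) (add_monoid (sect Z U))"
      proof (rule add.subgroupI)
        have "\<zero>\<^bsub>sect Z U\<^esub> \<in> vanishing U" using unit_germ_zero[OF U(1)] by (simp add: vanishing_def)
        then show "vanishing U \<noteq> {}" by blast
        fix a b assume a: "a \<in> vanishing U"
        then have ac: "a \<in> carrier (sect Z U)" by (simp add: vanishing_def)
        have "\<ominus>\<^bsub>sect Z U\<^esub> a = \<ominus>\<^bsub>sect Z U\<^esub> \<one>\<^bsub>sect Z U\<^esub> \<otimes>\<^bsub>sect Z U\<^esub> a"
          using ac by (simp add: l_minus)
        then show "\<ominus>\<^bsub>sect Z U\<^esub> a \<in> vanishing U"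
          using a ac unit_germ_mult[OF U(1)] by (auto simp: vanishing_def simp del: l_minus)
        assume "b \<in> vanishing U"
        with a show "a \<oplus>\<^bsub>sect Z U\<^esub> b \<in> vanishing U"
          using unit_germ_add[OF U(1)] unfolding vanishing_def by blast
      qed (auto simp: vanishing_def)
    qed (auto simp: vanishing_def unit_germ_mult[OF U(1)])
    show "cring (sect Z U)" by (rule is_cring)
    have "\<one>\<^bsub>sect Z U\<^esub> \<notin> vanishing U" using unit_germ_one[OF U(1)] U(2) by (auto simp: vanishing_def)
    then show "carrier (sect Z U) \<noteq> vanishing U" by blast
    fix a b assume ab: "a \<in> carrier (sect Z U)" "b \<in> carrier (sect Z U)" "a \<otimes>\<^bsub>sect Z U\<^esub> b \<in> vanishing U"
    let ?D = "\<lambda>s. {x \<in> U. unit_germ Z U s x}"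
    let ?T = "topspace (topo Z)"
    have sub: "?D s \<subseteq> ?T" for s using openin_subset[OF U(1)] by blast
    have "?D a \<inter> ?D b = {}" using ab unit_germ_mult[OF U(1) ab(1,2)] by (auto simp: vanishing_def)
    then have "(?T - ?D a) \<union> (?T - ?D b) = ?T" by blast
    moreover have "closedin (topo Z) (?T - ?D s)" for s
      using unit_germ_open[OF U(1)] by blast
    ultimately have "?T - ?D a = ?T \<or> ?T - ?D b = ?T"
      using irr unfolding irreducible_space_def by blast
    then have "?D a = {} \<or> ?D b = {}" using sub by blast
    then show "a \<in> vanishing U \<or> b \<in> vanishing U" using ab by (auto simp: vanishing_def)
  qed
qed

end

section \<open>The Zariski topology and points of affine opens\<close>

text \<open>The generating sets form a basis and not just a subbasis, since the intersection of
  those of \<open>f\<close> and \<open>g\<close> is that of their product.\<close>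

lemma zariski_basis:
  assumes "cring A" "openin (zariski A) V" "P \<in> V"
  shows "primeideal P A \<and> (\<exists>f\<in>carrier A. f \<notin> P \<and> {Q. primeideal Q A \<and> f \<notin> Q} \<subseteq> V)"
proof -
  have "generate_topology_on {{P. primeideal P A \<and> f \<notin> P} | f. f \<in> carrier A} V"
    using assms(2) unfolding zariski_def openin_topology_generated_by_iff .
  then show ?thesis
    using assms(3)
  proof (induction rule: generate_topology_on.induct)
    case (Int a b)
    then obtain f g where P: "primeideal P A"
      and f: "f \<in> carrier A" "f \<notin> P" "{Q. primeideal Q A \<and> f \<notin> Q} \<subseteq> a"
      and g: "g \<in> carrier A" "g \<notin> P" "{Q. primeideal Q A \<and> g \<notin> Q} \<subseteq> b" by auto
    interpret A: cring A by fact
    have "f \<otimes>\<^bsub>A\<^esub> g \<notin> P" using primeideal.I_prime[OF P f(1) g(1)] f(2) g(2) by blast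
    moreover have "f \<notin> Q \<and> g \<notin> Q" if "primeideal Q A" "f \<otimes>\<^bsub>A\<^esub> g \<notin> Q" for Q
    proof -
      interpret Q: primeideal Q A by fact
      show ?thesis using that(2) f(1) g(1) Q.I_l_closed Q.I_r_closed by blast
    qed
    ultimately show ?case
      using P f g A.m_closed[OF f(1) g(1)] by (intro conjI bexI[of _ "f \<otimes>\<^bsub>A\<^esub> g"]) auto
  next
    case (UN K)
    then obtain k where "k \<in> K" "P \<in> k" by blast
    with UN.IH[OF this] show ?case by blast
  qed auto
qed

lemma zariski_topspace:
  assumes "cring A"
  shows "topspace (zariski A) = {P. primeideal P A}"
proof -
  interpret cring A by fact
  have "\<one>\<^bsub>A\<^esub> \<notin> P" if "primeideal P A" for P
  proof
    interpret P: primeideal P A by fact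
    assume "\<one>\<^bsub>A\<^esub> \<in> P"
    then show False using P.one_imp_carrier P.I_notcarr by simp
  qed
  then show ?thesis
    unfolding zariski_def topology_generated_by_topspace by blast
qed

context locally_ringed_space
begin

lemma affine_homeomorphic:
  "affine_open Z U \<Longrightarrow> homeomorphic_map (subtopology (topo Z) U) (zariski (sect Z U))
    (\<lambda>x. {s \<in> carrier (sect Z U). \<not> unit_germ Z U s x})"
  by (simp add: affine_open_def Let_def)

lemma affine_openin: "affine_open Z U \<Longrightarrow> openin (topo Z) U"
  by (simp add: affine_open_def)

lemma affine_topspace:
  assumes "affine_open Z U"
  shows "topspace (subtopology (topo Z) U) = U"
  using openin_subset[OF affine_openin[OF assms]] by (simp add: Int_absorb1)

lemma affine_point_of_prime:
  assumes U: "affine_open Z U" and P: "primeideal P (sect Z U)"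
  shows "\<exists>x\<in>U. {s \<in> carrier (sect Z U). \<not> unit_germ Z U s x} = P"
proof -
  have "P \<in> topspace (zariski (sect Z U))"
    using P unfolding zariski_topspace[OF sect_cring[OF affine_openin[OF U]]] by (rule CollectI)
  also have "\<dots> = (\<lambda>x. {s \<in> carrier (sect Z U). \<not> unit_germ Z U s x}) ` U"
    using homeomorphic_imp_surjective_map[OF affine_homeomorphic[OF U]]
    unfolding affine_topspace[OF U] by (rule sym)
  finally show ?thesis by (rule imageE) (rule bexI, rule sym)
qed

text \<open>The homeomorphism carries \<open>V \<inter> U\<close> to an open set of primes, which
  contains a basic open set around the image of \<open>x\<close>; injectivity brings it back into
  \<open>V\<close>.\<close>

lemma affine_basic_neighbourhood:
  assumes U: "affine_open Z U" and x: "x \<in> U" "openin (topo Z) V" "x \<in> V"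
  shows "\<exists>f\<in>carrier (sect Z U). unit_germ Z U f x \<and> {y \<in> U. unit_germ Z U f y} \<subseteq> V"
proof -
  define \<theta> where "\<theta> x = {s \<in> carrier (sect Z U). \<not> unit_germ Z U s x}" for x
  have homeo: "homeomorphic_map (subtopology (topo Z) U) (zariski (sect Z U)) \<theta>"
    using affine_homeomorphic[OF U] unfolding \<theta>_def .
  have cr: "cring (sect Z U)" by (rule sect_cring[OF affine_openin[OF U]])
  have "openin (subtopology (topo Z) U) (V \<inter> U)"
    using x(2) by (auto simp: openin_subtopology)
  then have "openin (zariski (sect Z U)) (\<theta> ` (V \<inter> U))"
    using homeomorphic_map_openness[OF homeo, of "V \<inter> U"] affine_topspace[OF U] by auto
  from zariski_basis[OF cr this, of "\<theta> x"] x obtain f where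
    f: "f \<in> carrier (sect Z U)" "f \<notin> \<theta> x" "{Q. primeideal Q (sect Z U) \<and> f \<notin> Q} \<subseteq> \<theta> ` (V \<inter> U)"
    by blast
  have "y \<in> V" if y: "y \<in> U" "unit_germ Z U f y" for y
  proof -
    have "\<theta> y \<in> topspace (zariski (sect Z U))"
      using homeomorphic_imp_surjective_map[OF homeo] y(1) affine_topspace[OF U] by blast
    then have "primeideal (\<theta> y) (sect Z U)" unfolding zariski_topspace[OF cr] by blast
    moreover have "f \<notin> \<theta> y" using y(2) by (simp add: \<theta>_def)
    ultimately obtain z where z: "z \<in> V \<inter> U" "\<theta> y = \<theta> z" using f(3) by blast
    have "inj_on \<theta> U"
      using homeomorphic_imp_injective_map[OF homeo] unfolding affine_topspace[OF U] .
    with z y(1) show ?thesis by (auto dest: inj_onD)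
  qed
  with f show ?thesis by (auto simp: \<theta>_def)
qed

end

section \<open>Rational points\<close>

text \<open>The maximal ideal at \<open>x\<close> is the kernel of a homomorphism onto
  \<open>F\<close>. Near \<open>x\<close> a section is a fraction \<open>a / f ^ n\<close>, and its
  value at \<open>x\<close> is the corresponding fraction of values of \<open>\<psi>\<close> in
  \<open>F\<close>.\<close>

lemma rational_point_of_hom:
  fixes Z :: "('v, 'b, 'k::field) ringed_space"
  assumes Z: "locally_ringed Z" and U: "affine_open Z U" and x: "x \<in> U"
    and cst: "\<And>c. c \<in> F \<Longrightarrow> cst Z c \<in> carrier (sect Z (topspace (topo Z)))"
    and \<psi>: "\<psi> \<in> ring_hom (sect Z U) (ring_of_type_algebra :: 'k ring)"
    and \<psi>_F: "\<And>a. a \<in> carrier (sect Z U) \<Longrightarrow> \<psi> a \<in> F"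
    and \<psi>_cst: "\<And>c. c \<in> F \<Longrightarrow> \<psi> (cst_on Z U c) = c"
    and ker: "{s \<in> carrier (sect Z U). \<not> unit_germ Z U s x} = {s \<in> carrier (sect Z U). \<psi> s = 0}"
    and F: "\<And>a b. a \<in> F \<Longrightarrow> b \<in> F \<Longrightarrow> a * b \<in> F" "\<And>a. a \<in> F \<Longrightarrow> inverse a \<in> F"
      "\<And>a n. a \<in> F \<Longrightarrow> a ^ n \<in> F"
  shows "rational_point F Z x"
  unfolding rational_point_def
proof (intro conjI allI impI ballI)
  interpret locally_ringed_space Z by (rule locally_ringed_space.intro[OF Z])
  have oU: "openin (topo Z) U" by (rule affine_openin[OF U])
  show "x \<in> topspace (topo Z)" using openin_subset[OF oU] x by blast
  fix V s assume V: "openin (topo Z) V \<and> x \<in> V" and s: "s \<in> carrier (sect Z V)"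
  interpret U: cring "sect Z U" by (rule sect_cring[OF oU])
  interpret V: cring "sect Z V" by (rule sect_cring) (use V in blast)
  interpret K: cring "ring_of_type_algebra :: 'k ring" by (rule type_ring_cring)
  interpret \<psi>: ring_hom_cring "sect Z U" "ring_of_type_algebra :: 'k ring" \<psi>
    by (intro ring_hom_cringI ring_hom_cring.intro U.cring_axioms K.cring_axioms ring_hom_cring_axioms.intro \<psi>)
  let ?T = "topspace (topo Z)"
  have oT: "openin (topo Z) ?T" by (rule openin_topspace)
  \<comment> \<open>\<open>V\<close> need not lie in \<open>U\<close>. The basic open set of
    \<open>f\<close> lies in both, and sections over it are described by localization.\<close>
  obtain f where f: "f \<in> carrier (sect Z U)" "unit_germ Z U f x" "{y \<in> U. unit_germ Z U f y} \<subseteq> V"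
    using affine_basic_neighbourhood[OF U x] V by blast
  define D where "D = {y \<in> U. unit_germ Z U f y}"
  have D: "openin (topo Z) D" "D \<subseteq> U" "D \<subseteq> V" "x \<in> D"
    unfolding D_def using unit_germ_open[OF oU] f x by auto
  interpret D: cring "sect Z D" by (rule sect_cring[OF D(1)])
  have sD: "rstr Z V D s \<in> carrier (sect Z D)" using rstr_closed[OF _ D(1,3) s] V by blast
  obtain a n where a: "a \<in> carrier (sect Z U)"
    and eq: "rstr Z V D s \<otimes>\<^bsub>sect Z D\<^esub> rstr Z U D f [^]\<^bsub>sect Z D\<^esub> (n::nat) = rstr Z U D a"
    using affine_localization(2)[OF U f(1)] sD unfolding D_def by blast
  have \<psi>f: "\<psi> f \<noteq> 0" using f(1,2) ker by blast
  define c where "c = \<psi> a * inverse (\<psi> f ^ n)"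
  have c: "c \<in> F" unfolding c_def by (intro F \<psi>_F a f)
  have cT: "cst Z c \<in> carrier (sect Z ?T)" by (rule cst[OF c])
  have cst_closed: "cst_on Z W c \<in> carrier (sect Z W)" if "openin (topo Z) W" for W
    unfolding cst_on_def by (rule rstr_closed[OF oT that openin_subset[OF that] cT])
  \<comment> \<open>This is the numerator of \<open>s\<close> minus \<open>c\<close> over
    \<open>f ^ n\<close>. It lies in the kernel of \<open>\<psi>\<close>, so it is not a unit at
    \<open>x\<close>; were \<open>s\<close> minus \<open>c\<close> a unit there, so would be
    \<open>b\<close>.\<close>
  define b where "b = a \<ominus>\<^bsub>sect Z U\<^esub> cst_on Z U c \<otimes>\<^bsub>sect Z U\<^esub> f [^]\<^bsub>sect Z U\<^esub> n"
  have bU: "b \<in> carrier (sect Z U)" unfolding b_def using a f cst_closed[OF oU] by simp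
  have "\<psi> b = \<psi> a - \<psi> (cst_on Z U c) * \<psi> f ^ n"
    unfolding b_def a_minus_def using a f(1) cst_closed[OF oU] by simp
  also have "\<dots> = 0" using \<psi>f by (simp add: \<psi>_cst[OF c]) (simp add: c_def)
  finally have b: "\<not> unit_germ Z U b x" using bU ker by blast
  have "\<not> unit_germ Z V (s \<ominus>\<^bsub>sect Z V\<^esub> cst_on Z V c) x"
  proof
    let ?t = "s \<ominus>\<^bsub>sect Z V\<^esub> cst_on Z V c"
    have oV: "openin (topo Z) V" using V by blast
    have tV: "?t \<in> carrier (sect Z V)" using s cst_closed[OF oV] by simp
    assume "unit_germ Z V ?t x"
    then have t: "unit_germ Z D (rstr Z V D ?t) x"
      using unit_germ_restrict[OF oV tV D(1,3,4)] by blast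
    interpret VD: ring_hom_cring "sect Z V" "sect Z D" "rstr Z V D"
      by (intro ring_hom_cringI ring_hom_cring.intro V.cring_axioms D.cring_axioms
          ring_hom_cring_axioms.intro rstr_hom oV D)
    interpret UD: ring_hom_cring "sect Z U" "sect Z D" "rstr Z U D"
      by (intro ring_hom_cringI ring_hom_cring.intro U.cring_axioms D.cring_axioms
          ring_hom_cring_axioms.intro rstr_hom oU D)
    have cst_D: "rstr Z V D (cst_on Z V c) = cst_on Z D c" "rstr Z U D (cst_on Z U c) = cst_on Z D c"
      unfolding cst_on_def
      using rstr_rstr[OF oT oV D(1,3) openin_subset[OF oV] cT]
        rstr_rstr[OF oT oU D(1,2) openin_subset[OF oU] cT] by blast+
    let ?f = "rstr Z U D f" and ?s = "rstr Z V D s" and ?c = "cst_on Z D c"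
    have fD: "?f \<in> carrier (sect Z D)" and cD: "?c \<in> carrier (sect Z D)"
      using UD.hom_closed[OF f(1)] cst_closed[OF D(1)] by blast+
    have t_eq: "rstr Z V D ?t = ?s \<ominus>\<^bsub>sect Z D\<^esub> ?c"
      unfolding a_minus_def using s cst_closed[OF oV] by (simp add: cst_D)
    have "rstr Z U D b = rstr Z U D a \<ominus>\<^bsub>sect Z D\<^esub> ?c \<otimes>\<^bsub>sect Z D\<^esub> ?f [^]\<^bsub>sect Z D\<^esub> n"
      unfolding b_def a_minus_def using a f(1) cst_closed[OF oU] by (simp add: cst_D)
    also have "\<dots> = (?s \<ominus>\<^bsub>sect Z D\<^esub> ?c) \<otimes>\<^bsub>sect Z D\<^esub> ?f [^]\<^bsub>sect Z D\<^esub> n"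
      unfolding eq[symmetric] a_minus_def using sD fD cD by (simp add: D.l_distr D.l_minus)
    finally have b_eq: "rstr Z U D b = rstr Z V D ?t \<otimes>\<^bsub>sect Z D\<^esub> ?f [^]\<^bsub>sect Z D\<^esub> n"
      unfolding t_eq .
    have "unit_germ Z D ?f x" using unit_germ_restrict[OF oU f(1) D(1,2,4)] f(2) by blast
    then have "unit_germ Z D (?f [^]\<^bsub>sect Z D\<^esub> n) x" by (rule unit_germ_power[OF D(1) fD _ D(4)])
    with t have "unit_germ Z D (rstr Z U D b) x"
      unfolding b_eq using unit_germ_mult[OF D(1)] VD.hom_closed[OF tV] D.nat_pow_closed[OF fD] by blast
    then have "unit_germ Z U b x" using unit_germ_restrict[OF oU bU D(1,2,4)] by blast
    with b show False ..
  qed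
  with c show "\<exists>c\<in>F. \<not> unit_germ Z V (s \<ominus>\<^bsub>sect Z V\<^esub> cst_on Z V c) x" by blast
qed

text \<open>Conjugating the scalars preserves linear relations over an \<open>F\<close>-algebra, by induction on the
  number of terms: an \<open>F\<close>-linear dependence between the scalars eliminates a term, and
  otherwise the relation is trivial.\<close>

lemma tensor_relation_conjugate:
  fixes A :: "('b, 'm) ring_scheme" and T :: "('c, 'n) ring_scheme" and \<beta> :: "'k::field \<Rightarrow> 'c"
  assumes "cring A" "cring T" and \<alpha>: "\<alpha> \<in> ring_hom A T"
    and \<beta>: "\<beta> \<in> ring_hom ring_of_type_algebra T"
    and \<gamma>: "\<And>c. c \<in> F \<Longrightarrow> \<gamma> c \<in> carrier A" "\<And>c. c \<in> F \<Longrightarrow> \<alpha> (\<gamma> c) = \<beta> c"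
    and free: "\<And>B a. finite B \<Longrightarrow> lin_indep_over F B \<Longrightarrow> a \<in> B \<rightarrow> carrier A \<Longrightarrow>
      (\<Oplus>\<^bsub>T\<^esub>k\<in>B. \<alpha> (a k) \<otimes>\<^bsub>T\<^esub> \<beta> k) = \<zero>\<^bsub>T\<^esub> \<Longrightarrow> \<forall>k\<in>B. a k = \<zero>\<^bsub>A\<^esub>"
    and F: "0 \<in> F" "1 \<in> F" "\<And>a b. a \<in> F \<Longrightarrow> b \<in> F \<Longrightarrow> a * b \<in> F" "\<And>a. a \<in> F \<Longrightarrow> - a \<in> F" "\<And>a. a \<in> F \<Longrightarrow> inverse a \<in> F"
    and \<sigma>: "endo \<sigma>" "\<And>c. c \<in> F \<Longrightarrow> \<sigma> c = c"
    and M: "finite M" "\<And>m. m \<in> M \<Longrightarrow> a m \<in> carrier A"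
      "(\<Oplus>\<^bsub>T\<^esub>m\<in>M. \<alpha> (a m) \<otimes>\<^bsub>T\<^esub> \<beta> (c m)) = \<zero>\<^bsub>T\<^esub>"
  shows "(\<Oplus>\<^bsub>T\<^esub>m\<in>M. \<alpha> (a m) \<otimes>\<^bsub>T\<^esub> \<beta> (\<sigma> (c m))) = \<zero>\<^bsub>T\<^esub>"
proof -
  interpret A: cring A by fact
  interpret T: cring T by fact
  interpret K: cring "ring_of_type_algebra :: 'k ring" by (rule type_ring_cring)
  interpret \<alpha>: ring_hom_cring A T \<alpha>
    by (intro ring_hom_cringI ring_hom_cring.intro A.cring_axioms T.cring_axioms ring_hom_cring_axioms.intro \<alpha>)
  interpret \<beta>: ring_hom_cring "ring_of_type_algebra :: 'k ring" T \<beta>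
    by (intro ring_hom_cringI ring_hom_cring.intro K.cring_axioms T.cring_axioms ring_hom_cring_axioms.intro \<beta>)
  have \<beta>_simps [simp]: "\<beta> k \<in> carrier T" "\<beta> 0 = \<zero>\<^bsub>T\<^esub>" "\<beta> (k + l) = \<beta> k \<oplus>\<^bsub>T\<^esub> \<beta> l" "\<beta> (k * l) = \<beta> k \<otimes>\<^bsub>T\<^esub> \<beta> l" for k l
    using \<beta>.hom_closed[of k] \<beta>.hom_zero \<beta>.hom_add[of k l] \<beta>.hom_mult[of k l] by auto
  have \<beta>_sum: "\<beta> (sum h I) = (\<Oplus>\<^bsub>T\<^esub>i\<in>I. \<beta> (h i))" if "finite I" for h :: "'x \<Rightarrow> 'k" and I
    using that by (induction I rule: finite_induct) auto
  from M show ?thesis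
  proof (induction M arbitrary: a rule: finite_psubset_induct)
    case (psubset M)
    note aM = psubset.prems(1)
    show ?case
    proof (cases "inj_on c M \<and> lin_indep_over F (c ` M)")
      case True
      \<comment> \<open>The coefficients are reindexed by the scalars themselves, as
        \<open>free\<close> requires.\<close>
      define a' where "a' k = a (inv_into M c k)" for k
      have a': "a' (c m) = a m" if "m \<in> M" for m
        using True that by (simp add: a'_def)
      have "(\<Oplus>\<^bsub>T\<^esub>k\<in>c ` M. \<alpha> (a' k) \<otimes>\<^bsub>T\<^esub> \<beta> k) = (\<Oplus>\<^bsub>T\<^esub>m\<in>M. \<alpha> (a' (c m)) \<otimes>\<^bsub>T\<^esub> \<beta> (c m))"
        using True aM by (intro T.add.finprod_reindex) (auto simp: a')
      also have "\<dots> = (\<Oplus>\<^bsub>T\<^esub>m\<in>M. \<alpha> (a m) \<otimes>\<^bsub>T\<^esub> \<beta> (c m))"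
        using aM by (intro T.finsum_cong') (auto simp: a')
      finally have "(\<Oplus>\<^bsub>T\<^esub>k\<in>c ` M. \<alpha> (a' k) \<otimes>\<^bsub>T\<^esub> \<beta> k) = \<zero>\<^bsub>T\<^esub>"
        using psubset.prems(2) by simp
      then have "\<forall>k\<in>c ` M. a' k = \<zero>\<^bsub>A\<^esub>"
        using True aM psubset.hyps by (intro free) (auto simp: a')
      then have "a m = \<zero>\<^bsub>A\<^esub>" if "m \<in> M" for m using a' that by force
      then have "(\<Oplus>\<^bsub>T\<^esub>m\<in>M. \<alpha> (a m) \<otimes>\<^bsub>T\<^esub> \<beta> (\<sigma> (c m))) = (\<Oplus>\<^bsub>T\<^esub>m\<in>M. \<zero>\<^bsub>T\<^esub>)"
        by (intro T.finsum_cong') auto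
      then show ?thesis by simp
    next
      case False
      have "\<exists>l. (\<forall>m\<in>M. l m \<in> F) \<and> (\<exists>m\<in>M. l m \<noteq> 0) \<and> (\<Sum>m\<in>M. l m * c m) = 0"
      proof (cases "inj_on c M")
        case True
        with False obtain d where d: "\<forall>k\<in>c ` M. d k \<in> F" "(\<Sum>k\<in>c ` M. d k * k) = 0" "\<exists>k\<in>c ` M. d k \<noteq> 0"
          unfolding lin_indep_over_def by blast
        have "(\<Sum>m\<in>M. d (c m) * c m) = 0" using d(2) True by (simp add: sum.reindex)
        with d show ?thesis by (intro exI[of _ "\<lambda>m. d (c m)"]) auto
      next
        case False
        then obtain m m' where m: "m \<in> M" "m' \<in> M" "m \<noteq> m'" "c m = c m'" by (auto simp: inj_on_def)
        \<comment> \<open>Two equal scalars are dependent through the coefficients 1 and -1.\<close>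
        have "(\<Sum>i\<in>M. (if i = m then 1 else if i = m' then - 1 else 0) * c i) =
            (\<Sum>i\<in>{m, m'}. (if i = m then 1 else if i = m' then - 1 else 0) * c i)"
          using m psubset.hyps by (intro sum.mono_neutral_right) auto
        also have "\<dots> = 0" using m by simp
        finally show ?thesis
          using m F(1,2,4) by (intro exI[of _ "\<lambda>i. if i = m then 1 else if i = m' then - 1 else 0"]) auto
      qed
      then obtain l m0 where l: "\<And>m. m \<in> M \<Longrightarrow> l m \<in> F" "m0 \<in> M" "l m0 \<noteq> 0" "(\<Sum>m\<in>M. l m * c m) = 0"
        by blast
      define N where "N = M - {m0}"
      have N: "finite N" "m0 \<notin> N" "M = insert m0 N" "N \<subset> M" using psubset.hyps l(2) by (auto simp: N_def)
      define \<mu> where "\<mu> m = - (l m * inverse (l m0))" for m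
      have \<mu>: "\<mu> m \<in> F" if "m \<in> M" for m unfolding \<mu>_def using l(1) l(2) that by (intro F) auto
      have c0: "c m0 = (\<Sum>m\<in>N. \<mu> m * c m)"
      proof -
        have "l m0 * c m0 + (\<Sum>m\<in>N. l m * c m) = 0" using l(4) N by simp
        then have "l m0 * c m0 = - (\<Sum>m\<in>N. l m * c m)" by (simp add: eq_neg_iff_add_eq_0)
        then have "c m0 = - (\<Sum>m\<in>N. l m * c m) * inverse (l m0)" using l(3) by (simp add: field_simps)
        also have "\<dots> = (\<Sum>m\<in>N. \<mu> m * c m)"
          by (simp add: \<mu>_def sum_distrib_left sum_distrib_right sum_negf mult_ac)
        finally show ?thesis .
      qed
      have \<sigma>c0: "\<sigma> (c m0) = (\<Sum>m\<in>N. \<mu> m * \<sigma> (c m))"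
        unfolding c0 endo_sum[OF \<sigma>(1)] using \<mu> N(3) by (intro sum.cong) (auto simp: endoD(3)[OF \<sigma>(1)] \<sigma>(2))
      \<comment> \<open>The term of \<open>m0\<close> is absorbed into the others by writing
        \<open>c m0\<close> as an \<open>F\<close>-combination of the remaining scalars.\<close>
      define a2 where "a2 m = a m \<oplus>\<^bsub>A\<^esub> \<gamma> (\<mu> m) \<otimes>\<^bsub>A\<^esub> a m0" for m
      have a2: "a2 m \<in> carrier A" if "m \<in> N" for m
        unfolding a2_def using that N(3) aM \<gamma>(1) \<mu> by simp
      \<comment> \<open>This is stated for any scalars \<open>d\<close> satisfying the same
        \<open>F\<close>-relation. It applies to \<open>c\<close> and to its conjugate, because
        \<open>\<sigma>\<close> fixes the coefficients \<open>\<mu> m\<close>.\<close>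
      have eliminate: "(\<Oplus>\<^bsub>T\<^esub>m\<in>N. \<alpha> (a2 m) \<otimes>\<^bsub>T\<^esub> \<beta> (d m)) = (\<Oplus>\<^bsub>T\<^esub>m\<in>M. \<alpha> (a m) \<otimes>\<^bsub>T\<^esub> \<beta> (d m))"
        if d: "d m0 = (\<Sum>m\<in>N. \<mu> m * d m)" for d
      proof -
        have [simp]: "\<alpha> (a m) \<in> carrier T" if "m \<in> M" for m using aM that by simp
        have "(\<Oplus>\<^bsub>T\<^esub>m\<in>N. \<alpha> (a2 m) \<otimes>\<^bsub>T\<^esub> \<beta> (d m)) =
            (\<Oplus>\<^bsub>T\<^esub>m\<in>N. \<alpha> (a m) \<otimes>\<^bsub>T\<^esub> \<beta> (d m) \<oplus>\<^bsub>T\<^esub> \<alpha> (a m0) \<otimes>\<^bsub>T\<^esub> \<beta> (\<mu> m * d m))"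
          using aM \<gamma> \<mu> l(2) N(3)
          by (intro T.finsum_cong') (auto simp: a2_def T.l_distr T.r_distr T.m_ac)
        also have "\<dots> = (\<Oplus>\<^bsub>T\<^esub>m\<in>N. \<alpha> (a m) \<otimes>\<^bsub>T\<^esub> \<beta> (d m)) \<oplus>\<^bsub>T\<^esub>
            (\<Oplus>\<^bsub>T\<^esub>m\<in>N. \<alpha> (a m0) \<otimes>\<^bsub>T\<^esub> \<beta> (\<mu> m * d m))"
          using N(3) by (intro T.finsum_addf) auto
        also have "(\<Oplus>\<^bsub>T\<^esub>m\<in>N. \<alpha> (a m0) \<otimes>\<^bsub>T\<^esub> \<beta> (\<mu> m * d m)) = \<alpha> (a m0) \<otimes>\<^bsub>T\<^esub> \<beta> (d m0)"
          unfolding d \<beta>_sum[OF N(1)] using l(2) by (intro T.finsum_rdistr[symmetric] N) auto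
        also have "(\<Oplus>\<^bsub>T\<^esub>m\<in>N. \<alpha> (a m) \<otimes>\<^bsub>T\<^esub> \<beta> (d m)) \<oplus>\<^bsub>T\<^esub> \<alpha> (a m0) \<otimes>\<^bsub>T\<^esub> \<beta> (d m0) =
            \<alpha> (a m0) \<otimes>\<^bsub>T\<^esub> \<beta> (d m0) \<oplus>\<^bsub>T\<^esub> (\<Oplus>\<^bsub>T\<^esub>m\<in>N. \<alpha> (a m) \<otimes>\<^bsub>T\<^esub> \<beta> (d m))"
          using N(3) by (intro T.a_comm T.finsum_closed) auto
        also have "\<dots> = (\<Oplus>\<^bsub>T\<^esub>m\<in>M. \<alpha> (a m) \<otimes>\<^bsub>T\<^esub> \<beta> (d m))"
          unfolding N(3) using N by (intro T.finsum_insert[symmetric]) (auto simp: N(3))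
        finally show ?thesis .
      qed
      have "(\<Oplus>\<^bsub>T\<^esub>m\<in>N. \<alpha> (a2 m) \<otimes>\<^bsub>T\<^esub> \<beta> (c m)) = \<zero>\<^bsub>T\<^esub>"
        unfolding eliminate[OF c0] by (rule psubset.prems(2))
      from psubset.IH[OF N(4) a2 this]
      have "(\<Oplus>\<^bsub>T\<^esub>m\<in>N. \<alpha> (a2 m) \<otimes>\<^bsub>T\<^esub> \<beta> (\<sigma> (c m))) = \<zero>\<^bsub>T\<^esub>" .
      then show ?thesis unfolding eliminate[of "\<lambda>m. \<sigma> (c m)", OF \<sigma>c0] .
    qed
  qed
qed

lemma monom_eval_hom:
  assumes "cring A" "cring T" and \<alpha>: "\<alpha> \<in> ring_hom A T" and \<rho>: "\<And>v. \<rho> v \<in> carrier A"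
  shows "monom_eval T (\<lambda>v. \<alpha> (\<rho> v)) m = \<alpha> (monom_eval A \<rho> m)"
proof -
  interpret A: cring A by fact
  interpret T: cring T by fact
  interpret \<alpha>: ring_hom_cring A T \<alpha>
    by (intro ring_hom_cringI ring_hom_cring.intro A.cring_axioms T.cring_axioms ring_hom_cring_axioms.intro \<alpha>)
  show ?thesis
    by (induction m rule: poly_mapping_add_single_induct)
      (simp_all add: T.monom_eval_add A.monom_eval_add T.monom_eval_single A.monom_eval_single \<rho>)
qed

section \<open>Points of irreducible varieties\<close>

text \<open>Polynomials with coefficients in \<open>F\<close> are generated inductively so that
  their values can be followed along the rules of \<open>generate_ring\<close>.\<close>

inductive_set polys_over :: "'k::field set \<Rightarrow> 'x set \<Rightarrow> ('x, 'k) mpoly set" for F :: "'k set" and S :: "'x set" where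
  const: "c \<in> F \<Longrightarrow> mpoly_const c \<in> polys_over F S"
| var: "v \<in> S \<Longrightarrow> mpoly_var v \<in> polys_over F S"
| add: "f \<in> polys_over F S \<Longrightarrow> g \<in> polys_over F S \<Longrightarrow> f + g \<in> polys_over F S"
| mult: "f \<in> polys_over F S \<Longrightarrow> g \<in> polys_over F S \<Longrightarrow> f * g \<in> polys_over F S"

lemma polys_over_ring: "f \<in> polys_over F S \<Longrightarrow> f \<in> carrier (mpoly_ring S)"
  by (induction rule: polys_over.induct) (auto intro: mpoly_ring_closed)

text \<open>The data of an affine chart: \<open>A\<close> is a finitely generated \<open>F\<close>-algebra with structure map \<open>\<gamma>\<close>,
  \<open>T\<close> its base change, and \<open>P\<close> the nilradical of \<open>T\<close>, which is prime.\<close>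

lemma hom_to_constants:
  fixes G :: "('g, 'm) monoid_scheme" and \<sigma> :: "'g \<Rightarrow> 'k::field \<Rightarrow> 'k"
    and A :: "'b ring" and T :: "'c ring"
  assumes G: "group G" and TCF: "models_G_TCF G \<sigma>" and F_def: "F = constants G \<sigma>"
    and A: "cring A" and T: "cring T" and \<alpha>: "\<alpha> \<in> ring_hom A T"
    and \<beta>: "\<beta> \<in> ring_hom ring_of_type_algebra T"
    and \<gamma>: "\<And>c. c \<in> F \<Longrightarrow> \<gamma> c \<in> carrier A" "\<And>c. c \<in> F \<Longrightarrow> \<alpha> (\<gamma> c) = \<beta> c"
    and free: "\<And>B a. finite B \<Longrightarrow> lin_indep_over F B \<Longrightarrow> a \<in> B \<rightarrow> carrier A \<Longrightarrow>
      (\<Oplus>\<^bsub>T\<^esub>k\<in>B. \<alpha> (a k) \<otimes>\<^bsub>T\<^esub> \<beta> k) = \<zero>\<^bsub>T\<^esub> \<Longrightarrow> \<forall>k\<in>B. a k = \<zero>\<^bsub>A\<^esub>"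
    and gen: "finite S" "S \<subseteq> carrier A" "generate_ring A (\<gamma> ` F \<union> S) = carrier A"
    and P: "primeideal P T" "\<And>t. t \<in> P \<Longrightarrow> \<exists>n::nat. t [^]\<^bsub>T\<^esub> n = \<zero>\<^bsub>T\<^esub>"
  shows "\<exists>\<psi>. \<psi> \<in> ring_hom A ring_of_type_algebra \<and> (\<forall>a\<in>carrier A. \<psi> a \<in> F) \<and> (\<forall>c\<in>F. \<psi> (\<gamma> c) = c)"
proof -
  interpret G: group G by fact
  interpret A: cring A by fact
  interpret T: cring T by fact
  interpret P: primeideal P T by fact
  interpret \<alpha>: ring_hom_cring A T \<alpha>
    by (intro ring_hom_cringI ring_hom_cring.intro A.cring_axioms T.cring_axioms ring_hom_cring_axioms.intro \<alpha>)
  have tf: "transformal_field G \<sigma>" using TCF by (simp add: models_G_TCF_def)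
  note F_closed = constants_closed[OF tf, folded F_def]
  obtain m e where e: "S = e ` {i. i < (m :: nat)}"
    using finite_imp_nat_seg_image_inj_on[OF gen(1)] by blast
  \<comment> \<open>The axioms need at least one variable, while the set of generators may be empty;
    the extra coordinate of \<open>s\<close> is filled with zero.\<close>
  define n where "n = Suc m"
  define s where "s i = (if i < m then e i else \<zero>\<^bsub>A\<^esub>)" for i
  have s: "s i \<in> carrier A" for i using e gen(2) by (auto simp: s_def)
  have S_s: "\<exists>i<n. h = s i" if "h \<in> S" for h
  proof -
    from that e obtain i where "i < m" "h = e i" by auto
    then show ?thesis by (intro exI[of _ i]) (simp add: s_def n_def)
  qed
  define \<rho> where "\<rho> = (\<lambda>(h :: 'g, i). \<alpha> (s i))"
  have \<rho>_closed: "\<alpha> (s i) \<in> carrier T" for i using s by simp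
  interpret E: field_poly_evaluation T \<beta> \<rho>
    unfolding \<rho>_def by unfold_locales (use \<beta> \<rho>_closed in auto)
  have inv: "poly_eval T (\<lambda>c. \<beta> (\<sigma> g c)) (\<lambda>(h :: 'g, i). \<alpha> (s i)) f \<in> P"
    if g: "g \<in> carrier G" and f: "poly_eval T \<beta> (\<lambda>(h :: 'g, i). \<alpha> (s i)) f \<in> P" for g f
  proof -
    have \<sigma>: "endo (\<sigma> g)" by (rule transformal_field_endo[OF tf g])
    interpret E': field_poly_evaluation T "\<lambda>c. \<beta> (\<sigma> g c)" \<rho>
      unfolding \<rho>_def
      by unfold_locales (use \<beta> \<rho>_closed \<sigma> in \<open>auto simp: ring_hom_def endo_def\<close>)
    have kernel: "E'.pe h = \<zero>\<^bsub>T\<^esub>" if h: "E.pe h = \<zero>\<^bsub>T\<^esub>" for h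
    proof -
      define a where "a m = monom_eval A (\<lambda>(h :: 'g, i). s i) m" for m
      have a: "a m \<in> carrier A" for m
        unfolding a_def using s by (intro A.monom_eval_closed) auto
      have "\<rho> = (\<lambda>v. \<alpha> (case v of (h, i) \<Rightarrow> s i))" by (auto simp: \<rho>_def)
      then have me: "monom_eval T \<rho> m = \<alpha> (a m)" for m
        unfolding a_def using s by (simp add: monom_eval_hom[OF A T \<alpha>] split: prod.splits)
      have \<beta>_closed: "\<beta> c \<in> carrier T" for c using \<beta> by (auto simp: ring_hom_def)
      \<comment> \<open>The value of \<open>h\<close> is a sum of pure tensors, with the monomials
        evaluated in \<open>A\<close> and the coefficients as scalars, so
        \<open>tensor_relation_conjugate\<close> applies.\<close>
      have "(\<Oplus>\<^bsub>T\<^esub>m\<in>Poly_Mapping.keys h. \<alpha> (a m) \<otimes>\<^bsub>T\<^esub> \<beta> (Poly_Mapping.lookup h m)) = \<zero>\<^bsub>T\<^esub>"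
        using h a \<beta>_closed unfolding poly_eval_def me by (simp add: T.m_comm)
      then have "(\<Oplus>\<^bsub>T\<^esub>m\<in>Poly_Mapping.keys h. \<alpha> (a m) \<otimes>\<^bsub>T\<^esub> \<beta> (\<sigma> g (Poly_Mapping.lookup h m))) = \<zero>\<^bsub>T\<^esub>"
        using a g
        by (intro tensor_relation_conjugate[OF A T \<alpha> \<beta> \<gamma> free F_closed(1,2,4,5,6) \<sigma>])
          (auto simp: F_def constants_def)
      then show ?thesis
        using a \<beta>_closed unfolding poly_eval_def me by (simp add: T.m_comm)
    qed
    \<comment> \<open>The value of \<open>f\<close> is only nilpotent, so conjugation is applied to
      a power of \<open>f\<close> that evaluates to zero; primality of \<open>P\<close> removes the
      exponent afterwards.\<close>
    obtain k :: nat where "E.pe f [^]\<^bsub>T\<^esub> k = \<zero>\<^bsub>T\<^esub>" using P(2) f unfolding \<rho>_def by blast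
    then have "E.pe (f ^ k) = \<zero>\<^bsub>T\<^esub>" by (simp only: E.eval_power)
    then have "E'.pe (f ^ k) = \<zero>\<^bsub>T\<^esub>" by (rule kernel)
    then have zero: "E'.pe f [^]\<^bsub>T\<^esub> k = \<zero>\<^bsub>T\<^esub>" by (simp only: E'.eval_power)
    have "E'.pe f [^]\<^bsub>T\<^esub> j \<in> P \<Longrightarrow> E'.pe f \<in> P" for j :: nat
    proof (induction j)
      case 0
      then have "\<one>\<^bsub>T\<^esub> \<in> P" by simp
      then show ?case using P.one_imp_carrier E'.eval_closed by simp
    next
      case (Suc j)
      then show ?case
        using P.I_prime[OF T.nat_pow_closed[OF E'.eval_closed] E'.eval_closed, of f j f] by auto
    qed
    moreover have "\<zero>\<^bsub>T\<^esub> \<in> P" by (rule P.zero_closed)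
    ultimately show ?thesis unfolding \<rho>_def[symmetric] using zero by metis
  qed
  have "\<exists>a. (\<forall>i<n. a i \<in> constants G \<sigma>) \<and>
    (\<forall>f\<in>carrier (mpoly_ring (block_vars G n)). poly_eval T \<beta> (\<lambda>(h, i). \<alpha> (s i)) f \<in> P \<longrightarrow>
      mpoly_subst (\<lambda>c. c) (sigma_tuple \<sigma> a) f = 0)"
    by (rule G_TCF_constant_point[OF G TCF _ T \<beta> \<rho>_closed P(1) inv]) (simp_all add: n_def)
  then obtain a where a: "\<And>i. i < n \<Longrightarrow> a i \<in> F"
    and vanish: "\<And>f. f \<in> carrier (mpoly_ring (block_vars G n)) \<Longrightarrow> E.pe f \<in> P \<Longrightarrow>
      mpoly_subst (\<lambda>c. c) (sigma_tuple \<sigma> a) f = 0"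
    unfolding \<rho>_def F_def by blast
  interpret V: field_poly_evaluation "ring_of_type_algebra :: 'k ring" "\<lambda>c. c" "sigma_tuple \<sigma> a"
    by (intro field_poly_evaluation.intro poly_evaluation.intro type_ring_cring
        poly_evaluation_axioms.intro) (auto simp: ring_hom_def)
  \<comment> \<open>for the identity as coefficient map these rules loop with those for the ring of the type\<close>
  note [simp del] = V.coeff_map
  define Q where "Q = polys_over F (block_vars G n)"
  have Q_ring: "f \<in> carrier (mpoly_ring (block_vars G n))" if "f \<in> Q" for f
    using polys_over_ring that unfolding Q_def .
  have Q_F: "V.pe f \<in> F" if "f \<in> Q" for f
    using that unfolding Q_def
  proof (induction rule: polys_over.induct)
    case (const c)
    then show ?case unfolding V.eval_const .
  next
    case (var v)
    then obtain h i where v: "v = (h, i)" "h \<in> carrier G" "i < n" by (auto simp: block_vars_def)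
    then show ?case
      using a[OF v(3)] unfolding V.eval_var by (auto simp: sigma_tuple_def F_def constants_def)
  next
    case (add f g)
    then show ?case unfolding V.eval_add type_ring_simps by (intro F_closed)
  next
    case (mult f g)
    then show ?case unfolding V.eval_mult type_ring_simps by (intro F_closed)
  qed
  \<comment> \<open>Every element of \<open>A\<close> is represented, after passing to
    \<open>T\<close>, by a polynomial over \<open>F\<close>.\<close>
  have surj: "\<exists>f\<in>Q. E.pe f = \<alpha> x" if "x \<in> carrier A" for x
  proof -
    have "x \<in> generate_ring A (\<gamma> ` F \<union> S)" using that gen(3) by simp
    then show ?thesis
    proof (induction rule: generate_ring.induct)
      case one
      have "mpoly_const 1 \<in> Q" unfolding Q_def by (intro polys_over.const F_closed)
      moreover have "E.pe (mpoly_const 1) = \<alpha> \<one>\<^bsub>A\<^esub>" unfolding E.eval_const by simp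
      ultimately show ?case by blast
    next
      case (incl h)
      show ?case
      proof (cases "h \<in> S")
        case True
        then obtain i where i: "i < n" "h = s i" using S_s by blast
        have "mpoly_var (\<one>\<^bsub>G\<^esub>, i) \<in> Q" unfolding Q_def using i by (intro polys_over.var) (simp add: block_vars_def)
        moreover have "E.pe (mpoly_var (\<one>\<^bsub>G\<^esub>, i)) = \<alpha> h" unfolding E.eval_var by (simp add: \<rho>_def i)
        ultimately show ?thesis by blast
      next
        case False
        with incl obtain c where c: "c \<in> F" "h = \<gamma> c" by blast
        have "mpoly_const c \<in> Q" unfolding Q_def using c by (intro polys_over.const)
        moreover have "E.pe (mpoly_const c) = \<alpha> h" unfolding E.eval_const using c \<gamma>(2) by simp
        ultimately show ?thesis by blast
      qed
    next
      case (a_inv h)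
      then obtain f where f: "f \<in> Q" "E.pe f = \<alpha> h" by blast
      have h: "h \<in> carrier A" using a_inv.hyps gen(3) by simp
      \<comment> \<open>Negation is realized as multiplication by -1, which lies in
        \<open>F\<close>.\<close>
      have "mpoly_const (- 1) * f \<in> Q"
        using f(1) unfolding Q_def by (intro polys_over.intros F_closed)
      moreover have "\<beta> (- 1) = \<ominus>\<^bsub>T\<^esub> \<one>\<^bsub>T\<^esub>"
        using E.eval_uminus[of "mpoly_const 1"] E.\<phi>.hom_a_inv[of 1] by simp
      then have "E.pe (mpoly_const (- 1) * f) = \<alpha> (\<ominus>\<^bsub>A\<^esub> h)"
        unfolding E.eval_mult E.eval_const f(2) using h by (simp add: T.l_minus)
      ultimately show ?case by blast
    next
      case (eng_add h1 h2)
      then obtain f1 f2 where f: "f1 \<in> Q" "E.pe f1 = \<alpha> h1" "f2 \<in> Q" "E.pe f2 = \<alpha> h2" by blast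
      have h: "h1 \<in> carrier A" "h2 \<in> carrier A" using eng_add.hyps gen(3) by simp_all
      have "f1 + f2 \<in> Q" using f unfolding Q_def by (intro polys_over.add)
      moreover have "E.pe (f1 + f2) = \<alpha> (h1 \<oplus>\<^bsub>A\<^esub> h2)" unfolding E.eval_add f using h by simp
      ultimately show ?case by blast
    next
      case (eng_mult h1 h2)
      then obtain f1 f2 where f: "f1 \<in> Q" "E.pe f1 = \<alpha> h1" "f2 \<in> Q" "E.pe f2 = \<alpha> h2" by blast
      have h: "h1 \<in> carrier A" "h2 \<in> carrier A" using eng_mult.hyps gen(3) by simp_all
      have "f1 * f2 \<in> Q" using f unfolding Q_def by (intro polys_over.mult)
      moreover have "E.pe (f1 * f2) = \<alpha> (h1 \<otimes>\<^bsub>A\<^esub> h2)" unfolding E.eval_mult f using h by simp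
      ultimately show ?case by blast
    qed
  qed
  \<comment> \<open>Two representatives differ by a polynomial whose value in \<open>T\<close> is
    zero, hence in \<open>P\<close>, and the constants \<open>a\<close> are a zero of it.\<close>
  have well_def: "V.pe f = V.pe f'" if "f \<in> Q" "f' \<in> Q" "E.pe f = E.pe f'" for f f'
  proof -
    have "E.pe (f - f') = \<zero>\<^bsub>T\<^esub>"
      unfolding E.eval_diff that(3) a_minus_def by (rule T.r_neg[OF E.eval_closed])
    then have "E.pe (f - f') \<in> P" using P.zero_closed by metis
    moreover have "f - f' \<in> carrier (mpoly_ring (block_vars G n))"
      by (intro mpoly_ring_closed Q_ring that)
    ultimately have "V.pe (f - f') = 0" using vanish unfolding mpoly_subst_eq_poly_eval by blast
    then show ?thesis unfolding V.eval_diff type_ring_minus by simp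
  qed
  define \<psi> where "\<psi> x = V.pe (SOME f. f \<in> Q \<and> E.pe f = \<alpha> x)" for x
  have \<psi>: "\<psi> x = V.pe f" if "f \<in> Q" "E.pe f = \<alpha> x" for f x
  proof -
    have "(SOME f. f \<in> Q \<and> E.pe f = \<alpha> x) \<in> Q \<and> E.pe (SOME f. f \<in> Q \<and> E.pe f = \<alpha> x) = \<alpha> x"
      by (rule someI[of _ f]) (use that in blast)
    then show ?thesis unfolding \<psi>_def using that by (intro well_def) auto
  qed
  have "\<psi> \<in> ring_hom A ring_of_type_algebra"
  proof (rule ring_hom_memI)
    fix x y assume xy: "x \<in> carrier A" "y \<in> carrier A"
    then obtain f g where f: "f \<in> Q" "E.pe f = \<alpha> x" and g: "g \<in> Q" "E.pe g = \<alpha> y" using surj by metis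
    have "f * g \<in> Q" "f + g \<in> Q" using f g unfolding Q_def by (auto intro: polys_over.intros)
    moreover have "E.pe (f * g) = \<alpha> (x \<otimes>\<^bsub>A\<^esub> y)" "E.pe (f + g) = \<alpha> (x \<oplus>\<^bsub>A\<^esub> y)"
      unfolding E.eval_mult E.eval_add f g using xy by simp_all
    ultimately have "\<psi> (x \<otimes>\<^bsub>A\<^esub> y) = V.pe (f * g)" "\<psi> (x \<oplus>\<^bsub>A\<^esub> y) = V.pe (f + g)"
      using \<psi> by blast+
    then show "\<psi> (x \<otimes>\<^bsub>A\<^esub> y) = \<psi> x \<otimes>\<^bsub>ring_of_type_algebra\<^esub> \<psi> y"
      "\<psi> (x \<oplus>\<^bsub>A\<^esub> y) = \<psi> x \<oplus>\<^bsub>ring_of_type_algebra\<^esub> \<psi> y"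
      unfolding \<psi>[OF f] \<psi>[OF g] V.eval_mult V.eval_add by auto
  next
    have "mpoly_const 1 \<in> Q" unfolding Q_def by (intro polys_over.const F_closed)
    moreover have "E.pe (mpoly_const 1) = \<alpha> \<one>\<^bsub>A\<^esub>" unfolding E.eval_const by simp
    ultimately show "\<psi> \<one>\<^bsub>A\<^esub> = \<one>\<^bsub>ring_of_type_algebra\<^esub>" using \<psi> V.eval_const by simp
  qed simp
  moreover have "\<psi> x \<in> F" if "x \<in> carrier A" for x
    using surj[OF that] \<psi> Q_F by metis
  moreover have "\<psi> (\<gamma> c) = c" if "c \<in> F" for c
  proof -
    have "mpoly_const c \<in> Q" unfolding Q_def using that by (intro polys_over.const)
    moreover have "E.pe (mpoly_const c) = \<alpha> (\<gamma> c)" unfolding E.eval_const using that \<gamma>(2) by simp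
    ultimately show ?thesis using \<psi> V.eval_const by metis
  qed
  ultimately show ?thesis by blast
qed

text \<open>One affine chart suffices, because a rational point found in it is rational on
  \<open>Z\<close>. The homomorphism from its sections to \<open>F\<close> is supplied by
  \<open>hom_to_constants\<close>.\<close>

theorem G_TCF_constants_strongly_PAC:
  fixes G :: "('g, 'm) monoid_scheme" and \<sigma> :: "'g \<Rightarrow> 'k::field \<Rightarrow> 'k"
  assumes G: "group G" and TCF: "models_G_TCF G \<sigma>"
  shows "strongly_PAC TYPE('v) TYPE('b) TYPE('w) TYPE('c) (constants G \<sigma>)"
  unfolding strongly_PAC_def
proof (intro conjI allI impI)
  define F where "F = constants G \<sigma>"
  have tf: "transformal_field G \<sigma>" using TCF by (simp add: models_G_TCF_def)
  note F_closed = constants_closed[OF tf, folded F_def]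
  show "subfield (constants G \<sigma>) ring_of_type_algebra" by (rule constants_subfield[OF tf])
  fix Z :: "('v, 'b, 'k) ringed_space"
  assume "variety_over (constants G \<sigma>) Z \<and>
    irreducible_over_field TYPE('w) TYPE('c) (constants G \<sigma>) Z"
  then obtain W :: "('w, 'c, 'k) ringed_space" and p q where
    var: "variety_over F Z" and bc: "is_base_change F Z W p q" and irr: "irreducible_space (topo W)"
    unfolding irreducible_over_field_def F_def by blast
  have schZ: "scheme_over F Z" using var by (simp add: variety_over_def)
  have schW: "scheme_over UNIV W" and mor: "morphism_over F W Z p q"
    using bc by (simp_all add: is_base_change_def)
  have lrZ: "locally_ringed Z" and lrW: "locally_ringed W"
    using schZ schW by (simp_all add: scheme_over_def scheme_def)
  interpret Z: locally_ringed_space Z by (rule locally_ringed_space.intro[OF lrZ])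
  interpret W: locally_ringed_space W by (rule locally_ringed_space.intro[OF lrW])
  obtain \<C> where \<C>: "\<Union>\<C> = topspace (topo Z)"
    "\<forall>U\<in>\<C>. affine_open Z U \<and> (\<exists>S. finite S \<and> S \<subseteq> carrier (sect Z U) \<and>
      generate_ring (sect Z U) (cst_on Z U ` F \<union> S) = carrier (sect Z U))"
    using var unfolding variety_over_def by blast
  have cont: "continuous_map (topo W) (topo Z) p" using mor by (simp add: morphism_over_def)
  \<comment> \<open>An irreducible space is nonempty, so some chart of \<open>Z\<close> meets the
    image of \<open>W\<close>. Its preimage is nonempty, and the vanishing ideal there is
    proper.\<close>
  have "topspace (topo W) \<noteq> {}" using irr unfolding irreducible_space_def by (rule conjunct1)
  then obtain w where w: "w \<in> topspace (topo W)" by blast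
  have "p w \<in> topspace (topo Z)" using cont w by (auto simp: continuous_map_def)
  then obtain U where U\<C>: "U \<in> \<C>" "p w \<in> U" using \<C>(1) by blast
  with \<C>(2) obtain S where U: "affine_open Z U" and S: "finite S" "S \<subseteq> carrier (sect Z U)"
    "generate_ring (sect Z U) (cst_on Z U ` F \<union> S) = carrier (sect Z U)" by blast
  define pre where "pre V = {y \<in> topspace (topo W). p y \<in> V}" for V
  have mor': "\<And>V. openin (topo Z) V \<Longrightarrow> q V \<in> ring_hom (sect Z V) (sect W (pre V))"
    "\<And>V V' s. openin (topo Z) V \<Longrightarrow> openin (topo Z) V' \<Longrightarrow> V' \<subseteq> V \<Longrightarrow> s \<in> carrier (sect Z V) \<Longrightarrow>
      rstr W (pre V) (pre V') (q V s) = q V' (rstr Z V V' s)"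
    "\<And>c. c \<in> F \<Longrightarrow> q (topspace (topo Z)) (cst Z c) = cst W c"
  proof -
    note m = mor[unfolded morphism_over_def Let_def, folded pre_def, THEN conjunct2]
    show "q V \<in> ring_hom (sect Z V) (sect W (pre V))" if "openin (topo Z) V" for V
      using m[THEN conjunct1] that by blast
    show "rstr W (pre V) (pre V') (q V s) = q V' (rstr Z V V' s)"
      if "openin (topo Z) V" "openin (topo Z) V'" "V' \<subseteq> V" "s \<in> carrier (sect Z V)" for V V' s
      using m[THEN conjunct2, THEN conjunct1] that by blast
    show "q (topspace (topo Z)) (cst Z c) = cst W c" if "c \<in> F" for c
      using m[THEN conjunct2, THEN conjunct2, THEN conjunct2] that by blast
  qed
  have U': "affine_open W (pre U)"
    "is_tensor_with_field F (sect Z U) (sect W (pre U)) (q U) (cst_on W (pre U))"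
    using bc[unfolded is_base_change_def Let_def, folded pre_def, THEN conjunct2, THEN conjunct2,
        THEN spec, THEN mp, OF U] by (rule conjunct1, rule conjunct2)
  have oU: "openin (topo Z) U" by (rule Z.affine_openin[OF U])
  have oU': "openin (topo W) (pre U)" by (rule W.affine_openin[OF U'(1)])
  have ne: "pre U \<noteq> {}" using w U\<C> by (auto simp: pre_def)
  let ?TZ = "topspace (topo Z)" and ?TW = "topspace (topo W)"
  have pre_top: "pre ?TZ = ?TW"
    using cont by (auto simp: pre_def continuous_map_def)
  have sub: "U \<subseteq> ?TZ" "pre U \<subseteq> ?TW" using oU oU' by (auto dest: openin_subset)
  have cstZ: "cst Z c \<in> carrier (sect Z ?TZ)" if "c \<in> F" for c
    using schZ that by (auto simp: scheme_over_def ring_hom_def)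
  have "cst W \<in> ring_hom ring_of_type_algebra (sect W ?TW)"
    using schW by (simp add: scheme_over_def)
  then have \<beta>: "cst_on W (pre U) \<in> ring_hom ring_of_type_algebra (sect W (pre U))"
    using ring_hom_trans[OF _ W.rstr_hom[OF openin_topspace oU' sub(2)]]
    unfolding cst_on_def comp_def by blast
  have \<gamma>: "cst_on Z U c \<in> carrier (sect Z U)" "q U (cst_on Z U c) = cst_on W (pre U) c" if "c \<in> F" for c
  proof -
    show "cst_on Z U c \<in> carrier (sect Z U)"
      unfolding cst_on_def by (rule Z.rstr_closed[OF openin_topspace oU sub(1) cstZ[OF that]])
    show "q U (cst_on Z U c) = cst_on W (pre U) c"
      using mor'(2)[OF openin_topspace oU sub(1) cstZ[OF that]]
      unfolding cst_on_def mor'(3)[OF that] pre_top by (rule sym)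
  qed
  have free: "\<forall>k\<in>B. a k = \<zero>\<^bsub>sect Z U\<^esub>"
    if "finite B" "lin_indep_over F B" "a \<in> B \<rightarrow> carrier (sect Z U)"
      "(\<Oplus>\<^bsub>sect W (pre U)\<^esub>k\<in>B. q U (a k) \<otimes>\<^bsub>sect W (pre U)\<^esub> cst_on W (pre U) k) = \<zero>\<^bsub>sect W (pre U)\<^esub>" for B a
    using U'(2) that unfolding is_tensor_with_field_def by blast
  have "\<exists>\<psi>. \<psi> \<in> ring_hom (sect Z U) ring_of_type_algebra \<and>
      (\<forall>a\<in>carrier (sect Z U). \<psi> a \<in> F) \<and> (\<forall>c\<in>F. \<psi> (cst_on Z U c) = c)"
    by (rule hom_to_constants[OF G TCF F_def Z.sect_cring[OF oU] W.sect_cring[OF oU'] mor'(1)[OF oU] \<beta> \<gamma> free S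
        W.vanishing_prime[OF irr oU' ne] W.vanishing_imp_nilpotent[OF U'(1)]])
  then obtain \<psi> where \<psi>: "\<psi> \<in> ring_hom (sect Z U) ring_of_type_algebra"
    and \<psi>_F: "\<And>a. a \<in> carrier (sect Z U) \<Longrightarrow> \<psi> a \<in> F"
    and \<psi>_cst: "\<And>c. c \<in> F \<Longrightarrow> \<psi> (cst_on Z U c) = c"
    by blast
  interpret A: cring "sect Z U" by (rule Z.sect_cring[OF oU])
  interpret K: field "ring_of_type_algebra :: 'k ring" by (rule type_ring_field)
  interpret \<psi>: ring_hom_ring "sect Z U" "ring_of_type_algebra :: 'k ring" \<psi>
    by (intro ring_hom_ringI2 A.ring_axioms K.ring_axioms \<psi>)
  \<comment> \<open>The kernel of \<open>\<psi>\<close> is prime because the target is a field; as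
    \<open>U\<close> is affine, it is the ideal of a point of \<open>U\<close>.\<close>
  have "primeideal {a \<in> carrier (sect Z U). \<psi> a \<in> {\<zero>\<^bsub>ring_of_type_algebra\<^esub>}} (sect Z U)"
    by (rule \<psi>.primeideal_vimage[OF A.cring_axioms K.zeroprimeideal])
  from Z.affine_point_of_prime[OF U this] obtain x where x: "x \<in> U"
    "{s \<in> carrier (sect Z U). \<not> unit_germ Z U s x} = {s \<in> carrier (sect Z U). \<psi> s = 0}" by auto
  have "rational_point F Z x"
    by (rule rational_point_of_hom[OF lrZ U x(1) cstZ \<psi> \<psi>_F \<psi>_cst x(2) F_closed(4,6,7)])
  then show "\<exists>x. rational_point (constants G \<sigma>) Z x" unfolding F_def by blast
qed

theorem corollary3p23:
  fixes G :: "('g, 'm) monoid_scheme" and \<sigma> :: "'g \<Rightarrow> 'k::field \<Rightarrow> 'k"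
  assumes "group G" and "finite (carrier G)"
    and "models_G_TCF G \<sigma>"
  shows "bounded_field (constants G \<sigma>) \<and>
    strongly_PAC TYPE('v) TYPE('b) TYPE('w) TYPE('c) (constants G \<sigma>)"
  using G_TCF_constants_bounded[OF assms] G_TCF_constants_strongly_PAC[OF assms(1,3)] by (rule conjI)

end
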